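(* Let $\boldsymbol{A}\in \mathbb{DQ}^{m \times n}$, $\boldsymbol{B}\in \mathbb{DQ}^{p \times n}$, $\boldsymbol{C}=\begin{pmatrix}\boldsymbol{A}\\ \boldsymbol{B}\end{pmatrix}\in \mathbb{DQ}^{(m+p) \times n}$, and $\mathrm{Arank}(\boldsymbol{C})=t$. There exist unitary dual quaternion matrices $\boldsymbol{U}\in \mathbb{DQ}^{m \times m}$, $\boldsymbol{V}\in \mathbb{DQ}^{p \times p}$ and a dual quaternion matrix $\boldsymbol{X}\in \mathbb{DQ}^{n \times n}$ such that $$\boldsymbol{U}^{*}\boldsymbol{A}\boldsymbol{X}=(\Sigma_{\boldsymbol{A}},\ 0),\qquad \boldsymbol{V}^{*}\boldsymbol{B}\boldsymbol{X}=(\Sigma_{\boldsymbol{B}},\ 0),$$ where, for some nonnegative integers $r,r_1,q,l$ with $r_1\le r$, the matrices $\Sigma_{\boldsymbol{A}}$ ($m\times t$) and $\Sigma_{\boldsymbol{B}}$ ($p\times t$) are $$\Sigma_{\boldsymbol{A}}=\begin{pmatrix} I&0&0&0\\ 0&S_{\boldsymbol{A}}&0&0\\ 0&0&\Xi\epsilon&0\\ 0&0&0&0\end{pmatrix},\qquad \Sigma_{\boldsymbol{B}}=\begin{pmatrix}\Sigma\epsilon&0&0&0\\ 0&0&0&0\\ 0&0&S_{\boldsymbol{B}}&0\\ 0&0&0&I\end{pmatrix};$$ the block rows of $\Sigma_{\boldsymbol{A}}$ have sizes $r,\ q,\ l,\ m-r-q-l$ and its block columns have sizes $r,\ q,\ l,\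 t-(r+q+l)$; the block rows of $\Sigma_{\boldsymbol{B}}$ have sizes $r_1,\ p-t+r-r_1,\ q,\ t-(r+q)$ and its block columns have sizes $r_1,\ r-r_1,\ q,\ t-(r+q)$. Here $\Sigma=\mathrm{diag}(\sigma_1,\dots,\sigma_{r_1})$ and $\Xi=\mathrm{diag}(\xi_1,\dots,\xi_l)$ are real with $\sigma_1\ge\cdots\ge\sigma_{r_1}>0$, $\xi_1\ge\cdots\ge\xi_l>0$, and $S_{\boldsymbol{A}}=\mathrm{diag}(c_1,\dots,c_q)$, $S_{\boldsymbol{B}}=\mathrm{diag}(s_1,\dots,s_q)$ have appreciable dual number entries with $0<c_1\le\cdots\le c_q<1$, $1>s_1\ge\cdots\ge s_q>0$, and $c_i^2+s_i^2=1$ for $i=1,\dots,q$.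
   Context: Dual numbers: $\mathbb{D}=\{a+b\epsilon: a,b\in\mathbb{R}\}$ with $\epsilon\neq0$, $\epsilon^2=0$; $a+b\epsilon$ is appreciable if $a\ne0$ and infinitesimal otherwise. $\mathbb{D}$ is totally ordered lexicographically: $a+b\epsilon>a'+b'\epsilon$ iff $a>a'$, or $a=a'$ and $b>b'$. $\mathbb{Q}$ denotes the real (Hamilton) quaternions, and $\mathbb{DQ}=\{\mathbf{q}_{st}+\mathbf{q}_{in}\epsilon:\mathbf{q}_{st},\mathbf{q}_{in}\in\mathbb{Q}\}$ the dual quaternions, where $\epsilon$ commutes with quaternions; conjugation is $\mathbf{q}_{st}^*+\mathbf{q}_{in}^*\epsilon$. For a matrix $\boldsymbol{A}$ over $\mathbb{DQ}$, $\boldsymbol{A}^*$ is its conjugate transpose. A square $\boldsymbol{U}$ is unitary if $\boldsymbol{U}^*\boldsymbol{U}=\boldsymbol{U}\boldsymbol{U}^*=I$. Appreciable rank: every $\boldsymbol{A}\in\mathbb{DQ}^{m\times n}$ has a singular value decomposition (known) $\boldsymbol{U}^*\boldsymbol{A}\boldsymbol{V}=\begin{pmatrix}\mathrm{diag}(\mu_1,\dots,\mu_t)&0\\0&0\end{pmatrix}$ with $\boldsymbol{U},\boldsymbol{V}$ unitary, $\mu_1\ge\cdots\ge\mu_r$ positive appreciable dual numbers and $\mu_{r+1}\ge\cdots\ge\mu_t$ positive infinitesimal dual numbers; the $\mu_i$ are unique. Then $\mathrm{rank}(\boldsymbol{A})=t$ and $\mathrm{Arank}(\boldsymbol{A})=r$.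 $I$ and $0$ denote identity and zero blocks of suitable size; blocks with zero rows or columns are allowed (empty). *)

theory Defs
  imports Complex_Main "Jordan_Normal_Form.Matrix"
begin

section \<open>Real quaternions\<close>

datatype quat = Quat (qre: real) (qi: real) (qj: real) (qk: real)

lemma quat_eq_iff: "x = y \<longleftrightarrow> qre x = qre y \<and> qi x = qi y \<and> qj x = qj y \<and> qk x = qk y"
  by (cases x; cases y) simp

instantiation quat :: real_algebra_1
begin

definition "0 = Quat 0 0 0 0"
definition "1 = Quat 1 0 0 0"
definition "x + y = Quat (qre x + qre y) (qi x + qi y) (qj x + qj y) (qk x + qk y)"
definition "- x = Quat (- qre x) (- qi x) (- qj x) (- qk x)"
definition "x - y = Quat (qre x - qre y) (qi x - qi y) (qj x - qj y) (qk x - qk y)"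
definition "x * y = Quat
  (qre x * qre y - qi x * qi y - qj x * qj y - qk x * qk y)
  (qre x * qi y + qi x * qre y + qj x * qk y - qk x * qj y)
  (qre x * qj y - qi x * qk y + qj x * qre y + qk x * qi y)
  (qre x * qk y + qi x * qj y - qj x * qi y + qk x * qre y)"
definition "c *\<^sub>R x = Quat (c * qre x) (c * qi x) (c * qj x) (c * qk x)"

instance
  by standard
    (auto simp: quat_eq_iff zero_quat_def one_quat_def plus_quat_def uminus_quat_def
      minus_quat_def times_quat_def scaleR_quat_def algebra_simps)

end

definition quat_cnj :: "quat \<Rightarrow> quat" where
  "quat_cnj x = Quat (qre x) (- qi x) (- qj x) (- qk x)"

section \<open>Dual extensions\<close>

text \<open>\<open>Dual a b\<close> stands for \<open>a + b\<epsilon>\<close> with \<open>\<epsilon>\<^sup>2 = 0\<close> and \<open>\<epsilon>\<close> central. The dual numbers are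
  \<open>real dual\<close> and the dual quaternions are \<open>quat dual\<close>.\<close>

datatype 'a dual = Dual (st_part: 'a) (in_part: 'a)

lemma dual_eq_iff: "x = y \<longleftrightarrow> st_part x = st_part y \<and> in_part x = in_part y"
  by (cases x; cases y) simp

instantiation dual :: (ring_1) ring_1
begin

definition "0 = Dual 0 0"
definition "1 = Dual 1 0"
definition "x + y = Dual (st_part x + st_part y) (in_part x + in_part y)"
definition "- x = Dual (- st_part x) (- in_part x)"
definition "x - y = Dual (st_part x - st_part y) (in_part x - in_part y)"
definition "x * y = Dual (st_part x * st_part y) (st_part x * in_part y + in_part x * st_part y)"

instance
  by standard
    (auto simp: dual_eq_iff zero_dual_def one_dual_def plus_dual_def uminus_dual_def
      minus_dual_def times_dual_def algebra_simps)

end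

instance dual :: (comm_ring_1) comm_ring_1
  by standard (auto simp: dual_eq_iff one_dual_def plus_dual_def times_dual_def algebra_simps)

instantiation dual :: (linorder) linorder
begin

definition "x \<le> y \<longleftrightarrow> st_part x < st_part y \<or> st_part x = st_part y \<and> in_part x \<le> in_part y"
definition "x < y \<longleftrightarrow> st_part x < st_part y \<or> st_part x = st_part y \<and> in_part x < in_part y"

instance
  by standard (auto simp: less_eq_dual_def less_dual_def dual_eq_iff)

end

definition appreciable :: "real dual \<Rightarrow> bool" where
  "appreciable x \<longleftrightarrow> st_part x \<noteq> 0"

definition dq_of_dual :: "real dual \<Rightarrow> quat dual" where
  "dq_of_dual = map_dual of_real"

definition dq_cnj :: "quat dual \<Rightarrow> quat dual" where
  "dq_cnj = map_dual quat_cnj"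

section \<open>Dual quaternion matrices\<close>

definition dq_adjoint :: "quat dual mat \<Rightarrow> quat dual mat" where
  "dq_adjoint A = transpose_mat (map_mat dq_cnj A)"

definition dq_unitary :: "nat \<Rightarrow> quat dual mat \<Rightarrow> bool" where
  "dq_unitary n U \<longleftrightarrow> U \<in> carrier_mat n n \<and>
     dq_adjoint U * U = 1\<^sub>m n \<and> U * dq_adjoint U = 1\<^sub>m n"

definition dual_diag :: "nat \<Rightarrow> (nat \<Rightarrow> real dual) \<Rightarrow> quat dual mat" where
  "dual_diag n d = mat_diag n (\<lambda>i. dq_of_dual (d i))"

text \<open>The singular values \<open>\<mu>\<^sub>1, \<dots>, \<mu>\<^sub>t\<close> are \<open>\<mu> 0, \<dots>, \<mu> (t - 1)\<close>; the first \<open>r\<close> of them are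
  appreciable, the others infinitesimal.\<close>

definition dq_svd :: "quat dual mat \<Rightarrow> quat dual mat \<Rightarrow> quat dual mat \<Rightarrow>
    nat \<Rightarrow> nat \<Rightarrow> (nat \<Rightarrow> real dual) \<Rightarrow> bool" where
  "dq_svd A U V r t \<mu> \<longleftrightarrow>
     dq_unitary (dim_row A) U \<and> dq_unitary (dim_col A) V \<and>
     r \<le> t \<and> t \<le> dim_row A \<and> t \<le> dim_col A \<and>
     (\<forall>i<t. 0 < \<mu> i) \<and>
     (\<forall>i<r. appreciable (\<mu> i)) \<and> monotone_on {..<r} (\<le>) (\<ge>) \<mu> \<and>
     (\<forall>i\<in>{r..<t}. \<not> appreciable (\<mu> i)) \<and> monotone_on {r..<t} (\<le>) (\<ge>) \<mu> \<and>
     dq_adjoint U * A * V =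
       diag_block_mat [dual_diag t \<mu>, 0\<^sub>m (dim_row A - t) (dim_col A - t)]"

text \<open>Every dual quaternion matrix has a singular value decomposition and its singular values
  are unique, so the description determines a number.\<close>

definition Arank :: "quat dual mat \<Rightarrow> nat" where
  "Arank A = (THE r. \<exists>U V t \<mu>. dq_svd A U V r t \<mu>)"

definition append_cols :: "'a :: zero mat \<Rightarrow> 'a mat \<Rightarrow> 'a mat" where
  "append_cols A B = four_block_mat A B (0\<^sub>m 0 (dim_col A)) (0\<^sub>m 0 (dim_col B))"

end

theory Submission
  imports Defs "HOL-Analysis.Function_Topology"
begin

text \<open>
  The matrix \<open>X\<close> need not be invertible, so only the part of \<open>C\<close> (\<open>A\<close> stacked on \<open>B\<close>) that belongs to
  its \<open>t\<close> appreciable singular values matters.  If \<open>C = U D V\<^sup>*\<close> is a singular value decomposition,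
  the first \<open>t\<close> columns of \<open>V\<close>, divided by the (invertible) appreciable singular values, form an
  \<open>n \<times> t\<close> matrix \<open>Z\<close> such that \<open>C Z\<close> has orthonormal columns (\<open>orthonormal_reduction\<close>).  Then
  \<open>P = A Z\<close> and \<open>Q = B Z\<close> satisfy \<open>P\<^sup>* P + Q\<^sup>* Q = I\<close>, and what remains is a CS decomposition of the
  pair \<open>P, Q\<close> over the dual quaternions (\<open>cs_decomposition\<close>).

  For the CS decomposition, diagonalise \<open>P\<close> by its singular value decomposition.  Then \<open>Q\<^sup>* Q = I - P\<^sup>* P\<close>
  is diagonal too, with entries \<open>1 - c\<^sup>2\<close>.  A column of \<open>Q\<close> whose squared norm is infinitesimal has
  standard part \<open>0\<close>, hence squared norm exactly \<open>0\<close>; so a cosine with standard part \<open>1\<close> equals \<open>1\<close>.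
  The other columns of \<open>Q\<close> have invertible norm \<open>s = sqrt (1 - c\<^sup>2)\<close>, which is \<open>1\<close> whenever \<open>c\<close> is
  infinitesimal; normalised, they extend to a unitary matrix (\<open>unitary_completion\<close>).  In the new
  basis the columns with cosine \<open>1\<close> form a block of infinitesimal entries that is orthogonal to the rest;
  its own singular value decomposition produces \<open>\<Sigma>\<epsilon>\<close> and leaves the other blocks untouched.

  Everything rests on the singular value decomposition over the dual quaternions
  (\<open>dual_quaternion_svd\<close>), used four times: for \<open>C\<close>, for \<open>P\<close>, for the completion and for the infinitesimal
  block.  It is obtained from a variational principle.  Fix strictly decreasing positive weights \<open>w\<^sub>i\<close>
  and, over all pairs of unitary real-quaternion matrices, maximise the dual number
  \<open>\<Sum>\<^sub>i w\<^sub>i Re (U\<^sup>* A V)\<^sub>i\<^sub>i\<close> in the lexicographic order; a maximum exists by compactness.  At the maximum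
  the standard part of \<open>U\<^sup>* A V\<close> is stationary under all plane rotations, which makes it diagonal, and the
  infinitesimal part is stationary under those rotations that fix the standard part, which makes it
  diagonal inside every block of equal singular values, up to a skew part (\<open>lex_maximal_structure\<close>).
  What is left over is removed by factors \<open>I + \<epsilon> S\<close> with \<open>S\<close> skew-Hermitian, for which a linear
  \<open>2 \<times> 2\<close> system has to be solved for each pair of indices (\<open>diagonalise_lex_maximal\<close>).

  The number of appreciable singular values does not depend on the decomposition, so that \<open>Arank\<close> is well
  defined: it is the real trace of the orthogonal projection onto the range of the standard part, and an
  orthogonal projection is determined by its range (\<open>range_projection_unique\<close>).
\<close>

section \<open>Matrices over a ring with involution\<close>

text \<open>Quaternions are needed beside dual quaternions because the variational argument takes place among
  standard matrices; a class of rings with an involution lets both share the algebra of adjoints.\<close>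

class star_ring = ring_1 +
  fixes star :: "'a \<Rightarrow> 'a"
  assumes star_add: "star (x + y) = star x + star y"
    and star_mult: "star (x * y) = star y * star x"
    and star_star [simp]: "star (star x) = x"
begin

lemma star_0 [simp]: "star 0 = 0"
  using star_add [of 0 0] by simp

lemma star_1 [simp]: "star 1 = 1"
  by (metis star_mult star_star mult_1 mult_1_right)

lemma star_minus: "star (- x) = - star x"
  using star_add [of x "- x"] by (simp add: eq_neg_iff_add_eq_0 add.commute)

lemma star_sum: "star (sum f I) = (\<Sum>i\<in>I. star (f i))"
  by (induction I rule: infinite_finite_induct) (auto simp: star_add)

end

lemmas quat_defs = zero_quat_def one_quat_def plus_quat_def uminus_quat_def
  minus_quat_def times_quat_def scaleR_quat_def

lemmas dual_defs = zero_dual_def one_dual_def plus_dual_def uminus_dual_def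
  minus_dual_def times_dual_def

instantiation quat :: star_ring
begin

definition star_quat_def: "star = quat_cnj"

instance
  by standard (auto simp: star_quat_def quat_cnj_def quat_defs algebra_simps)

end

instantiation dual :: (star_ring) star_ring
begin

definition star_dual_def: "star = map_dual star"

instance
proof
  fix x y :: "'a dual"
  show "star (x + y) = star x + star y" "star (x * y) = star y * star x" "star (star x) = x"
    by (cases x; cases y; simp add: star_dual_def plus_dual_def times_dual_def star_add star_mult)+
qed

end

lemma st_part_simps [simp]:
  "st_part 0 = 0" "st_part 1 = 1" "st_part (x + y) = st_part x + st_part y"
  "st_part (- x) = - st_part x" "st_part (x - y) = st_part x - st_part y"
  "st_part (x * y) = st_part x * st_part y" "st_part (star z) = star (st_part z)"
  by (auto simp: dual_defs star_dual_def dual.map_sel)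

lemma in_part_simps [simp]:
  "in_part 0 = 0" "in_part 1 = 0" "in_part (x + y) = in_part x + in_part y"
  "in_part (- x) = - in_part x" "in_part (x - y) = in_part x - in_part y"
  "in_part (x * y) = st_part x * in_part y + in_part x * st_part y"
  "in_part (star z) = star (in_part z)"
  by (auto simp: dual_defs star_dual_def dual.map_sel)

lemma st_part_sum [simp]: "st_part (sum f I) = (\<Sum>i\<in>I. st_part (f i))"
  by (induction I rule: infinite_finite_induct) auto

lemma in_part_sum [simp]: "in_part (sum f I) = (\<Sum>i\<in>I. in_part (f i))"
  by (induction I rule: infinite_finite_induct) auto

lemma dq_cnj_eq_star: "dq_cnj = star"
  by (simp add: dq_cnj_def star_dual_def star_quat_def)

definition adjoint :: "'a::star_ring mat \<Rightarrow> 'a mat" where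
  "adjoint A = transpose_mat (map_mat star A)"

definition unitary :: "nat \<Rightarrow> 'a::star_ring mat \<Rightarrow> bool" where
  "unitary n U \<longleftrightarrow> U \<in> carrier_mat n n \<and> adjoint U * U = 1\<^sub>m n \<and> U * adjoint U = 1\<^sub>m n"

lemma dq_adjoint_eq_adjoint: "dq_adjoint = adjoint"
  by (simp add: dq_adjoint_def adjoint_def dq_cnj_eq_star fun_eq_iff)

lemma dq_unitary_eq_unitary: "dq_unitary = unitary"
  by (simp add: dq_unitary_def unitary_def dq_adjoint_eq_adjoint fun_eq_iff)

lemma mult_mat_entry:
  assumes "A \<in> carrier_mat m k" "B \<in> carrier_mat k n" "i < m" "j < n"
  shows "(A * B) $$ (i,j) = (\<Sum>l<k. A $$ (i,l) * B $$ (l,j))"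
  using assms by (auto simp: scalar_prod_def atLeast0LessThan)

lemma adjoint_carrier [simp, intro]: "A \<in> carrier_mat m n \<Longrightarrow> adjoint A \<in> carrier_mat n m"
  by (auto simp: adjoint_def)

lemma adjoint_dims [simp]: "dim_row (adjoint A) = dim_col A" "dim_col (adjoint A) = dim_row A"
  by (auto simp: adjoint_def)

lemma adjoint_entry [simp]:
  "i < dim_col A \<Longrightarrow> j < dim_row A \<Longrightarrow> adjoint A $$ (i,j) = star (A $$ (j,i))"
  by (auto simp: adjoint_def)

lemma adjoint_adjoint [simp]: "adjoint (adjoint A) = A"
  by (rule eq_matI) auto

lemma adjoint_one [simp]: "adjoint (1\<^sub>m n) = 1\<^sub>m n"
  by (rule eq_matI) auto

lemma adjoint_zero [simp]: "adjoint (0\<^sub>m m n) = 0\<^sub>m n m"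
  by (rule eq_matI) auto

lemma adjoint_mult:
  assumes "A \<in> carrier_mat m k" "B \<in> carrier_mat k n"
  shows "adjoint (A * B) = adjoint B * adjoint A"
proof (rule eq_matI)
  fix i j assume "i < dim_row (adjoint B * adjoint A)" "j < dim_col (adjoint B * adjoint A)"
  then have ij: "i < n" "j < m" using assms by auto
  then have "adjoint (A * B) $$ (i,j) = star (\<Sum>l<k. A $$ (j,l) * B $$ (l,i))"
    using assms by (subst adjoint_entry) (auto simp del: index_mult_mat(1) simp: mult_mat_entry)
  also have "\<dots> = (adjoint B * adjoint A) $$ (i,j)"
    using assms ij by (subst mult_mat_entry[of _ n k _ m]) (auto simp: star_sum star_mult)
  finally show "adjoint (A * B) $$ (i,j) = (adjoint B * adjoint A) $$ (i,j)" .
qed (use assms in auto)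

lemma adjoint_four_block:
  assumes "A \<in> carrier_mat a c" "B \<in> carrier_mat a d" "C \<in> carrier_mat b c" "D \<in> carrier_mat b d"
  shows "adjoint (four_block_mat A B C D) =
    four_block_mat (adjoint A) (adjoint C) (adjoint B) (adjoint D)"
  using assms by (intro eq_matI) auto

lemma unitaryD:
  assumes "unitary n U"
  shows unitary_carrier: "U \<in> carrier_mat n n" "adjoint U \<in> carrier_mat n n"
    and unitary_left: "adjoint U * U = 1\<^sub>m n" and unitary_right: "U * adjoint U = 1\<^sub>m n"
  using assms by (auto simp: unitary_def)

lemma unitary_one: "unitary n (1\<^sub>m n)"
  by (auto simp: unitary_def)

lemma unitary_adjoint: "unitary n U \<Longrightarrow> unitary n (adjoint U)"
  by (auto simp: unitary_def)

lemma unitary_cancel_left: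
  assumes "unitary n U" "A \<in> carrier_mat n k"
  shows "adjoint U * (U * A) = A" "U * (adjoint U * A) = A"
  using unitaryD[OF assms(1)] assms(2)
  by (auto simp flip: assoc_mult_mat[of _ n n _ n _ k])

lemma unitary_cancel_right:
  assumes "unitary n U" "A \<in> carrier_mat k n"
  shows "A * adjoint U * U = A" "A * U * adjoint U = A"
  using unitaryD[OF assms(1)] assms(2)
  by (auto simp: assoc_mult_mat[of _ k n _ n _ n])

lemma unitary_mult:
  assumes "unitary n U" "unitary n V"
  shows "unitary n (U * V)"
proof -
  note c = unitaryD[OF assms(1)] unitaryD[OF assms(2)]
  have "adjoint (U * V) * (U * V) = adjoint V * (adjoint U * (U * V))"
    using c by (simp add: adjoint_mult[of _ n n _ n] assoc_mult_mat[of _ n n _ n _ n]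
      mult_carrier_mat[of _ n n])
  moreover have "U * V * adjoint (U * V) = U * (V * (adjoint V * adjoint U))"
    using c by (simp add: adjoint_mult[of _ n n _ n] assoc_mult_mat[of _ n n _ n _ n]
      mult_carrier_mat[of _ n n])
  ultimately show ?thesis
    using c unitary_cancel_left[OF assms(1)] unitary_cancel_left[OF assms(2)]
    by (auto simp: unitary_def)
qed

lemma unitary_four_block:
  assumes "unitary a U" "unitary b V"
  shows "unitary (a + b) (four_block_mat U (0\<^sub>m a b) (0\<^sub>m b a) V)"
proof -
  note c = unitaryD[OF assms(1)] unitaryD[OF assms(2)]
  show ?thesis
    unfolding unitary_def using c
    by (simp add: adjoint_four_block[of _ a a _ b _ b]
      mult_four_block_mat[of _ a a _ b _ b _ _ a _ b])
qed

section \<open>Standard and infinitesimal parts of matrices\<close>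

abbreviation st_mat :: "'a dual mat \<Rightarrow> 'a mat" where "st_mat \<equiv> map_mat st_part"
abbreviation in_mat :: "'a dual mat \<Rightarrow> 'a mat" where "in_mat \<equiv> map_mat in_part"
abbreviation std_mat :: "'a::zero mat \<Rightarrow> 'a dual mat" where "std_mat \<equiv> map_mat (\<lambda>x. Dual x 0)"

lemma dual_mat_eqI:
  assumes "st_mat A = st_mat B" "in_mat A = in_mat B"
  shows "A = B"
proof (rule eq_matI)
  show d: "dim_row A = dim_row B" "dim_col A = dim_col B"
    using arg_cong[OF assms(1), of dim_row] arg_cong[OF assms(1), of dim_col] by auto
  fix i j assume "i < dim_row B" "j < dim_col B"
  then show "A $$ (i,j) = B $$ (i,j)"
    using d arg_cong[OF assms(1), of "\<lambda>M. M $$ (i,j)"] arg_cong[OF assms(2), of "\<lambda>M. M $$ (i,j)"]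
    by (auto simp: dual_eq_iff)
qed

lemma
  assumes "A \<in> carrier_mat m k" "B \<in> carrier_mat k n"
  shows st_mat_mult: "st_mat (A * B) = st_mat A * st_mat (B :: 'a::ring_1 dual mat)"
    and in_mat_mult: "in_mat (A * B) = st_mat A * in_mat B + in_mat A * st_mat B"
proof -
  show "st_mat (A * B) = st_mat A * st_mat B"
  proof (rule eq_matI)
    fix i j assume "i < dim_row (st_mat A * st_mat B)" "j < dim_col (st_mat A * st_mat B)"
    then show "st_mat (A * B) $$ (i,j) = (st_mat A * st_mat B) $$ (i,j)"
      using assms by (auto simp: scalar_prod_def)
  qed (use assms in auto)
  show "in_mat (A * B) = st_mat A * in_mat B + in_mat A * st_mat B"
    by (rule eq_matI) (use assms in \<open>auto simp: scalar_prod_def sum.distrib\<close>)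
qed

lemma st_mat_adjoint: "st_mat (adjoint A) = adjoint (st_mat A)"
  by (rule eq_matI) auto

lemma in_mat_adjoint: "in_mat (adjoint A) = adjoint (in_mat A)"
  by (rule eq_matI) auto

lemma st_mat_one: "st_mat (1\<^sub>m n :: 'a::ring_1 dual mat) = 1\<^sub>m n"
  by (rule eq_matI) auto

lemma in_mat_one: "in_mat (1\<^sub>m n :: 'a::ring_1 dual mat) = 0\<^sub>m n n"
  by (rule eq_matI) auto

lemma st_mat_std_mat [simp]: "st_mat (std_mat M) = M"
  by (rule eq_matI) auto

lemma in_mat_std_mat [simp]: "in_mat (std_mat M) = 0\<^sub>m (dim_row M) (dim_col M)"
  by (rule eq_matI) auto

lemma unitary_st_mat:
  assumes "unitary n (U :: 'a::star_ring dual mat)"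
  shows "unitary n (st_mat U)"
proof -
  note c = unitaryD[OF assms]
  show ?thesis
    using c(1,2) arg_cong[OF c(3), of st_mat] arg_cong[OF c(4), of st_mat]
    unfolding st_mat_mult[OF c(1,2)] st_mat_mult[OF c(2,1)]
    by (auto simp: unitary_def st_mat_adjoint st_mat_one)
qed

lemma unitary_std_mat:
  assumes "unitary n (U :: 'a::star_ring mat)"
  shows "unitary n (std_mat U)"
proof -
  note c = unitaryD[OF assms]
  have z: "0\<^sub>m n n * X = 0\<^sub>m n n" "X * 0\<^sub>m n n = 0\<^sub>m n n" if "X \<in> carrier_mat n n" for X :: "'a mat"
    using that by auto
  have "adjoint (std_mat U) * std_mat U = 1\<^sub>m n" "std_mat U * adjoint (std_mat U) = 1\<^sub>m n"
    by (rule dual_mat_eqI; use c z in \<open>simp add: st_mat_mult[of _ n n _ n] in_mat_mult[of _ n n _ n]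
      st_mat_adjoint in_mat_adjoint st_mat_one in_mat_one\<close>)+
  then show ?thesis using c by (auto simp: unitary_def)
qed

section \<open>Lexicographic maximisation over pairs of unitary matrices\<close>

text \<open>Compactness is used in the form of Tychonoff's theorem for real coordinates, so continuity of
quaternion-valued and matrix-valued functions is expressed through the real components.\<close>
definition quat_continuous :: "('x::topological_space \<Rightarrow> quat) \<Rightarrow> bool" where
  "quat_continuous f \<longleftrightarrow> continuous_on UNIV (\<lambda>x. qre (f x)) \<and> continuous_on UNIV (\<lambda>x. qi (f x)) \<and>
     continuous_on UNIV (\<lambda>x. qj (f x)) \<and> continuous_on UNIV (\<lambda>x. qk (f x))"

definition mat_continuous :: "nat \<Rightarrow> nat \<Rightarrow> ('x::topological_space \<Rightarrow> quat mat) \<Rightarrow> bool" where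
  "mat_continuous m n F \<longleftrightarrow> (\<forall>x. F x \<in> carrier_mat m n) \<and>
     (\<forall>i<m. \<forall>j<n. quat_continuous (\<lambda>x. F x $$ (i,j)))"

lemma quat_part_simps [simp]:
  "qre (x + y) = qre x + qre y" "qi (x + y) = qi x + qi y"
  "qj (x + y) = qj x + qj y" "qk (x + y) = qk x + qk y"
  "qre (- x) = - qre x" "qi (- x) = - qi x" "qj (- x) = - qj x" "qk (- x) = - qk x"
  "qre (x - y) = qre x - qre y" "qi (x - y) = qi x - qi y"
  "qj (x - y) = qj x - qj y" "qk (x - y) = qk x - qk y"
  "qre (c *\<^sub>R x) = c * qre x" "qi (c *\<^sub>R x) = c * qi x"
  "qj (c *\<^sub>R x) = c * qj x" "qk (c *\<^sub>R x) = c * qk x"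
  "qre (star x) = qre x" "qi (star x) = - qi x" "qj (star x) = - qj x" "qk (star x) = - qk x"
  "qre 0 = 0" "qi 0 = 0" "qj 0 = 0" "qk 0 = 0" "qre 1 = 1" "qi 1 = 0" "qj 1 = 0" "qk 1 = 0"
  by (auto simp: quat_defs star_quat_def quat_cnj_def)

lemma quat_part_mult:
  "qre (x * y) = qre x * qre y - qi x * qi y - qj x * qj y - qk x * qk y"
  "qi (x * y) = qre x * qi y + qi x * qre y + qj x * qk y - qk x * qj y"
  "qj (x * y) = qre x * qj y - qi x * qk y + qj x * qre y + qk x * qi y"
  "qk (x * y) = qre x * qk y + qi x * qj y - qj x * qi y + qk x * qre y"
  by (auto simp: quat_defs)

lemma quat_part_sum [simp]:
  "qre (sum f I) = (\<Sum>i\<in>I. qre (f i))" "qi (sum f I) = (\<Sum>i\<in>I. qi (f i))"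
  "qj (sum f I) = (\<Sum>i\<in>I. qj (f i))" "qk (sum f I) = (\<Sum>i\<in>I. qk (f i))"
  by (induction I rule: infinite_finite_induct; simp)+

lemma quat_continuous_sum_mult:
  assumes "\<And>i. i \<in> I \<Longrightarrow> quat_continuous (f i)" "\<And>i. i \<in> I \<Longrightarrow> quat_continuous (g i)"
  shows "quat_continuous (\<lambda>x. \<Sum>i\<in>I. f i x * g i x)"
  using assms unfolding quat_continuous_def
  by (auto simp: quat_part_mult intro!: continuous_intros)

lemma quat_continuous_star: "quat_continuous f \<Longrightarrow> quat_continuous (\<lambda>x. star (f x))"
  unfolding quat_continuous_def by (auto intro!: continuous_intros)

lemma quat_continuous_const: "quat_continuous (\<lambda>x. c)"
  unfolding quat_continuous_def by (auto intro!: continuous_intros)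

lemma mat_continuous_mult:
  assumes "mat_continuous m k F" "mat_continuous k n G"
  shows "mat_continuous m n (\<lambda>x. F x * G x)"
  unfolding mat_continuous_def
proof safe
  show "F x * G x \<in> carrier_mat m n" for x
    using assms by (auto simp: mat_continuous_def intro!: mult_carrier_mat[of _ m k])
  fix i j assume "i < m" "j < n"
  then show "quat_continuous (\<lambda>x. (F x * G x) $$ (i,j))"
    using assms
    by (subst mult_mat_entry[of _ m k _ n]) (auto simp: mat_continuous_def intro!: quat_continuous_sum_mult)
qed

lemma mat_continuous_adjoint:
  "mat_continuous m n F \<Longrightarrow> mat_continuous n m (\<lambda>x. adjoint (F x))"
proof -
  assume F: "mat_continuous m n F"
  then have "dim_row (F x) = m" "dim_col (F x) = n" for x
    by (auto simp: mat_continuous_def)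
  with F show ?thesis
    by (auto simp: mat_continuous_def intro!: quat_continuous_star)
qed

lemma mat_continuous_const: "C \<in> carrier_mat m n \<Longrightarrow> mat_continuous m n (\<lambda>x. C)"
  by (auto simp: mat_continuous_def quat_continuous_const)

lemma closed_mat_eq:
  assumes F: "mat_continuous m n F" and C: "C \<in> carrier_mat m n"
  shows "closed {x. F x = C}"
proof -
  have "{x. F x = C} = (\<Inter>i\<in>{..<m}. \<Inter>j\<in>{..<n}. {x. F x $$ (i,j) = C $$ (i,j)})"
    using F C by (auto simp: mat_continuous_def intro!: eq_matI)
  moreover have "closed {x. F x $$ (i,j) = C $$ (i,j)}" if "i < m" "j < n" for i j
    using F that unfolding quat_eq_iff mat_continuous_def quat_continuous_def
    by (auto intro!: closed_Collect_conj closed_Collect_eq continuous_intros)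
  ultimately show ?thesis by (auto intro!: closed_INT)
qed

text \<open>A lexicographic maximum over a compact set exists although the lexicographic order does not induce the
product topology: the maximisers of the first function again form a compact set, on which the second one
attains its maximum.\<close>
lemma lexicographic_maximum:
  fixes f g :: "'x::topological_space \<Rightarrow> real"
  assumes "compact K" "K \<noteq> {}" "continuous_on UNIV f" "continuous_on UNIV g"
  shows "\<exists>x\<in>K. \<forall>y\<in>K. Dual (f y) (g y) \<le> Dual (f x) (g x)"
proof -
  obtain z where z: "z \<in> K" "\<And>y. y \<in> K \<Longrightarrow> f y \<le> f z"
    using continuous_attains_sup[OF assms(1,2) continuous_on_subset[OF assms(3)]] by auto
  let ?L = "K \<inter> {x. f x = f z}"
  have "compact ?L"
    using assms by (intro compact_Int_closed closed_Collect_eq continuous_intros) auto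
  moreover have "?L \<noteq> {}" using z by auto
  moreover have "continuous_on ?L g"
    using assms(4) by (rule continuous_on_subset) simp
  ultimately have "\<exists>x\<in>?L. \<forall>y\<in>?L. g y \<le> g x"
    by (rule continuous_attains_sup)
  then obtain x where x: "x \<in> K" "f x = f z" "\<And>y. y \<in> K \<Longrightarrow> f y = f z \<Longrightarrow> g y \<le> g x"
    by auto
  show ?thesis
  proof (intro bexI ballI)
    fix y assume "y \<in> K"
    then show "Dual (f y) (g y) \<le> Dual (f x) (g x)"
      using z(2)[of y] x(2) x(3)[of y] by (auto simp: less_eq_dual_def)
  qed (rule x)
qed

lemma compact_box: "compact {x :: 'i \<Rightarrow> real. \<forall>i. \<bar>x i\<bar> \<le> 1}"
proof -
  have "compactin (product_topology (\<lambda>i::'i. euclidean) UNIV) (Pi\<^sub>E UNIV (\<lambda>i. {-1..1::real}))"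
    by (subst compactin_PiE) auto
  then have "compact (Pi\<^sub>E UNIV (\<lambda>i::'i. {-1..1::real}))"
    by (simp add: euclidean_product_topology)
  moreover have "Pi\<^sub>E UNIV (\<lambda>i::'i. {-1..1::real}) = {x. \<forall>i. \<bar>x i\<bar> \<le> 1}"
    by (auto simp: PiE_iff abs_le_iff minus_le_iff)
  ultimately show ?thesis by simp
qed

text \<open>A pair of quaternion matrices is encoded by one real-valued function on index triples: the first component
is \<open>c, \<dots>, c + 3\<close> for the four real components of the entries, with \<open>c = 0\<close> for one matrix and
\<open>c = 4\<close> for the other.\<close>
definition coord_mat :: "nat \<Rightarrow> nat \<Rightarrow> (nat \<times> nat \<times> nat \<Rightarrow> real) \<Rightarrow> quat mat" where
  "coord_mat c n x =
     mat n n (\<lambda>(i,j). Quat (x (c,i,j)) (x (c+1,i,j)) (x (c+2,i,j)) (x (c+3,i,j)))"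

lemma mat_continuous_coord_mat: "mat_continuous n n (coord_mat c n)"
  unfolding mat_continuous_def quat_continuous_def coord_mat_def by auto

lemma quat_part_bound:
  assumes "qre (star x * x) \<le> 1"
  shows "\<bar>qre x\<bar> \<le> 1" "\<bar>qi x\<bar> \<le> 1" "\<bar>qj x\<bar> \<le> 1" "\<bar>qk x\<bar> \<le> 1"
proof -
  have *: "(qre x)\<^sup>2 + (qi x)\<^sup>2 + (qj x)\<^sup>2 + (qk x)\<^sup>2 \<le> 1"
    using assms by (simp add: quat_part_mult power2_eq_square)
  have "(qre x)\<^sup>2 \<le> 1" "(qi x)\<^sup>2 \<le> 1" "(qj x)\<^sup>2 \<le> 1" "(qk x)\<^sup>2 \<le> 1"
    using * by (smt (verit) zero_le_power2)+
  then show "\<bar>qre x\<bar> \<le> 1" "\<bar>qi x\<bar> \<le> 1" "\<bar>qj x\<bar> \<le> 1" "\<bar>qk x\<bar> \<le> 1"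
    by (auto simp: abs_square_le_1)
qed

lemma qre_star_mult_nonneg: "0 \<le> qre (star x * x)"
  by (simp add: quat_part_mult)

lemma unitary_entry_bound:
  assumes U: "unitary n (U :: quat mat)" and ij: "i < n" "j < n"
  shows "qre (star (U $$ (i,j)) * U $$ (i,j)) \<le> 1"
proof -
  note c = unitaryD[OF U]
  have "(\<Sum>l<n. star (U $$ (l,j)) * U $$ (l,j)) = 1"
    using arg_cong[OF c(3), of "\<lambda>M. M $$ (j,j)"] c(1) ij
    by (simp add: mult_mat_entry[of _ n n _ n] del: index_mult_mat(1))
  then have "(\<Sum>l<n. qre (star (U $$ (l,j)) * U $$ (l,j))) = 1"
    by (metis quat_part_sum(1) quat_part_simps(25))
  moreover have "qre (star (U $$ (i,j)) * U $$ (i,j)) \<le> (\<Sum>l<n. qre (star (U $$ (l,j)) * U $$ (l,j)))"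
    using ij by (intro member_le_sum) (auto intro: qre_star_mult_nonneg)
  ultimately show ?thesis by simp
qed

text \<open>The objective function. Its weights \<open>k, k - 1, \<dots>, 1\<close> are strictly decreasing, which forces sorted
diagonal entries at a maximum, and truncated subtraction makes them vanish from index \<open>k\<close> on, so that
out-of-range diagonal positions need no separate treatment.\<close>
definition weighted_trace :: "nat \<Rightarrow> quat mat \<Rightarrow> real" where
  "weighted_trace k M = (\<Sum>i<k. real (k - i) * qre (M $$ (i,i)))"

text \<open>The unitary group is closed and its entries have norm at most \<open>1\<close>, so the admissible coordinates form a
compact subset of a product of intervals.\<close>
lemma exists_lexicographic_maximum:
  assumes M: "M \<in> carrier_mat m n" and N: "N \<in> carrier_mat m n" and k: "k \<le> m" "k \<le> n"
  obtains U V where "unitary m U" "unitary n V"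
    "\<And>R T. unitary m R \<Longrightarrow> unitary n T \<Longrightarrow>
       Dual (weighted_trace k (adjoint R * M * T)) (weighted_trace k (adjoint R * N * T))
       \<le> Dual (weighted_trace k (adjoint U * M * V)) (weighted_trace k (adjoint U * N * V))"
proof -
  let ?U = "coord_mat 0 m" and ?V = "coord_mat 4 n"
  define K where "K = {x. \<forall>i. \<bar>x i\<bar> \<le> 1} \<inter> {x. unitary m (?U x)} \<inter> {x. unitary n (?V x)}"
  have mc: "mat_continuous m n (\<lambda>x. adjoint (?U x) * X * ?V x)" if "X \<in> carrier_mat m n" for X
    by (rule mat_continuous_mult[OF mat_continuous_mult[OF mat_continuous_adjoint
      [OF mat_continuous_coord_mat] mat_continuous_const[OF that]] mat_continuous_coord_mat])
  have cont: "continuous_on UNIV (\<lambda>x. weighted_trace k (adjoint (?U x) * X * ?V x))"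
    if "X \<in> carrier_mat m n" for X
  proof -
    have "continuous_on UNIV (\<lambda>x. qre ((adjoint (?U x) * X * ?V x) $$ (i,i)))" if "i < k" for i
      using mc[OF \<open>X \<in> carrier_mat m n\<close>] that k
      unfolding mat_continuous_def quat_continuous_def by (meson order_less_le_trans)
    then show ?thesis
      unfolding weighted_trace_def by (intro continuous_on_sum continuous_on_mult_left) simp
  qed
  have closed: "closed {x. unitary r (coord_mat c r x)}" for c r
  proof -
    have eq: "{x. unitary r (coord_mat c r x)} =
        {x. adjoint (coord_mat c r x) * coord_mat c r x = 1\<^sub>m r} \<inter>
        {x. coord_mat c r x * adjoint (coord_mat c r x) = 1\<^sub>m r}"
      by (auto simp: unitary_def coord_mat_def)
    have "closed {x. adjoint (coord_mat c r x) * coord_mat c r x = 1\<^sub>m r}"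
      by (rule closed_mat_eq[OF mat_continuous_mult[OF mat_continuous_adjoint
        [OF mat_continuous_coord_mat] mat_continuous_coord_mat]]) simp
    moreover have "closed {x. coord_mat c r x * adjoint (coord_mat c r x) = 1\<^sub>m r}"
      by (rule closed_mat_eq[OF mat_continuous_mult[OF mat_continuous_coord_mat
        mat_continuous_adjoint[OF mat_continuous_coord_mat]]]) simp
    ultimately show ?thesis unfolding eq by (rule closed_Int)
  qed
  have K: "compact K"
    unfolding K_def by (intro compact_Int_closed compact_box closed)
  have surj: "\<exists>x\<in>K. ?U x = R \<and> ?V x = T" if R: "unitary m R" and T: "unitary n T" for R T
  proof -
    define comp where "comp q c = (if c = 0 then qre q else if c = 1 then qi q
      else if c = 2 then qj q else qk q)" for q and c :: nat
    define x where "x = (\<lambda>(c,i,j). if c < 4 then if i < m \<and> j < m then comp (R $$ (i,j)) c else 0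
      else if i < n \<and> j < n then comp (T $$ (i,j)) (c - 4) else 0)"
    have "?U x = R" "?V x = T"
      using unitaryD[OF R] unitaryD[OF T]
      by (auto intro!: eq_matI simp: coord_mat_def x_def comp_def)
    moreover have "\<bar>x i\<bar> \<le> 1" for i
      using quat_part_bound[OF unitary_entry_bound[OF R]] quat_part_bound[OF unitary_entry_bound[OF T]]
      by (cases i) (auto simp: x_def comp_def)
    ultimately show ?thesis using R T by (intro bexI[of _ x]) (auto simp: K_def)
  qed
  have "K \<noteq> {}" using surj[OF unitary_one unitary_one] by auto
  from lexicographic_maximum[OF K this cont[OF M] cont[OF N]] obtain x where
    x: "x \<in> K" "\<And>y. y \<in> K \<Longrightarrow>
       Dual (weighted_trace k (adjoint (?U y) * M * ?V y)) (weighted_trace k (adjoint (?U y) * N * ?V y))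
       \<le> Dual (weighted_trace k (adjoint (?U x) * M * ?V x)) (weighted_trace k (adjoint (?U x) * N * ?V x))"
    by auto
  show thesis
  proof (rule that[of "?U x" "?V x"])
    fix R T :: "quat mat" assume "unitary m R" "unitary n T"
    from surj[OF this] x(2) show
      "Dual (weighted_trace k (adjoint R * M * T)) (weighted_trace k (adjoint R * N * T))
       \<le> Dual (weighted_trace k (adjoint (?U x) * M * ?V x)) (weighted_trace k (adjoint (?U x) * N * ?V x))"
      by auto
  qed (use x(1) in \<open>auto simp: K_def\<close>)
qed

section \<open>Plane rotations and stationarity\<close>

text \<open>The rotation with cosine \<open>c\<close> and sine \<open>s\<close> in the plane of the coordinates \<open>i\<close> and \<open>j\<close>, twisted by a unit
quaternion \<open>\<omega>\<close>. Letting \<open>\<omega>\<close> vary makes stationarity a statement about all four components of an entry.\<close>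
definition rotation :: "nat \<Rightarrow> nat \<Rightarrow> nat \<Rightarrow> quat \<Rightarrow> real \<Rightarrow> real \<Rightarrow> quat mat" where
  "rotation n i j \<omega> c s = mat n n (\<lambda>(a,b).
     if a = i \<and> b = i \<or> a = j \<and> b = j then of_real c
     else if a = i \<and> b = j then - (s *\<^sub>R \<omega>)
     else if a = j \<and> b = i then s *\<^sub>R star \<omega>
     else if a = b then 1 else 0)"

lemma rotation_carrier [simp, intro]: "rotation n i j \<omega> c s \<in> carrier_mat n n"
  by (simp add: rotation_def)

lemma rotation_dims [simp]:
  "dim_row (rotation n i j \<omega> c s) = n" "dim_col (rotation n i j \<omega> c s) = n"
  by (simp_all add: rotation_def)

lemma star_scaleR [simp]: "star (r *\<^sub>R (x::quat)) = r *\<^sub>R star x"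
  by (simp add: quat_eq_iff)

lemma star_of_real [simp]: "star (of_real r :: quat) = of_real r"
  by (simp add: quat_eq_iff of_real_def)

lemma adjoint_rotation:
  "i \<noteq> j \<Longrightarrow> adjoint (rotation n i j \<omega> c s) = rotation n i j \<omega> c (- s)"
  by (rule eq_matI) (auto simp: rotation_def star_minus)

lemma sum_two_terms:
  assumes "finite I" "i \<in> I" "j \<in> I" "i \<noteq> j" "\<And>l. l \<in> I \<Longrightarrow> l \<noteq> i \<Longrightarrow> l \<noteq> j \<Longrightarrow> f l = 0"
  shows "sum f I = f i + f j"
proof -
  have "sum f I = sum f {i, j}"
    using assms by (intro sum.mono_neutral_right) auto
  then show ?thesis using assms(4) by simp
qed

lemma mult_rotation_entry:
  assumes M: "M \<in> carrier_mat m n" and ij: "i < n" "j < n" "i \<noteq> j" and ab: "a < m" "b < n"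
  shows "(M * rotation n i j \<omega> c s) $$ (a,b) =
    (if b = i then c *\<^sub>R M $$ (a,i) + s *\<^sub>R (M $$ (a,j) * star \<omega>)
     else if b = j then c *\<^sub>R M $$ (a,j) - s *\<^sub>R (M $$ (a,i) * \<omega>)
     else M $$ (a,b))"
proof -
  let ?f = "\<lambda>l. M $$ (a,l) * rotation n i j \<omega> c s $$ (l,b)"
  have eq: "(M * rotation n i j \<omega> c s) $$ (a,b) = sum ?f {..<n}"
    using M ab by (intro mult_mat_entry) auto
  show ?thesis
  proof (cases "b = i \<or> b = j")
    case True
    then have "sum ?f {..<n} = ?f i + ?f j"
      using ij ab by (intro sum_two_terms) (auto simp: rotation_def)
    then show ?thesis
      unfolding eq using True ij by (auto simp: rotation_def of_real_def)
  next
    case False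
    then have "sum ?f {..<n} = (\<Sum>l<n. if l = b then M $$ (a,b) else 0)"
      using ab ij by (intro sum.cong) (auto simp: rotation_def)
    then show ?thesis
      unfolding eq using False ab by simp
  qed
qed

lemma rotation_mult_entry:
  assumes M: "M \<in> carrier_mat m n" and ij: "i < m" "j < m" "i \<noteq> j" and ab: "a < m" "b < n"
  shows "(rotation m i j \<omega> c s * M) $$ (a,b) =
    (if a = i then c *\<^sub>R M $$ (i,b) - s *\<^sub>R (\<omega> * M $$ (j,b))
     else if a = j then c *\<^sub>R M $$ (j,b) + s *\<^sub>R (star \<omega> * M $$ (i,b))
     else M $$ (a,b))"
proof -
  let ?f = "\<lambda>l. rotation m i j \<omega> c s $$ (a,l) * M $$ (l,b)"
  have eq: "(rotation m i j \<omega> c s * M) $$ (a,b) = sum ?f {..<m}"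
    using M ab by (intro mult_mat_entry) auto
  show ?thesis
  proof (cases "a = i \<or> a = j")
    case True
    then have "sum ?f {..<m} = ?f i + ?f j"
      using ij ab by (intro sum_two_terms) (auto simp: rotation_def)
    then show ?thesis
      unfolding eq using True ij by (auto simp: rotation_def of_real_def)
  next
    case False
    then have "sum ?f {..<m} = (\<Sum>l<m. if l = a then M $$ (a,b) else 0)"
      using ab ij by (intro sum.cong) (auto simp: rotation_def)
    then show ?thesis
      unfolding eq using False ab by simp
  qed
qed

lemma unitary_rotation:
  assumes ij: "i < n" "j < n" "i \<noteq> j" and \<omega>: "star \<omega> * \<omega> = 1" "\<omega> * star \<omega> = 1" and cs: "c\<^sup>2 + s\<^sup>2 = 1"
  shows "unitary n (rotation n i j \<omega> c s)"
proof -
  have *: "rotation n i j \<omega> c (- s) * rotation n i j \<omega> c s = 1\<^sub>m n" if "c\<^sup>2 + s\<^sup>2 = 1" for s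
  proof (rule eq_matI)
    fix a b assume "a < dim_row (1\<^sub>m n :: quat mat)" "b < dim_col (1\<^sub>m n :: quat mat)"
    moreover have "c *\<^sub>R c *\<^sub>R (1::quat) + s *\<^sub>R s *\<^sub>R 1 = 1"
      using that by (simp add: power2_eq_square flip: scaleR_left_distrib)
    ultimately show "(rotation n i j \<omega> c (- s) * rotation n i j \<omega> c s) $$ (a,b) = 1\<^sub>m n $$ (a,b)"
      using ij \<omega> by (subst mult_rotation_entry[of _ n]) (auto simp: rotation_def of_real_def add.commute)
  qed auto
  from *[OF cs] *[of "- s"] cs ij show ?thesis
    by (auto simp: unitary_def adjoint_rotation)
qed

text \<open>Multiplication of one coordinate by a unit quaternion; it is used to make diagonal entries real.\<close>
definition phase :: "nat \<Rightarrow> nat \<Rightarrow> quat \<Rightarrow> quat mat" where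
  "phase n i \<omega> = mat_diag n (\<lambda>a. if a = i then \<omega> else 1)"

lemma adjoint_mat_diag: "adjoint (mat_diag n f) = mat_diag n (\<lambda>i. star (f i))"
  by (rule eq_matI) (auto simp: mat_diag_def)

lemma adjoint_phase: "adjoint (phase n i \<omega>) = phase n i (star \<omega>)"
  by (auto simp: phase_def adjoint_mat_diag intro!: arg_cong[of _ _ "mat_diag n"])

lemma unitary_phase:
  assumes "star \<omega> * \<omega> = 1" "\<omega> * star \<omega> = 1"
  shows "unitary n (phase n i \<omega>)"
proof -
  have "mat_diag n (\<lambda>a. (if a = i then x else 1) * (if a = i then y else 1)) = 1\<^sub>m n"
    if "x * y = 1" for x y :: quat
    using that by (auto simp: mat_diag_def intro!: eq_matI)
  then show ?thesis
    using assms unfolding unitary_def adjoint_phase by (simp add: phase_def)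
qed

lemma phase_mult_entry:
  assumes "M \<in> carrier_mat m n" "a < m" "b < n"
  shows "(phase m i \<omega> * M) $$ (a,b) = (if a = i then \<omega> * M $$ (a,b) else M $$ (a,b))"
  using assms by (simp add: phase_def mat_diag_mult_left[of _ m n])

lemma phase_carrier [simp, intro]: "phase n i \<omega> \<in> carrier_mat n n"
  by (simp add: phase_def)

lemma phase_dims [simp]: "dim_row (phase n i \<omega>) = n" "dim_col (phase n i \<omega>) = n"
  by (simp_all add: phase_def mat_diag_def)

lemma weighted_trace_change:
  assumes "i \<noteq> j" "\<And>a. a < k \<Longrightarrow> a \<noteq> i \<Longrightarrow> a \<noteq> j \<Longrightarrow> qre (M' $$ (a,a)) = qre (M $$ (a,a))"
  shows "weighted_trace k M' = weighted_trace k M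
    + real (k - i) * (qre (M' $$ (i,i)) - qre (M $$ (i,i)))
    + real (k - j) * (qre (M' $$ (j,j)) - qre (M $$ (j,j)))"
proof -
  let ?f = "\<lambda>a. real (k - a) * (qre (M' $$ (a,a)) - qre (M $$ (a,a)))"
  have "weighted_trace k M' - weighted_trace k M = sum ?f {..<k}"
    by (simp add: weighted_trace_def right_diff_distrib sum_subtractf)
  also have "\<dots> = sum ?f ({..<k} \<union> {i,j})"
    by (intro sum.mono_neutral_left) auto
  also have "\<dots> = ?f i + ?f j"
    using assms by (intro sum_two_terms) auto
  finally show ?thesis by simp
qed

text \<open>A linear functional on the unit circle attains its maximum in the direction of its coefficient vector. This
replaces the derivative of the objective along a one-parameter group of rotations.\<close>
lemma circle_maximum_at_one:
  fixes a b :: real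
  assumes "\<And>c s. c\<^sup>2 + s\<^sup>2 = 1 \<Longrightarrow> a * c + b * s \<le> a"
  shows "b = 0" "0 \<le> a"
proof -
  show "0 \<le> a" using assms[of "-1" 0] by simp
  show "b = 0"
  proof (rule ccontr)
    assume "b \<noteq> 0"
    define r where "r = sqrt (a\<^sup>2 + b\<^sup>2)"
    have r2: "r\<^sup>2 = a\<^sup>2 + b\<^sup>2" by (simp add: r_def)
    have "r > \<bar>a\<bar>"
      using \<open>b \<noteq> 0\<close> unfolding r_def by (intro real_less_rsqrt) simp
    then have r: "r > 0" "r > a" by auto
    have "(a / r)\<^sup>2 + (b / r)\<^sup>2 = 1"
      using r(1) by (simp only: power_divide r2[symmetric] flip: add_divide_distrib) simp
    from assms[OF this] have "(a\<^sup>2 + b\<^sup>2) / r \<le> a"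
      by (simp add: power2_eq_square add_divide_distrib)
    then have "r\<^sup>2 / r \<le> a" by (simp only: r2)
    then have "r \<le> a" using r(1) by (simp add: power2_eq_square)
    then show False using r by simp
  qed
qed

text \<open>Rotating rows and columns simultaneously makes the objective quadratic in cosine and sine, and a maximum at
the identity kills the mixed coefficient: near the identity the term \<open>b c s\<close> would dominate \<open>e s\<^sup>2\<close>.\<close>
lemma circle_quadratic_maximum:
  fixes b e :: real
  assumes "\<And>c s. c\<^sup>2 + s\<^sup>2 = 1 \<Longrightarrow> b * (c * s) \<le> e * s\<^sup>2"
  shows "b = 0" "0 \<le> e"
proof -
  show e: "0 \<le> e" using assms[of 0 1] by simp
  have le: "b * t \<le> e * t\<^sup>2" for t :: real
  proof -
    define c where "c = 1 / sqrt (1 + t\<^sup>2)"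
    have c: "c > 0" "c\<^sup>2 * (1 + t\<^sup>2) = 1"
      by (simp_all add: c_def power_divide add_pos_nonneg) (metis add_nonneg_eq_0_iff zero_le_one zero_le_power2 zero_neq_one)
    then have "c\<^sup>2 + (t * c)\<^sup>2 = 1" by (simp add: algebra_simps power_mult_distrib)
    from assms[OF this] have "c\<^sup>2 * (b * t) \<le> c\<^sup>2 * (e * t\<^sup>2)"
      by (simp add: power2_eq_square algebra_simps)
    then show ?thesis using c(1) by simp
  qed
  show "b = 0"
  proof (rule ccontr)
    assume "b \<noteq> 0"
    define t where "t = b / (e + 1)"
    have "b * t \<le> e * t\<^sup>2" by (rule le)
    moreover have "b * t = (e + 1) * t\<^sup>2"
      using e by (simp add: t_def power2_eq_square)
    moreover have "t\<^sup>2 > 0" using \<open>b \<noteq> 0\<close> e by (simp add: t_def)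
    ultimately show False by (simp add: algebra_simps)
  qed
qed

text \<open>The units \<open>1, i, j, k\<close> read off the four components of \<open>x\<close>.\<close>
lemma quat_eq_0_by_units:
  assumes "\<And>\<omega>. star \<omega> * \<omega> = 1 \<Longrightarrow> \<omega> * star \<omega> = 1 \<Longrightarrow> qre (x * star \<omega>) = 0"
  shows "x = 0"
  using assms[of 1] assms[of "Quat 0 1 0 0"] assms[of "Quat 0 0 1 0"] assms[of "Quat 0 0 0 1"]
  by (simp add: quat_eq_iff quat_part_mult)

abbreviation unit_quat :: "quat \<Rightarrow> bool" where
  "unit_quat \<omega> \<equiv> star \<omega> * \<omega> = 1 \<and> \<omega> * star \<omega> = 1"

text \<open>Along the rotations of two columns the objective is \<open>a c + b s\<close> plus a constant, where \<open>b\<close> collects the two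
off-diagonal entries with their weights; a maximum at the identity forces \<open>b = 0\<close>.\<close>
lemma column_stationary:
  assumes M: "M \<in> carrier_mat m n" and k: "k \<le> m" "k \<le> n" and ij: "i < n" "j < n" "i \<noteq> j"
    and max: "\<And>\<omega> c s. unit_quat \<omega> \<Longrightarrow> c\<^sup>2 + s\<^sup>2 = 1 \<Longrightarrow>
      weighted_trace k (M * rotation n i j \<omega> c s) \<le> weighted_trace k M"
  shows "real (k - i) *\<^sub>R M $$ (i,j) = real (k - j) *\<^sub>R star (M $$ (j,i))"
proof -
  let ?w = "\<lambda>i. real (k - i)"
  have "?w i *\<^sub>R M $$ (i,j) - ?w j *\<^sub>R star (M $$ (j,i)) = 0"
  proof (rule quat_eq_0_by_units)
    fix \<omega> :: quat assume \<omega>: "star \<omega> * \<omega> = 1" "\<omega> * star \<omega> = 1"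
    define a where "a = ?w i * qre (M $$ (i,i)) + ?w j * qre (M $$ (j,j))"
    define b where "b = ?w i * qre (M $$ (i,j) * star \<omega>) - ?w j * qre (M $$ (j,i) * \<omega>)"
    have "a * c + b * s \<le> a" if cs: "c\<^sup>2 + s\<^sup>2 = 1" for c s
    proof -
      let ?M = "M * rotation n i j \<omega> c s"
      have "weighted_trace k ?M = weighted_trace k M
        + ?w i * (qre (?M $$ (i,i)) - qre (M $$ (i,i))) + ?w j * (qre (?M $$ (j,j)) - qre (M $$ (j,j)))"
        using k ij by (intro weighted_trace_change) (auto simp: mult_rotation_entry[OF M] simp del: index_mult_mat)
      moreover have "?w i * qre (?M $$ (i,i)) = ?w i * (c * qre (M $$ (i,i)) + s * qre (M $$ (i,j) * star \<omega>))"
        using ij k by (cases "i < k") (auto simp: mult_rotation_entry[OF M] simp del: index_mult_mat)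
      moreover have "?w j * qre (?M $$ (j,j)) = ?w j * (c * qre (M $$ (j,j)) - s * qre (M $$ (j,i) * \<omega>))"
        using ij k by (cases "j < k") (auto simp: mult_rotation_entry[OF M] simp del: index_mult_mat)
      ultimately show ?thesis
        using max[of \<omega> c s] \<omega> cs by (simp add: a_def b_def algebra_simps)
    qed
    then have "b = 0" by (rule circle_maximum_at_one)
    then show "qre ((?w i *\<^sub>R M $$ (i,j) - ?w j *\<^sub>R star (M $$ (j,i))) * star \<omega>) = 0"
      by (simp add: b_def quat_part_mult algebra_simps)
  qed
  then show ?thesis by simp
qed

lemma weighted_trace_adjoint:
  "M \<in> carrier_mat m n \<Longrightarrow> k \<le> m \<Longrightarrow> k \<le> n \<Longrightarrow> weighted_trace k (adjoint M) = weighted_trace k M"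
  by (auto simp: weighted_trace_def intro!: sum.cong)

text \<open>The transposed situation. If \<open>M\<close> has no column \<open>j\<close>, the right-hand side of the stationarity equation is
zero, because the weight of \<open>j\<close> is.\<close>
lemma row_stationary:
  assumes M: "M \<in> carrier_mat m n" and k: "k \<le> m" "k \<le> n" and ij: "i < m" "j < m" "i \<noteq> j"
    and max: "\<And>\<omega> c s. unit_quat \<omega> \<Longrightarrow> c\<^sup>2 + s\<^sup>2 = 1 \<Longrightarrow>
      weighted_trace k (adjoint (rotation m i j \<omega> c s) * M) \<le> weighted_trace k M"
  shows "i < n \<Longrightarrow> j < n \<Longrightarrow> real (k - i) *\<^sub>R star (M $$ (j,i)) = real (k - j) *\<^sub>R M $$ (i,j)"
    "i < n \<Longrightarrow> \<not> j < n \<Longrightarrow> real (k - i) *\<^sub>R star (M $$ (j,i)) = 0"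
proof -
  have "real (k - i) *\<^sub>R adjoint M $$ (i,j) = real (k - j) *\<^sub>R star (adjoint M $$ (j,i))"
  proof (rule column_stationary[of "adjoint M" n m])
    fix \<omega> c s assume \<omega>: "unit_quat \<omega>" "(c::real)\<^sup>2 + s\<^sup>2 = 1"
    have "adjoint M * rotation m i j \<omega> c s = adjoint (adjoint (rotation m i j \<omega> c s) * M)"
      using M by (subst adjoint_mult[of _ m m _ n]) auto
    moreover have "adjoint (rotation m i j \<omega> c s) * M \<in> carrier_mat m n"
      using M by (intro mult_carrier_mat[of _ m m]) auto
    ultimately show "weighted_trace k (adjoint M * rotation m i j \<omega> c s) \<le> weighted_trace k (adjoint M)"
      using max[OF \<omega>] M k by (simp add: weighted_trace_adjoint[of _ m n])
  qed (use assms in auto)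
  then show "i < n \<Longrightarrow> j < n \<Longrightarrow> real (k - i) *\<^sub>R star (M $$ (j,i)) = real (k - j) *\<^sub>R M $$ (i,j)"
    "i < n \<Longrightarrow> \<not> j < n \<Longrightarrow> real (k - i) *\<^sub>R star (M $$ (j,i)) = 0"
    using M k ij by (auto simp: not_less)
qed

lemma qre_mult_commute: "qre (x * y) = qre (y * x)"
  by (simp add: quat_part_mult)

text \<open>With rows and columns rotated together, the objective changes by
\<open>(w\<^sub>i - w\<^sub>j) (h c s - (a - b) s\<^sup>2)\<close>, where \<open>a, b\<close> are the real parts of the two diagonal entries and \<open>h\<close> is
a real component of \<open>M\<^sub>i\<^sub>j + M\<^sub>j\<^sub>i\<^sup>*\<close>. The weights decrease strictly, so both conclusions follow. These are the
only rotations available for the infinitesimal part within a block of equal nonzero singular values.\<close>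
lemma two_sided_stationary:
  assumes M: "M \<in> carrier_mat m n" and k: "k \<le> m" "k \<le> n" and ij: "i < j" "j < k"
    and max: "\<And>\<omega> c s. unit_quat \<omega> \<Longrightarrow> c\<^sup>2 + s\<^sup>2 = 1 \<Longrightarrow>
      weighted_trace k (adjoint (rotation m i j \<omega> c s) * M * rotation n i j \<omega> c s) \<le> weighted_trace k M"
  shows "M $$ (i,j) = - star (M $$ (j,i))" "qre (M $$ (j,j)) \<le> qre (M $$ (i,i))"
proof -
  define a b where "a = qre (M $$ (i,i))" and "b = qre (M $$ (j,j))"
  have *: "qre ((M $$ (i,j) + star (M $$ (j,i))) * star \<omega>) = 0 \<and> b \<le> a" if \<omega>: "unit_quat \<omega>" for \<omega>
  proof -
    define h where "h = qre (\<omega> * M $$ (j,i)) + qre (M $$ (i,j) * star \<omega>)"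
    have conj: "qre (\<omega> * x * star \<omega>) = qre x" "qre (star \<omega> * x * \<omega>) = qre x" for x
      using \<omega> qre_mult_commute[of "\<omega> * x" "star \<omega>"] qre_mult_commute[of "star \<omega> * x" "\<omega>"]
      by (simp_all flip: mult.assoc)
    have "h * (c * s) \<le> (a - b) * s\<^sup>2" if cs: "c\<^sup>2 + s\<^sup>2 = 1" for c s
    proof -
      let ?L = "rotation m i j \<omega> c (- s)"
      let ?Y = "?L * M"
      let ?Z = "?Y * rotation n i j \<omega> c s"
      have Y: "?Y \<in> carrier_mat m n"
        by (rule mult_carrier_mat[OF rotation_carrier M])
      have im: "i < m" "j < m" "i < n" "j < n" "i \<noteq> j" using ij k by auto
      note entries = mult_rotation_entry[OF Y im(3,4,5)] rotation_mult_entry[OF M im(1,2,5)]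
      have "weighted_trace k ?Z = weighted_trace k M
        + real (k - i) * (qre (?Z $$ (i,i)) - qre (M $$ (i,i)))
        + real (k - j) * (qre (?Z $$ (j,j)) - qre (M $$ (j,j)))"
        using im k by (intro weighted_trace_change) (auto simp: entries simp del: index_mult_mat)
      moreover have "qre (?Z $$ (i,i)) = c\<^sup>2 * a + (c * s) * h + s\<^sup>2 * b"
        using im k conj[of "M $$ (j,j)"]
        by (simp add: entries a_def b_def h_def algebra_simps power2_eq_square del: index_mult_mat)
      moreover have "qre (?Z $$ (j,j)) = c\<^sup>2 * b - (c * s) * h + s\<^sup>2 * a"
        using im k conj[of "M $$ (i,i)"] qre_mult_commute[of \<omega> "M $$ (j,i)"]
          qre_mult_commute[of "M $$ (i,j)" "star \<omega>"]
        by (simp add: entries a_def b_def h_def algebra_simps power2_eq_square del: index_mult_mat)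
      moreover have "weighted_trace k ?Z \<le> weighted_trace k M"
        using max[OF \<omega> cs] im(5) by (simp add: adjoint_rotation)
      moreover have "c\<^sup>2 = 1 - s\<^sup>2" using cs by simp
      ultimately have "(real (k - i) - real (k - j)) * ((c * s) * h - (a - b) * s\<^sup>2) \<le> 0"
        unfolding a_def[symmetric] b_def[symmetric] by (simp add: algebra_simps)
      moreover have "real (k - i) - real (k - j) > 0" using ij by simp
      ultimately have "(c * s) * h - (a - b) * s\<^sup>2 \<le> 0"
        unfolding mult_le_0_iff by linarith
      then show ?thesis by (simp add: mult.commute)
    qed
    from circle_quadratic_maximum[OF this] have "h = 0" "0 \<le> a - b" by auto
    then show ?thesis by (simp add: h_def quat_part_mult algebra_simps)
  qed
  have "M $$ (i,j) + star (M $$ (j,i)) = 0"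
    using * by (intro quat_eq_0_by_units) blast
  then show "M $$ (i,j) = - star (M $$ (j,i))" by (simp add: eq_neg_iff_add_eq_0)
  show "qre (M $$ (j,j)) \<le> qre (M $$ (i,i))"
    using *[of 1] by (simp add: a_def b_def)
qed

text \<open>A quaternion whose real part does not grow under multiplication by units is real and nonnegative: the
unit quaternions \<open>c + s e\<close> with \<open>e\<close> one of \<open>i, j, k\<close> reduce this to linear functionals on a circle.\<close>
lemma phase_stationary:
  assumes M: "M \<in> carrier_mat m n" and k: "k \<le> m" "k \<le> n" and i: "i < k"
    and max: "\<And>\<omega>. unit_quat \<omega> \<Longrightarrow>
      weighted_trace k (adjoint (phase m i \<omega>) * M) \<le> weighted_trace k M"
  shows "M $$ (i,i) = of_real (qre (M $$ (i,i)))" "0 \<le> qre (M $$ (i,i))"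
proof -
  have *: "qre (\<omega> * M $$ (i,i)) \<le> qre (M $$ (i,i))" if "unit_quat \<omega>" for \<omega>
  proof -
    let ?M = "phase m i \<omega> * M"
    have "weighted_trace k ?M = weighted_trace k M
        + real (k - i) * (qre (?M $$ (i,i)) - qre (M $$ (i,i)))
        + real (k - Suc i) * (qre (?M $$ (Suc i,Suc i)) - qre (M $$ (Suc i,Suc i)))"
      using i k by (intro weighted_trace_change) (auto simp: phase_mult_entry[OF M] simp del: index_mult_mat)
    moreover have "real (k - Suc i) * (qre (?M $$ (Suc i,Suc i)) - qre (M $$ (Suc i,Suc i))) = 0"
      using k by (cases "Suc i < k") (auto simp: phase_mult_entry[OF M] simp del: index_mult_mat)
    moreover have "weighted_trace k ?M \<le> weighted_trace k M"
      using max[of "star \<omega>"] that by (simp add: adjoint_phase)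
    ultimately have "real (k - i) * (qre (?M $$ (i,i)) - qre (M $$ (i,i))) \<le> 0" by simp
    then show ?thesis
      using i k by (simp add: mult_le_0_iff phase_mult_entry[OF M] del: index_mult_mat)
  qed
  have unit: "unit_quat (Quat c (s * x) (s * y) (s * z))"
    if "c\<^sup>2 + s\<^sup>2 = 1" "x\<^sup>2 + y\<^sup>2 + z\<^sup>2 = 1" for c s x y z :: real
  proof -
    have "c\<^sup>2 + (s * x)\<^sup>2 + (s * y)\<^sup>2 + (s * z)\<^sup>2 = c\<^sup>2 + s\<^sup>2 * (x\<^sup>2 + y\<^sup>2 + z\<^sup>2)"
      by (simp add: algebra_simps power_mult_distrib)
    also have "\<dots> = 1" using that by simp
    finally show ?thesis by (simp add: quat_eq_iff quat_part_mult power2_eq_square)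
  qed
  note le = *[OF unit]
  have "qre (M $$ (i,i)) * c + - qi (M $$ (i,i)) * s \<le> qre (M $$ (i,i))"
    "qre (M $$ (i,i)) * c + - qj (M $$ (i,i)) * s \<le> qre (M $$ (i,i))"
    "qre (M $$ (i,i)) * c + - qk (M $$ (i,i)) * s \<le> qre (M $$ (i,i))"
    if "c\<^sup>2 + s\<^sup>2 = 1" for c s
    using le[OF that, of 1 0 0] le[OF that, of 0 1 0] le[OF that, of 0 0 1]
    by (simp_all add: quat_part_mult mult.commute)
  note circle = circle_maximum_at_one[OF this(1)] circle_maximum_at_one[OF this(2)]
    circle_maximum_at_one[OF this(3)]
  show "M $$ (i,i) = of_real (qre (M $$ (i,i)))" "0 \<le> qre (M $$ (i,i))"
    using circle by (auto simp: quat_eq_iff of_real_def)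
qed

text \<open>Row and column stationarity say \<open>w\<^sub>i M\<^sub>i\<^sub>j = w\<^sub>j M\<^sub>j\<^sub>i\<^sup>*\<close> and \<open>w\<^sub>i M\<^sub>j\<^sub>i\<^sup>* = w\<^sub>j M\<^sub>i\<^sub>j\<close>; together they give
\<open>(w\<^sub>i\<^sup>2 - w\<^sub>j\<^sup>2) M\<^sub>i\<^sub>j = 0\<close> with distinct weights. When one of the two indices exceeds the smaller dimension,
a single equation suffices because one weight is zero. The hypotheses concern only the plane of \<open>i\<close> and
\<open>j\<close>, so that the lemma also applies to the infinitesimal part, where few rotations are admissible.\<close>
lemma one_sided_stationary:
  assumes M: "M \<in> carrier_mat m n" and ij: "i < m" "j < n" "i \<noteq> j"
    and cols: "\<And>\<omega> c s. i < n \<Longrightarrow> unit_quat \<omega> \<Longrightarrow> c\<^sup>2 + s\<^sup>2 = 1 \<Longrightarrow>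
      weighted_trace (min m n) (M * rotation n i j \<omega> c s) \<le> weighted_trace (min m n) M"
    and rows: "\<And>\<omega> c s. j < m \<Longrightarrow> unit_quat \<omega> \<Longrightarrow> c\<^sup>2 + s\<^sup>2 = 1 \<Longrightarrow>
      weighted_trace (min m n) (adjoint (rotation m i j \<omega> c s) * M) \<le> weighted_trace (min m n) M"
    and rows': "\<And>\<omega> c s. j < m \<Longrightarrow> unit_quat \<omega> \<Longrightarrow> c\<^sup>2 + s\<^sup>2 = 1 \<Longrightarrow>
      weighted_trace (min m n) (adjoint (rotation m j i \<omega> c s) * M) \<le> weighted_trace (min m n) M"
  shows "M $$ (i,j) = 0"
proof -
  let ?k = "min m n"
  let ?w = "\<lambda>i. real (?k - i)"
  show ?thesis
  proof (cases "i < n")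
    case True
    have col: "?w i *\<^sub>R M $$ (i,j) = ?w j *\<^sub>R star (M $$ (j,i))"
      by (rule column_stationary[OF M]) (use ij True cols in auto)
    have wi: "?w i > 0" using True ij by simp
    show ?thesis
    proof (cases "j < m")
      case jm: True
      have row: "?w i *\<^sub>R star (M $$ (j,i)) = ?w j *\<^sub>R M $$ (i,j)"
        by (rule row_stationary(1)[OF M]) (use ij True jm rows in auto)
      have "(?w i * ?w i) *\<^sub>R M $$ (i,j) = ?w i *\<^sub>R (?w i *\<^sub>R M $$ (i,j))" by simp
      also have "\<dots> = ?w j *\<^sub>R (?w i *\<^sub>R star (M $$ (j,i)))"
        unfolding col by (simp add: mult.commute)
      also have "\<dots> = (?w j * ?w j) *\<^sub>R M $$ (i,j)" unfolding row by simp
      finally have "(?w i * ?w i - ?w j * ?w j) *\<^sub>R M $$ (i,j) = 0"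
        by (simp add: scaleR_left_diff_distrib)
      moreover have "?w i * ?w i - ?w j * ?w j \<noteq> 0"
      proof -
        have "?w i \<noteq> ?w j" using ij True jm by auto
        then have "(?w i - ?w j) * (?w i + ?w j) \<noteq> 0" using wi by (simp del: of_nat_diff)
        then show ?thesis by (simp add: algebra_simps)
      qed
      ultimately show ?thesis by (simp only: scaleR_eq_0_iff) blast
    next
      case False
      then have "?w j = 0" by simp
      then have "?w i *\<^sub>R M $$ (i,j) = 0" using col by (simp only: scaleR_zero_left)
      then show ?thesis using wi by (simp only: scaleR_eq_0_iff) (metis less_irrefl)
    qed
  next
    case False
    then have jm: "j < m" using ij by simp
    have "?w j *\<^sub>R star (M $$ (i,j)) = 0"
      by (rule row_stationary(2)[OF M]) (use ij False jm rows' in auto)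
    moreover have "?w j > 0" using jm ij by simp
    ultimately have "star (M $$ (i,j)) = 0"
      by (simp only: scaleR_eq_0_iff) (metis less_irrefl)
    then show ?thesis by (metis star_star star_0)
  qed
qed

text \<open>\<open>M\<close> and \<open>N\<close> stand for the standard and the infinitesimal part of \<open>U\<^sup>* A V\<close> for a maximising pair
\<open>U, V\<close>; the maximality is then maximality at the identity.\<close>
definition lex_maximal :: "nat \<Rightarrow> nat \<Rightarrow> quat mat \<Rightarrow> quat mat \<Rightarrow> bool" where
  "lex_maximal m n M N \<longleftrightarrow> M \<in> carrier_mat m n \<and> N \<in> carrier_mat m n \<and>
    (\<forall>R T. unitary m R \<longrightarrow> unitary n T \<longrightarrow>
      Dual (weighted_trace (min m n) (adjoint R * M * T)) (weighted_trace (min m n) (adjoint R * N * T))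
      \<le> Dual (weighted_trace (min m n) M) (weighted_trace (min m n) N))"

lemma lex_maximal_st:
  "lex_maximal m n M N \<Longrightarrow> unitary m R \<Longrightarrow> unitary n T \<Longrightarrow>
    weighted_trace (min m n) (adjoint R * M * T) \<le> weighted_trace (min m n) M"
  by (force simp: lex_maximal_def less_eq_dual_def)

lemma lex_maximal_in:
  "lex_maximal m n M N \<Longrightarrow> unitary m R \<Longrightarrow> unitary n T \<Longrightarrow> adjoint R * M * T = M \<Longrightarrow>
    weighted_trace (min m n) (adjoint R * N * T) \<le> weighted_trace (min m n) N"
  by (force simp: lex_maximal_def less_eq_dual_def)

text \<open>All rotations and phases are admissible for \<open>M\<close>, which makes \<open>M\<close> diagonal, nonnegative and sorted. For \<open>N\<close>
the admissible ones are those that fix \<open>M\<close>: one-sided rotations and phases where the singular values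
vanish, and simultaneous rotations where two singular values agree.\<close>
lemma lex_maximal_structure:
  assumes lm: "lex_maximal m n M N"
  obtains d where
    "M = mat m n (\<lambda>(i,j). if i = j then of_real (d i) else 0)"
    "\<And>i. 0 \<le> d i" "\<And>i. min m n \<le> i \<Longrightarrow> d i = 0"
    "\<And>i j. i < j \<Longrightarrow> j < min m n \<Longrightarrow> d j \<le> d i"
    "\<And>i j. i < m \<Longrightarrow> j < n \<Longrightarrow> i \<noteq> j \<Longrightarrow> d i = 0 \<Longrightarrow> d j = 0 \<Longrightarrow> N $$ (i,j) = 0"
    "\<And>i j. i < j \<Longrightarrow> j < min m n \<Longrightarrow> d i = d j \<Longrightarrow>
       N $$ (i,j) = - star (N $$ (j,i)) \<and> qre (N $$ (j,j)) \<le> qre (N $$ (i,i))"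
    "\<And>i. i < min m n \<Longrightarrow> d i = 0 \<Longrightarrow> N $$ (i,i) = of_real (qre (N $$ (i,i))) \<and> 0 \<le> qre (N $$ (i,i))"
proof -
  let ?k = "min m n"
  have M: "M \<in> carrier_mat m n" and N: "N \<in> carrier_mat m n"
    using lm by (auto simp: lex_maximal_def)
  have left: "adjoint R * X * 1\<^sub>m n = adjoint R * X" if "X \<in> carrier_mat m n" "unitary m R" for X R
    using that unitaryD(2)[OF that(2)] by (intro right_mult_one_mat mult_carrier_mat)
  have right: "adjoint (1\<^sub>m m) * X * T = X * T" "1\<^sub>m m * X * T = X * T"
    if "X \<in> carrier_mat m n" for X T :: "quat mat"
    using that by simp_all
  note stM = lex_maximal_st[OF lm]
  note inN = lex_maximal_in[OF lm]
  have off: "M $$ (i,j) = 0" if "i < m" "j < n" "i \<noteq> j" for i j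
  proof (rule one_sided_stationary[OF M that])
    fix \<omega> c s assume *: "unit_quat \<omega>" "(c::real)\<^sup>2 + s\<^sup>2 = 1"
    show "weighted_trace ?k (M * rotation n i j \<omega> c s) \<le> weighted_trace ?k M" if "i < n"
      using stM[OF unitary_one unitary_rotation, of i j \<omega> c s] * that \<open>j < n\<close> \<open>i \<noteq> j\<close> by (simp add: right[OF M])
    show "weighted_trace ?k (adjoint (rotation m i j \<omega> c s) * M) \<le> weighted_trace ?k M"
      "weighted_trace ?k (adjoint (rotation m j i \<omega> c s) * M) \<le> weighted_trace ?k M" if "j < m"
      using stM[OF unitary_rotation unitary_one, of i j \<omega> c s] stM[OF unitary_rotation unitary_one, of j i \<omega> c s]
        * that \<open>i < m\<close> \<open>i \<noteq> j\<close>
      by (simp_all add: left[OF M unitary_rotation])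
  qed
  have diag: "M $$ (i,i) = of_real (qre (M $$ (i,i))) \<and> 0 \<le> qre (M $$ (i,i))" if "i < ?k" for i
  proof -
    have "weighted_trace ?k (adjoint (phase m i \<omega>) * M) \<le> weighted_trace ?k M" if "unit_quat \<omega>" for \<omega>
      using stM[OF unitary_phase unitary_one, of \<omega> i] that by (simp add: left[OF M unitary_phase])
    from phase_stationary[OF M _ _ \<open>i < ?k\<close> this] show ?thesis by auto
  qed
  define d where "d i = (if i < ?k then qre (M $$ (i,i)) else 0)" for i
  have M_eq: "M $$ (i,j) = (if i = j then of_real (d i) else 0)" if "i < m" "j < n" for i j
    using that off diag by (auto simp: d_def)
  have row_fix: "adjoint (rotation m i j \<omega> c s) * M * 1\<^sub>m n = M"
    if "i < m" "j < m" "i \<noteq> j" "d i = 0" "d j = 0" "unitary m (rotation m i j \<omega> c s)" for i j \<omega> c s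
    unfolding left[OF M that(6)]
    by (rule eq_matI) (use that M in \<open>auto simp: adjoint_rotation rotation_mult_entry[OF M] M_eq
      simp del: index_mult_mat(1)\<close>)
  have col_fix: "adjoint (1\<^sub>m m) * M * rotation n i j \<omega> c s = M"
    if "i < n" "j < n" "i \<noteq> j" "d i = 0" "d j = 0" for i j \<omega> c s
    unfolding right(1)[OF M]
    by (rule eq_matI) (use that M in \<open>auto simp: mult_rotation_entry[OF M] M_eq
      simp del: index_mult_mat(1)\<close>)
  have phase_fix: "adjoint (phase m i \<omega>) * M * 1\<^sub>m n = M"
    if "i < m" "d i = 0" "unitary m (phase m i \<omega>)" for i \<omega>
    unfolding left[OF M that(3)]
    by (rule eq_matI) (use that M in \<open>auto simp: adjoint_phase phase_mult_entry[OF M] M_eq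
      simp del: index_mult_mat(1)\<close>)
  have both_fix: "adjoint (rotation m i j \<omega> c s) * M * rotation n i j \<omega> c s = M"
    if "i < ?k" "j < ?k" "i \<noteq> j" "d i = d j" "unitary m (rotation m i j \<omega> c s)" for i j \<omega> c s
  proof -
    have ij: "i < m" "j < m" "i < n" "j < n" using that by auto
    have "M * rotation n i j \<omega> c s = rotation m i j \<omega> c s * M"
      by (rule eq_matI) (use that(3,4) ij M in \<open>auto simp: rotation_mult_entry[OF M]
        mult_rotation_entry[OF M] M_eq of_real_def simp del: index_mult_mat(1)\<close>)
    then show ?thesis
      using unitary_cancel_left(1)[OF that(5) M] M
      by (subst assoc_mult_mat[of _ m m _ n _ n]) auto
  qed
  show thesis
  proof (rule that[of d])
    show "M = mat m n (\<lambda>(i,j). if i = j then of_real (d i) else 0)"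
      using M by (intro eq_matI) (auto simp: M_eq)
    show "0 \<le> d i" for i using diag[of i] by (auto simp: d_def)
    show "?k \<le> i \<Longrightarrow> d i = 0" for i by (auto simp: d_def)
    show "d j \<le> d i" if "i < j" "j < ?k" for i j
    proof -
      have "qre (M $$ (j,j)) \<le> qre (M $$ (i,i))"
        by (rule two_sided_stationary(2)[OF M _ _ that])
          (use that in \<open>auto intro!: stM unitary_rotation\<close>)
      then show ?thesis using that by (simp add: d_def)
    qed
    show "N $$ (i,j) = 0" if "i < m" "j < n" "i \<noteq> j" and d: "d i = 0" "d j = 0" for i j
    proof (rule one_sided_stationary[OF N \<open>i < m\<close> \<open>j < n\<close> \<open>i \<noteq> j\<close>])
      fix \<omega> c s assume *: "unit_quat \<omega>" "(c::real)\<^sup>2 + s\<^sup>2 = 1"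
      show "weighted_trace ?k (N * rotation n i j \<omega> c s) \<le> weighted_trace ?k N" if "i < n"
        using inN[OF unitary_one unitary_rotation col_fix, of i j \<omega> c s] * that d \<open>j < n\<close> \<open>i \<noteq> j\<close>
        by (simp add: right[OF N])
      show "weighted_trace ?k (adjoint (rotation m i j \<omega> c s) * N) \<le> weighted_trace ?k N"
        "weighted_trace ?k (adjoint (rotation m j i \<omega> c s) * N) \<le> weighted_trace ?k N" if "j < m"
        using inN[OF _ unitary_one row_fix, of i j \<omega> c s]
          inN[OF _ unitary_one row_fix, of j i \<omega> c s]
          unitary_rotation[of i m j \<omega> c s] unitary_rotation[of j m i \<omega> c s]
          * that d \<open>i < m\<close> \<open>i \<noteq> j\<close>
        by (simp_all add: left[OF N])
    qed
    show "N $$ (i,j) = - star (N $$ (j,i)) \<and> qre (N $$ (j,j)) \<le> qre (N $$ (i,i))"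
      if "i < j" "j < ?k" "d i = d j" for i j
    proof -
      have "weighted_trace ?k (adjoint (rotation m i j \<omega> c s) * N * rotation n i j \<omega> c s) \<le> weighted_trace ?k N"
        if "unit_quat \<omega>" "c\<^sup>2 + s\<^sup>2 = 1" for \<omega> c s
        using that \<open>i < j\<close> \<open>j < ?k\<close> \<open>d i = d j\<close> by (intro inN both_fix unitary_rotation) auto
      from two_sided_stationary[OF N _ _ that(1,2) this] show ?thesis by auto
    qed
    show "N $$ (i,i) = of_real (qre (N $$ (i,i))) \<and> 0 \<le> qre (N $$ (i,i))" if "i < ?k" "d i = 0" for i
    proof -
      have "weighted_trace ?k (adjoint (phase m i \<omega>) * N) \<le> weighted_trace ?k N" if "unit_quat \<omega>" for \<omega>
        using inN[OF _ unitary_one phase_fix, of i \<omega>] unitary_phase[of \<omega> m i] that \<open>i < ?k\<close> \<open>d i = 0\<close>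
        by (simp add: left[OF N])
      from phase_stationary[OF N _ _ \<open>i < ?k\<close> this] show ?thesis by auto
    qed
  qed
qed

section \<open>Singular value decomposition over the dual quaternions\<close>

definition rect_diag :: "nat \<Rightarrow> nat \<Rightarrow> (nat \<Rightarrow> 'a::zero) \<Rightarrow> 'a mat" where
  "rect_diag m n f = mat m n (\<lambda>(i,j). if i = j then f i else 0)"

lemma rect_diag_carrier [simp, intro]: "rect_diag m n f \<in> carrier_mat m n"
  by (simp add: rect_diag_def)

lemma rect_diag_dims [simp]: "dim_row (rect_diag m n f) = m" "dim_col (rect_diag m n f) = n"
  by (simp_all add: rect_diag_def)

lemma rect_diag_entry [simp]:
  "i < m \<Longrightarrow> j < n \<Longrightarrow> rect_diag m n f $$ (i,j) = (if i = j then f i else 0)"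
  by (simp add: rect_diag_def)

lemma mult_rect_diag_entry:
  fixes f :: "nat \<Rightarrow> 'a::semiring_0"
  assumes "S \<in> carrier_mat l m" "i < l" "j < n"
  shows "(S * rect_diag m n f) $$ (i,j) = (if j < m then S $$ (i,j) * f j else 0)"
proof -
  have "(S * rect_diag m n f) $$ (i,j) = (\<Sum>a<m. S $$ (i,a) * rect_diag m n f $$ (a,j))"
    using assms by (intro mult_mat_entry) auto
  also have "\<dots> = (\<Sum>a<m. if a = j then S $$ (i,j) * f j else 0)"
    using assms by (intro sum.cong) auto
  finally show ?thesis by simp
qed

lemma rect_diag_mult_entry:
  fixes f :: "nat \<Rightarrow> 'a::semiring_0"
  assumes "S \<in> carrier_mat n l" "i < m" "j < l"
  shows "(rect_diag m n f * S) $$ (i,j) = (if i < n then f i * S $$ (i,j) else 0)"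
proof -
  have "(rect_diag m n f * S) $$ (i,j) = (\<Sum>a<n. rect_diag m n f $$ (i,a) * S $$ (a,j))"
    using assms by (intro mult_mat_entry) auto
  also have "\<dots> = (\<Sum>a<n. if a = i then f i * S $$ (i,j) else 0)"
    using assms by (intro sum.cong) auto
  finally show ?thesis by simp
qed

lemma conjugate_mult:
  fixes A :: "'a::star_ring mat"
  assumes "U \<in> carrier_mat m m" "U' \<in> carrier_mat m m" "V \<in> carrier_mat n n" "V' \<in> carrier_mat n n"
    "A \<in> carrier_mat m n"
  shows "adjoint (U * U') * A * (V * V') = adjoint U' * (adjoint U * A * V) * V'"
proof -
  have c: "adjoint U \<in> carrier_mat m m" "adjoint U' \<in> carrier_mat m m" using assms by auto
  note mc = mult_carrier_mat[OF c(1) assms(5)]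
  have "adjoint (U * U') * A * (V * V') = adjoint U' * adjoint U * A * (V * V')"
    using assms by (simp add: adjoint_mult[of _ m m _ m])
  also have "\<dots> = adjoint U' * (adjoint U * A) * (V * V')"
    by (simp only: assoc_mult_mat[OF c(2,1) assms(5)])
  also have "\<dots> = adjoint U' * ((adjoint U * A) * (V * V'))"
    by (rule assoc_mult_mat[OF c(2) mc mult_carrier_mat[OF assms(3,4)]])
  also have "(adjoint U * A) * (V * V') = (adjoint U * A * V) * V'"
    by (rule assoc_mult_mat[OF mc assms(3,4), symmetric])
  also have "adjoint U' * ((adjoint U * A * V) * V') = adjoint U' * (adjoint U * A * V) * V'"
    by (rule assoc_mult_mat[OF c(2) mult_carrier_mat[OF mc assms(3)] assms(4), symmetric])
  finally show ?thesis .
qed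

text \<open>The matrix \<open>I + \<epsilon> S\<close>.\<close>
definition infinitesimal_unitary :: "quat mat \<Rightarrow> quat dual mat" where
  "infinitesimal_unitary S = mat (dim_row S) (dim_col S)
     (\<lambda>(i,j). Dual (if i = j then 1 else 0) (S $$ (i,j)))"

lemma st_in_infinitesimal_unitary:
  assumes "S \<in> carrier_mat n n"
  shows "st_mat (infinitesimal_unitary S) = 1\<^sub>m n" "in_mat (infinitesimal_unitary S) = S"
    "infinitesimal_unitary S \<in> carrier_mat n n"
  using assms by (auto simp: infinitesimal_unitary_def intro!: eq_matI)

lemma unitary_infinitesimal_unitary:
  assumes S: "S \<in> carrier_mat n n" and skew: "adjoint S = - S"
  shows "unitary n (infinitesimal_unitary S)"
proof -
  note c = st_in_infinitesimal_unitary[OF S]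
  have ca: "adjoint (infinitesimal_unitary S) \<in> carrier_mat n n" using c(3) by simp
  have "S + - S = 0\<^sub>m n n" "- S + S = 0\<^sub>m n n" using S by auto
  then have "adjoint (infinitesimal_unitary S) * infinitesimal_unitary S = 1\<^sub>m n"
    "infinitesimal_unitary S * adjoint (infinitesimal_unitary S) = 1\<^sub>m n"
    using S by (auto intro!: dual_mat_eqI simp: st_mat_mult[OF ca c(3)] st_mat_mult[OF c(3) ca]
      in_mat_mult[OF ca c(3)] in_mat_mult[OF c(3) ca] st_mat_adjoint in_mat_adjoint c skew
      st_mat_one in_mat_one)
  then show ?thesis using c(3) by (simp add: unitary_def)
qed

text \<open>For \<open>U = I + \<epsilon> S\<close> and \<open>V = I + \<epsilon> T\<close> with \<open>S, T\<close> skew-Hermitian, the infinitesimal part of \<open>U\<^sup>* B V\<close> is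
\<open>N - S M + M T\<close>, where \<open>M\<close> is diagonal with entries \<open>d\<^sub>i\<close>. For \<open>d\<^sub>i \<noteq> d\<^sub>j\<close> the entries at \<open>(i,j)\<close> and
\<open>(j,i)\<close> vanish for a unique choice of \<open>S\<^sub>i\<^sub>j\<close> and \<open>T\<^sub>i\<^sub>j\<close>, with determinant \<open>d\<^sub>j\<^sup>2 - d\<^sub>i\<^sup>2\<close>; for
\<open>d\<^sub>i = d\<^sub>j > 0\<close> maximality leaves only a skew-Hermitian entry of \<open>N\<close>, which \<open>S\<close> absorbs; for
\<open>d\<^sub>i = d\<^sub>j = 0\<close> maximality has already made the entry zero. On the diagonal \<open>S\<close> removes the imaginary
part.\<close>
lemma diagonalise_lex_maximal:
  assumes B: "B \<in> carrier_mat m n" and lm: "lex_maximal m n (st_mat B) (in_mat B)"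
  obtains U V \<mu> where "unitary m U" "unitary n V" "\<And>i. i < min m n \<Longrightarrow> 0 \<le> \<mu> i"
    "\<And>i j. i \<le> j \<Longrightarrow> j < min m n \<Longrightarrow> \<mu> j \<le> \<mu> i"
    "adjoint U * B * V = rect_diag m n (\<lambda>i. dq_of_dual (\<mu> i))"
proof -
  let ?k = "min m n"
  define N where "N = in_mat B"
  have N: "N \<in> carrier_mat m n" using B by (simp add: N_def)
  from lex_maximal_structure[OF lm, folded N_def] obtain d where d:
    "st_mat B = mat m n (\<lambda>(i,j). if i = j then of_real (d i) else 0)"
    "\<And>i. 0 \<le> d i" "\<And>i. ?k \<le> i \<Longrightarrow> d i = 0"
    "\<And>i j. i < j \<Longrightarrow> j < ?k \<Longrightarrow> d j \<le> d i"
    and N0: "\<And>i j. i < m \<Longrightarrow> j < n \<Longrightarrow> i \<noteq> j \<Longrightarrow> d i = 0 \<Longrightarrow> d j = 0 \<Longrightarrow> N $$ (i,j) = 0"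
    and Neq: "\<And>i j. i < j \<Longrightarrow> j < ?k \<Longrightarrow> d i = d j \<Longrightarrow>
       N $$ (i,j) = - star (N $$ (j,i)) \<and> qre (N $$ (j,j)) \<le> qre (N $$ (i,i))"
    and Nii: "\<And>i. i < ?k \<Longrightarrow> d i = 0 \<Longrightarrow> N $$ (i,i) = of_real (qre (N $$ (i,i))) \<and> 0 \<le> qre (N $$ (i,i))"
    by blast
  have dk: "i < m" "i < n" if "d i \<noteq> 0" for i
    using that d(3)[of i] by (meson min.cobounded1 min.cobounded2 not_le order_less_le_trans)+
  \<comment> \<open>\<open>S\<close> is \<open>m \<times> m\<close> and \<open>T\<close> is \<open>n \<times> n\<close>, so one formula for both needs \<open>N\<close> padded with zeros.\<close>
  define x where "x i j = (if i < m \<and> j < n then N $$ (i,j) else 0)" for i j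
  define s where "s i j = (if i = j then (if d i = 0 then 0 else (1 / d i) *\<^sub>R (x i i - of_real (qre (x i i))))
    else if d i = d j then (if d i = 0 then 0 else (1 / d i) *\<^sub>R x i j)
    else (1 / ((d j)\<^sup>2 - (d i)\<^sup>2)) *\<^sub>R (d j *\<^sub>R x i j + d i *\<^sub>R star (x j i)))" for i j
  define t where "t i j = (if i = j \<or> d i = d j then 0
    else (1 / ((d j)\<^sup>2 - (d i)\<^sup>2)) *\<^sub>R (d i *\<^sub>R x i j + d j *\<^sub>R star (x j i)))" for i j
  have sq: "(d j)\<^sup>2 - (d i)\<^sup>2 \<noteq> 0" if "d i \<noteq> d j" for i j
    using d(2)[of i] d(2)[of j] that by (simp add: power2_eq_iff_nonneg)
  have neg: "1 / ((d i)\<^sup>2 - (d j)\<^sup>2) = - (1 / ((d j)\<^sup>2 - (d i)\<^sup>2))" for i j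
    by (metis minus_diff_eq minus_divide_right)
  have x_skew: "x i j = - star (x j i)" if "i \<noteq> j" "d i = d j" "d i \<noteq> 0" for i j
  proof -
    have "i < ?k" "j < ?k" using that dk[of i] dk[of j] by auto
    then show ?thesis
      using Neq[of i j] Neq[of j i] that by (cases i j rule: linorder_cases) (auto simp: x_def star_minus)
  qed
  have s_skew: "star (s j i) = - s i j" for i j
  proof (cases "i = j \<or> d i = d j")
    case True
    then show ?thesis
      using x_skew[of i j] by (auto simp: s_def quat_eq_iff of_real_def)
  next
    case False
    then show ?thesis
      using neg[of i j] by (auto simp: s_def star_add star_minus add.commute)
  qed
  have t_skew: "star (t j i) = - t i j" for i j
    using neg[of i j] by (auto simp: t_def star_add star_minus add.commute)
  have solve: "x i j - d j *\<^sub>R s i j + d i *\<^sub>R t i j = (if i = j then of_real (qre (x i i)) else 0)"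
    if ij: "i < m" "j < n" for i j
  proof (cases "i = j")
    case True
    then show ?thesis
      using Nii[of i] ij by (auto simp: s_def t_def x_def)
  next
    case False
    show ?thesis
    proof (cases "d i = d j")
      case True
      then show ?thesis
        using N0[OF ij False] False ij by (auto simp: s_def t_def x_def)
    next
      case neq: False
      let ?D = "(d j)\<^sup>2 - (d i)\<^sup>2"
      have "x i j - d j *\<^sub>R s i j + d i *\<^sub>R t i j =
        x i j - (1 / ?D) *\<^sub>R (d j *\<^sub>R (d j *\<^sub>R x i j + d i *\<^sub>R star (x j i))
          - d i *\<^sub>R (d i *\<^sub>R x i j + d j *\<^sub>R star (x j i)))"
        using False neq by (simp add: s_def t_def scaleR_right_diff_distrib mult.commute)
      also have "d j *\<^sub>R (d j *\<^sub>R x i j + d i *\<^sub>R star (x j i))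
          - d i *\<^sub>R (d i *\<^sub>R x i j + d j *\<^sub>R star (x j i)) = ?D *\<^sub>R x i j"
        by (simp add: scaleR_left_diff_distrib scaleR_right_distrib power2_eq_square mult.commute)
      also have "x i j - (1 / ?D) *\<^sub>R (?D *\<^sub>R x i j) = 0"
        using sq[OF neq] by simp
      finally show ?thesis using False by simp
    qed
  qed
  define S where "S = mat m m (\<lambda>(i,j). s i j)"
  define T where "T = mat n n (\<lambda>(i,j). t i j)"
  have S: "S \<in> carrier_mat m m" and T: "T \<in> carrier_mat n n" by (auto simp: S_def T_def)
  have skew: "adjoint S = - S" "adjoint T = - T"
    by (auto intro!: eq_matI simp: S_def T_def s_skew t_skew)
  define U V where "U = infinitesimal_unitary S" and "V = infinitesimal_unitary T"
  note stU = st_in_infinitesimal_unitary[OF S, folded U_def]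
  note stV = st_in_infinitesimal_unitary[OF T, folded V_def]
  define \<mu> where "\<mu> i = Dual (d i) (qre (N $$ (i,i)))" for i
  have stB: "st_mat B = rect_diag m n (\<lambda>i. of_real (d i))"
    by (simp add: d(1) rect_diag_def)
  have Uc: "adjoint U \<in> carrier_mat m m" using stU by auto
  have UBc: "adjoint U * B \<in> carrier_mat m n" using Uc B by auto
  show thesis
  proof (rule that[of U V \<mu>])
    show "unitary m U" "unitary n V"
      unfolding U_def V_def using S T skew by (auto intro: unitary_infinitesimal_unitary)
    show "0 \<le> \<mu> i" if "i < ?k" for i
      using d(2)[of i] Nii[OF that] by (auto simp: \<mu>_def less_eq_dual_def)
    show "\<mu> j \<le> \<mu> i" if "i \<le> j" "j < ?k" for i j
      using d(4)[of i j] Neq[of i j] that by (cases "i = j") (auto simp: \<mu>_def less_eq_dual_def)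
    show "adjoint U * B * V = rect_diag m n (\<lambda>i. dq_of_dual (\<mu> i))"
    proof (rule dual_mat_eqI)
      have st: "st_mat (adjoint U * B) = st_mat B"
        using B stU by (simp add: st_mat_mult[OF Uc B] st_mat_adjoint)
      show "st_mat (adjoint U * B * V) = st_mat (rect_diag m n (\<lambda>i. dq_of_dual (\<mu> i)))"
        unfolding st_mat_mult[OF UBc stV(3)] st stV(1)
        by (auto intro!: eq_matI simp: stB \<mu>_def dq_of_dual_def right_mult_one_mat[of _ m n] rect_diag_carrier)
      have "in_mat (adjoint U * B * V) = st_mat B * T + (N + - S * st_mat B)"
        unfolding in_mat_mult[OF UBc stV(3)] st stV in_mat_mult[OF Uc B]
        using N B S by (simp add: st_mat_adjoint in_mat_adjoint stU skew right_mult_one_mat[of _ m n]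
          N_def[symmetric] add_carrier_mat[of _ m n])
      also have "\<dots> = in_mat (rect_diag m n (\<lambda>i. dq_of_dual (\<mu> i)))"
      proof (rule eq_matI)
        fix i j assume "i < dim_row (in_mat (rect_diag m n (\<lambda>i. dq_of_dual (\<mu> i))))"
          "j < dim_col (in_mat (rect_diag m n (\<lambda>i. dq_of_dual (\<mu> i))))"
        then have ij: "i < m" "j < n" by auto
        have "(st_mat B * T + (N + - S * st_mat B)) $$ (i,j) =
          (st_mat B * T) $$ (i,j) + (N $$ (i,j) + (- S * st_mat B) $$ (i,j))"
          using S T N B ij by simp
        also have "(st_mat B * T) $$ (i,j) = d i *\<^sub>R t i j"
          unfolding stB using ij T dk[of i]
          by (subst rect_diag_mult_entry[of _ n n]) (auto simp: T_def of_real_def)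
        also have "(- S * st_mat B) $$ (i,j) = - (d j *\<^sub>R s i j)"
          unfolding stB using ij S dk[of j]
          by (subst mult_rect_diag_entry[of _ m m]) (auto simp: S_def of_real_def)
        also have "d i *\<^sub>R t i j + (N $$ (i,j) + - (d j *\<^sub>R s i j)) =
            (if i = j then of_real (qre (x i i)) else 0)"
          using solve[OF ij] ij by (simp add: x_def algebra_simps)
        finally show "(st_mat B * T + (N + - S * st_mat B)) $$ (i,j) =
            in_mat (rect_diag m n (\<lambda>i. dq_of_dual (\<mu> i))) $$ (i,j)"
          using ij by (simp add: x_def \<mu>_def dq_of_dual_def)
      qed (use S T N B in auto)
      finally show "in_mat (adjoint U * B * V) = in_mat (rect_diag m n (\<lambda>i. dq_of_dual (\<mu> i)))" .
    qed
  qed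
qed

text \<open>The standard factors come from the lexicographic maximum, the infinitesimal ones from
\<open>diagonalise_lex_maximal\<close>. The singular values are sorted in the order of dual numbers; the splitting into
appreciable, infinitesimal and zero ones is read off from this order later.\<close>
theorem dual_quaternion_svd:
  assumes A: "A \<in> carrier_mat m n"
  obtains U V \<mu> where "unitary m U" "unitary n V" "\<And>i. i < min m n \<Longrightarrow> 0 \<le> \<mu> i"
    "\<And>i j. i \<le> j \<Longrightarrow> j < min m n \<Longrightarrow> \<mu> j \<le> \<mu> i"
    "adjoint U * A * V = rect_diag m n (\<lambda>i. dq_of_dual (\<mu> i))"
proof -
  let ?k = "min m n"
  have MN: "st_mat A \<in> carrier_mat m n" "in_mat A \<in> carrier_mat m n" using A by auto
  obtain U V where U: "unitary m U" and V: "unitary n V" and max: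
    "\<And>R T. unitary m R \<Longrightarrow> unitary n T \<Longrightarrow>
       Dual (weighted_trace ?k (adjoint R * st_mat A * T)) (weighted_trace ?k (adjoint R * in_mat A * T))
       \<le> Dual (weighted_trace ?k (adjoint U * st_mat A * V)) (weighted_trace ?k (adjoint U * in_mat A * V))"
    using exists_lexicographic_maximum[OF MN, of ?k] by auto
  note c = unitaryD(1,2)[OF U] unitaryD(1,2)[OF V]
  define U' V' where "U' = std_mat U" and "V' = std_mat V"
  have U': "unitary m U'" and V': "unitary n V'"
    using U V by (auto simp: U'_def V'_def intro: unitary_std_mat)
  note c' = unitaryD(1,2)[OF U'] unitaryD(1,2)[OF V']
  define B where "B = adjoint U' * A * V'"
  have UA: "adjoint U' * A \<in> carrier_mat m n" using c' A by auto
  have B: "B \<in> carrier_mat m n" using UA c' by (auto simp: B_def)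
  have stB: "st_mat B = adjoint U * st_mat A * V"
    unfolding B_def st_mat_mult[OF UA c'(3)] st_mat_mult[OF c'(2) A] st_mat_adjoint
    by (simp add: U'_def V'_def)
  have UX: "adjoint U * X \<in> carrier_mat m n" if "X \<in> carrier_mat m n" for X
    using c that by auto
  have inB: "in_mat B = adjoint U * in_mat A * V"
    unfolding B_def in_mat_mult[OF UA c'(3)] in_mat_mult[OF c'(2) A] st_mat_mult[OF c'(2) A]
      st_mat_adjoint in_mat_adjoint
    using c MN UX[OF MN(1)] UX[OF MN(2)]
    by (simp add: U'_def V'_def right_mult_zero_mat[of _ m n]
      left_mult_zero_mat[of _ m n] left_add_zero_mat[of _ m n] right_add_zero_mat[of _ m n])
  have "lex_maximal m n (st_mat B) (in_mat B)"
    unfolding lex_maximal_def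
  proof (intro conjI allI impI)
    fix R T :: "quat mat" assume R: "unitary m R" and T: "unitary n T"
    have "adjoint R * (adjoint U * X * V) * T = adjoint (U * R) * X * (V * T)" if "X \<in> carrier_mat m n" for X
      using conjugate_mult[OF c(1) _ c(3) _ that] unitaryD(1)[OF R] unitaryD(1)[OF T] by simp
    then show "Dual (weighted_trace ?k (adjoint R * st_mat B * T)) (weighted_trace ?k (adjoint R * in_mat B * T))
        \<le> Dual (weighted_trace ?k (st_mat B)) (weighted_trace ?k (in_mat B))"
      unfolding stB inB using MN max[OF unitary_mult[OF U R] unitary_mult[OF V T]] by simp
  qed (use B in auto)
  from diagonalise_lex_maximal[OF B this] obtain U2 V2 \<mu> where
    *: "unitary m U2" "unitary n V2" "\<And>i. i < ?k \<Longrightarrow> 0 \<le> \<mu> i" "\<And>i j. i \<le> j \<Longrightarrow> j < ?k \<Longrightarrow> \<mu> j \<le> \<mu> i"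
    "adjoint U2 * B * V2 = rect_diag m n (\<lambda>i. dq_of_dual (\<mu> i))"
    by blast
  show thesis
  proof (rule that[of "U' * U2" "V' * V2" \<mu>])
    show "adjoint (U' * U2) * A * (V' * V2) = rect_diag m n (\<lambda>i. dq_of_dual (\<mu> i))"
      using conjugate_mult[OF c'(1) _ c'(3) _ A] unitaryD(1)[OF *(1)] unitaryD(1)[OF *(2)] *(5)
      by (simp add: B_def)
  qed (use * U' V' in \<open>auto intro: unitary_mult\<close>)
qed

section \<open>The appreciable rank\<close>

lemma rect_diag_mult:
  fixes f g :: "nat \<Rightarrow> 'a::semiring_0"
  shows "rect_diag m n f * rect_diag n l g = rect_diag m l (\<lambda>i. if i < n then f i * g i else 0)"
  by (rule eq_matI) (auto simp: mult_rect_diag_entry[of _ m n] simp del: index_mult_mat(1))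

lemma adjoint_rect_diag: "adjoint (rect_diag m n f) = rect_diag n m (\<lambda>i. star (f i))"
  by (rule eq_matI) auto

lemma unitary_conjugate_solve:
  assumes U: "unitary m U" and V: "unitary n V" and A: "A \<in> carrier_mat m n"
    and eq: "adjoint U * A * V = B"
  shows "A = U * B * adjoint V"
proof -
  note c = unitaryD(1,2)[OF U] unitaryD(1,2)[OF V]
  have X: "adjoint U * A \<in> carrier_mat m n" using c A by auto
  have "U * B = U * (adjoint U * A) * V"
    unfolding eq[symmetric] by (rule assoc_mult_mat[OF c(1) X c(3), symmetric])
  also have "U * (adjoint U * A) = A" by (rule unitary_cancel_left[OF U A])
  finally show ?thesis using unitary_cancel_right(2)[OF V A] by simp
qed

lemma mult_cancel_middle:
  assumes V: "unitary n V" and c: "U \<in> carrier_mat a m" "D \<in> carrier_mat m n"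
    "E \<in> carrier_mat n l" "W \<in> carrier_mat l b"
  shows "U * D * adjoint V * (V * E * W) = U * (D * E) * W"
proof -
  note v = unitaryD(1,2)[OF V]
  have UD: "U * D \<in> carrier_mat a n" and EW: "E * W \<in> carrier_mat n b"
    and DE: "D * E \<in> carrier_mat m l" and VEW: "V * (E * W) \<in> carrier_mat n b"
    using c v by auto
  have "U * D * adjoint V * (V * E * W) = U * D * adjoint V * (V * (E * W))"
    by (simp only: assoc_mult_mat[OF v(1) c(3,4)])
  also have "\<dots> = U * D * (adjoint V * (V * (E * W)))"
    by (rule assoc_mult_mat[OF UD v(2) VEW])
  also have "\<dots> = U * D * (E * W)" by (simp only: unitary_cancel_left[OF V EW])
  also have "\<dots> = U * D * E * W" by (rule assoc_mult_mat[OF UD c(3,4), symmetric])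
  also have "U * D * E = U * (D * E)" by (rule assoc_mult_mat[OF c(1-3)])
  finally show ?thesis .
qed

text \<open>Over the quaternions \<open>tr (A B)\<close> and \<open>tr (B A)\<close> differ in general, but their real parts agree.\<close>
definition real_trace :: "quat mat \<Rightarrow> real" where
  "real_trace A = (\<Sum>i<dim_row A. qre (A $$ (i,i)))"

lemma real_trace_mult_commute:
  assumes "A \<in> carrier_mat m n" "B \<in> carrier_mat n m"
  shows "real_trace (A * B) = real_trace (B * A)"
proof -
  have "real_trace (A * B) = (\<Sum>i<m. \<Sum>l<n. qre (A $$ (i,l) * B $$ (l,i)))"
    using assms by (auto simp: real_trace_def mult_mat_entry[OF assms] simp del: index_mult_mat(1) intro!: sum.cong)
  also have "\<dots> = (\<Sum>l<n. \<Sum>i<m. qre (B $$ (l,i) * A $$ (i,l)))"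
    by (subst sum.swap) (simp only: qre_mult_commute)
  also have "\<dots> = real_trace (B * A)"
    using assms by (auto simp: real_trace_def mult_mat_entry[OF assms(2,1)] simp del: index_mult_mat(1) intro!: sum.cong)
  finally show ?thesis .
qed

text \<open>The projection is \<open>M\<close> times its pseudo-inverse; this factorisation is what makes the projection recoverable
from the range alone.\<close>
lemma range_projection:
  fixes d :: "nat \<Rightarrow> real"
  assumes U: "unitary m U" and V: "unitary n V" and r: "r \<le> m" "r \<le> n"
    and d: "\<And>i. i < r \<Longrightarrow> d i \<noteq> 0"
    and M: "M = U * rect_diag m n (\<lambda>i. if i < r then of_real (d i) else 0) * adjoint V"
  obtains P G where "P \<in> carrier_mat m m" "G \<in> carrier_mat n m" "M * G = P" "P * M = M"
    "adjoint P = P" "real_trace P = real r"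
proof -
  let ?D = "rect_diag m n (\<lambda>i. if i < r then of_real (d i) else 0) :: quat mat"
  let ?E = "rect_diag n m (\<lambda>i. if i < r then of_real (1 / d i) else 0) :: quat mat"
  let ?J = "rect_diag m m (\<lambda>i. if i < r then 1 else 0) :: quat mat"
  note u = unitaryD(1,2)[OF U] and v = unitaryD(1,2)[OF V]
  define P G where "P = U * ?J * adjoint U" and "G = V * ?E * adjoint U"
  have UJ: "U * ?J \<in> carrier_mat m m" and JU: "?J * adjoint U \<in> carrier_mat m m"
    using u by auto
  show thesis
  proof (rule that[of P G])
    show "P \<in> carrier_mat m m" "G \<in> carrier_mat n m"
      using u v by (auto simp: P_def G_def)
    have "?D * ?E = ?J"
      using d r by (auto simp: rect_diag_mult intro!: eq_matI simp flip: of_real_mult)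
    then show "M * G = P"
      unfolding M G_def P_def
      by (subst mult_cancel_middle[OF V u(1) rect_diag_carrier rect_diag_carrier u(2)]) simp
    have "?J * ?D = ?D"
      using r by (auto simp: rect_diag_mult intro!: eq_matI)
    then show "P * M = M"
      unfolding M P_def
      by (subst mult_cancel_middle[OF U u(1) rect_diag_carrier rect_diag_carrier v(2)]) simp
    have "adjoint P = U * (?J * adjoint U)"
      unfolding P_def adjoint_mult[OF UJ u(2)] adjoint_mult[OF u(1) rect_diag_carrier]
      by (auto simp: adjoint_rect_diag intro!: arg_cong[where f = "(*) U"] arg_cong[where f = "\<lambda>X. X * adjoint U"] eq_matI)
    then show "adjoint P = P"
      unfolding P_def by (simp add: assoc_mult_mat[OF u(1) rect_diag_carrier u(2)])
    have "real_trace P = real_trace (?J * adjoint U * U)"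
      unfolding P_def assoc_mult_mat[OF u(1) rect_diag_carrier u(2)]
      by (rule real_trace_mult_commute[OF u(1) JU])
    also have "?J * adjoint U * U = ?J" by (rule unitary_cancel_right(1)[OF U rect_diag_carrier])
    also have "real_trace ?J = (\<Sum>i<m. if i < r then 1 else 0)"
      by (auto simp: real_trace_def intro!: sum.cong)
    also have "\<dots> = (\<Sum>i<r. 1)"
      using r by (intro sum.mono_neutral_cong_right) auto
    finally show "real_trace P = real r" by simp
  qed
qed

text \<open>Two orthogonal projections onto the same range satisfy \<open>P' P = P\<close> and \<open>P P' = P'\<close>, and taking adjoints
turns one equation into the other. Equality of ranges is expressed by \<open>M G = P\<close> and \<open>P M = M\<close>.\<close>
lemma range_projection_unique:
  fixes P P' :: "'a::star_ring mat"
  assumes c: "M \<in> carrier_mat m n" "P \<in> carrier_mat m m" "G \<in> carrier_mat n m"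
    "P' \<in> carrier_mat m m" "G' \<in> carrier_mat n m"
    and P: "M * G = P" "P * M = M" "adjoint P = P"
    and P': "M * G' = P'" "P' * M = M" "adjoint P' = P'"
  shows "P = P'"
proof -
  have *: "P' * P = P" "P * P' = P'"
    using P P' assoc_mult_mat[OF c(4,1,3)] assoc_mult_mat[OF c(2,1,5)] by auto
  have "P = adjoint (P' * P)" using * P by simp
  also have "\<dots> = P * P'" by (simp add: adjoint_mult[OF c(4,2)] P P')
  finally show ?thesis using * by simp
qed

lemma initial_segment:
  assumes "\<And>i j. i \<le> j \<Longrightarrow> j < k \<Longrightarrow> P j \<Longrightarrow> P i"
  obtains t where "t \<le> k" "\<And>i. i < k \<Longrightarrow> P i \<longleftrightarrow> i < (t::nat)"
proof -
  have "\<exists>t\<le>k. \<forall>i<k. P i \<longleftrightarrow> i < t"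
    using assms
  proof (induction k)
    case (Suc k)
    show ?case
    proof (cases "P k")
      case True
      then show ?thesis using Suc.prems[of _ k] by (intro exI[of _ "Suc k"]) auto
    next
      case False
      from Suc.IH Suc.prems obtain t where "t \<le> k" "\<forall>i<k. P i \<longleftrightarrow> i < t"
        by (metis less_SucI)
      then show ?thesis using False by (intro exI[of _ t]) (auto simp: less_Suc_eq)
    qed
  qed auto
  then show thesis using that by blast
qed

lemma dq_of_dual_simps [simp]:
  "dq_of_dual 0 = 0" "dq_of_dual 1 = 1" "dq_of_dual (x * y) = dq_of_dual x * dq_of_dual y"
  "dq_of_dual (x + y) = dq_of_dual x + dq_of_dual y" "dq_of_dual (x - y) = dq_of_dual x - dq_of_dual y"
  "star (dq_of_dual x) = dq_of_dual x"
  "st_part (dq_of_dual x) = of_real (st_part x)" "in_part (dq_of_dual x) = of_real (in_part x)"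
  by (auto simp: dq_of_dual_def dual_eq_iff dual.map_sel)

lemma dq_of_dual_inject [simp]: "dq_of_dual x = dq_of_dual y \<longleftrightarrow> x = y"
  by (auto simp: dual_eq_iff)

lemma rect_diag_eq_diag_block_mat:
  assumes "t \<le> m" "t \<le> n"
  shows "diag_block_mat [dual_diag t \<mu>, 0\<^sub>m (m - t) (n - t)] =
    rect_diag m n (\<lambda>i. if i < t then dq_of_dual (\<mu> i) else 0)"
  using assms by (auto simp: dual_diag_def mat_diag_def Let_def intro!: eq_matI)

lemma exists_dq_svd:
  assumes A: "A \<in> carrier_mat m n"
  shows "\<exists>r U V t \<mu>. dq_svd A U V r t \<mu>"
proof -
  let ?k = "min m n"
  obtain U V \<mu> where svd: "unitary m U" "unitary n V" "\<And>i. i < ?k \<Longrightarrow> 0 \<le> \<mu> i"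
    "\<And>i j. i \<le> j \<Longrightarrow> j < ?k \<Longrightarrow> \<mu> j \<le> \<mu> i"
    "adjoint U * A * V = rect_diag m n (\<lambda>i. dq_of_dual (\<mu> i))"
    using dual_quaternion_svd[OF A] by metis
  obtain t where t: "t \<le> ?k" "\<And>i. i < ?k \<Longrightarrow> 0 < \<mu> i \<longleftrightarrow> i < t"
    using initial_segment[of ?k "\<lambda>i. 0 < \<mu> i"] svd(4) by (metis order_less_le_trans)
  have st: "st_part (\<mu> j) \<le> st_part (\<mu> i)" if "i \<le> j" "j < ?k" for i j
    using svd(4)[OF that] by (auto simp: less_eq_dual_def)
  obtain r where r: "r \<le> ?k" "\<And>i. i < ?k \<Longrightarrow> 0 < st_part (\<mu> i) \<longleftrightarrow> i < r"
    using initial_segment[of ?k "\<lambda>i. 0 < st_part (\<mu> i)"] st by (metis order_less_le_trans)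
  have rt: "r \<le> t"
  proof (rule ccontr)
    assume "\<not> r \<le> t"
    then have "t < ?k" "0 < st_part (\<mu> t)" using r by auto
    then have "0 < \<mu> t" by (simp add: less_dual_def)
    then show False using t(2)[OF \<open>t < ?k\<close>] by simp
  qed
  have "rect_diag m n (\<lambda>i. dq_of_dual (\<mu> i)) =
    rect_diag m n (\<lambda>i. if i < t then dq_of_dual (\<mu> i) else 0)"
  proof (rule eq_matI)
    fix i j assume "i < dim_row (rect_diag m n (\<lambda>i. if i < t then dq_of_dual (\<mu> i) else 0))"
      "j < dim_col (rect_diag m n (\<lambda>i. if i < t then dq_of_dual (\<mu> i) else 0))"
    then show "rect_diag m n (\<lambda>i. dq_of_dual (\<mu> i)) $$ (i,j) =
        rect_diag m n (\<lambda>i. if i < t then dq_of_dual (\<mu> i) else 0) $$ (i,j)"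
      using svd(3)[of i] t(2)[of i] by (auto simp: order_le_less)
  qed auto
  then have "dq_adjoint U * A * V = diag_block_mat [dual_diag t \<mu>, 0\<^sub>m (m - t) (n - t)]"
    using t(1) by (simp add: dq_adjoint_eq_adjoint svd(5) rect_diag_eq_diag_block_mat del: diag_block_mat.simps)
  moreover have "\<not> appreciable (\<mu> i)" if "i \<in> {r..<t}" for i
    using that r(2)[of i] t svd(3)[of i] by (auto simp: appreciable_def less_eq_dual_def)
  moreover have "appreciable (\<mu> i)" if "i < r" for i
    using that r(2)[of i] r(1) by (auto simp: appreciable_def)
  moreover have "0 < \<mu> i" if "i < t" for i using that t by auto
  ultimately have "dq_svd A U V r t \<mu>"
    using A svd(1,2,4) r(1) t(1) rt
    by (auto simp: dq_svd_def dq_unitary_eq_unitary monotone_on_def simp del: diag_block_mat.simps)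
  then show ?thesis by blast
qed

lemma dq_svd_solve:
  assumes A: "A \<in> carrier_mat m n" and svd: "dq_svd A U V r t \<mu>"
  shows "unitary m U" "unitary n V" "r \<le> t" "t \<le> m" "t \<le> n"
    "A = U * rect_diag m n (\<lambda>i. if i < t then dq_of_dual (\<mu> i) else 0) * adjoint V"
    "\<And>i. i < r \<Longrightarrow> st_part (\<mu> i) \<noteq> 0" "\<And>i. r \<le> i \<Longrightarrow> i < t \<Longrightarrow> st_part (\<mu> i) = 0"
proof -
  note d = svd[unfolded dq_svd_def dq_unitary_eq_unitary dq_adjoint_eq_adjoint]
  show u: "unitary m U" "unitary n V" "r \<le> t" "t \<le> m" "t \<le> n"
    using d A by auto
  have "adjoint U * A * V = diag_block_mat [dual_diag t \<mu>, 0\<^sub>m (m - t) (n - t)]"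
    using d A by simp
  also have "\<dots> = rect_diag m n (\<lambda>i. if i < t then dq_of_dual (\<mu> i) else 0)"
    using u by (intro rect_diag_eq_diag_block_mat)
  finally show "A = U * rect_diag m n (\<lambda>i. if i < t then dq_of_dual (\<mu> i) else 0) * adjoint V"
    by (rule unitary_conjugate_solve[OF u(1,2) A])
  show "\<And>i. i < r \<Longrightarrow> st_part (\<mu> i) \<noteq> 0" "\<And>i. r \<le> i \<Longrightarrow> i < t \<Longrightarrow> st_part (\<mu> i) = 0"
    using d by (auto simp: appreciable_def)
qed

lemma dq_svd_projection:
  assumes A: "A \<in> carrier_mat m n" and svd: "dq_svd A U V r t \<mu>"
  obtains P G where "P \<in> carrier_mat m m" "G \<in> carrier_mat n m" "st_mat A * G = P" "P * st_mat A = st_mat A"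
    "adjoint P = P" "real_trace P = real r"
proof -
  note s = dq_svd_solve[OF A svd]
  let ?D = "rect_diag m n (\<lambda>i. if i < t then dq_of_dual (\<mu> i) else 0)"
  note c = unitaryD(1,2)[OF s(1)] unitaryD(1,2)[OF s(2)]
  have UD: "U * ?D \<in> carrier_mat m n" using c by auto
  have "st_mat A = st_mat U * st_mat ?D * adjoint (st_mat V)"
    unfolding s(6) st_mat_mult[OF UD c(4)] st_mat_mult[OF c(1) rect_diag_carrier] st_mat_adjoint ..
  also have "st_mat ?D = rect_diag m n (\<lambda>i. if i < r then of_real (st_part (\<mu> i)) else 0)"
    using s(3,8) by (auto intro!: eq_matI)
  finally have eq: "st_mat A = st_mat U * rect_diag m n (\<lambda>i. if i < r then of_real (st_part (\<mu> i)) else 0)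
    * adjoint (st_mat V)" .
  have r: "r \<le> m" "r \<le> n" using s(3,4,5) by auto
  show thesis
    by (rule range_projection[OF unitary_st_mat[OF s(1)] unitary_st_mat[OF s(2)] r s(7) eq])
      (assumption | rule that)+
qed

text \<open>The projection onto the range of the standard part determines the number of appreciable singular values as
its real trace.\<close>
lemma dq_svd_appreciable_unique:
  assumes A: "A \<in> carrier_mat m n" and svd: "dq_svd A U V r t \<mu>" "dq_svd A U' V' r' t' \<mu>'"
  shows "r = r'"
proof -
  have M: "st_mat A \<in> carrier_mat m n" using A by auto
  obtain P G where P: "P \<in> carrier_mat m m" "G \<in> carrier_mat n m" "st_mat A * G = P" "P * st_mat A = st_mat A"
    "adjoint P = P" "real_trace P = real r"
    using dq_svd_projection[OF A svd(1)] by metis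
  obtain P' G' where P': "P' \<in> carrier_mat m m" "G' \<in> carrier_mat n m" "st_mat A * G' = P'" "P' * st_mat A = st_mat A"
    "adjoint P' = P'" "real_trace P' = real r'"
    using dq_svd_projection[OF A svd(2)] by metis
  have "P = P'"
    using range_projection_unique[OF M P(1,2) P'(1,2) P(3-5) P'(3-5)] .
  then show ?thesis using P(6) P'(6) by simp
qed

lemma Arank_dq_svd:
  assumes A: "A \<in> carrier_mat m n"
  obtains U V t \<mu> where "dq_svd A U V (Arank A) t \<mu>"
proof -
  have "\<exists>!r. \<exists>U V t \<mu>. dq_svd A U V r t \<mu>"
    using exists_dq_svd[OF A] dq_svd_appreciable_unique[OF A] by blast
  from theI'[OF this] show thesis using that unfolding Arank_def by blast
qed

lemma append_rows_mult:
  assumes "A \<in> carrier_mat m n" "B \<in> carrier_mat p n" "X \<in> carrier_mat n t"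
  shows "(A @\<^sub>r B) * X = (A * X) @\<^sub>r (B * X)"
  using assms
  by (intro eq_matI) (auto simp: append_rows_def scalar_prod_def intro!: sum.cong)

lemma gram_append_rows:
  fixes P Q :: "'a::star_ring mat"
  assumes "P \<in> carrier_mat m t" "Q \<in> carrier_mat p t"
  shows "adjoint (P @\<^sub>r Q) * (P @\<^sub>r Q) = adjoint P * P + adjoint Q * Q"
proof -
  have "adjoint (P @\<^sub>r Q) * (P @\<^sub>r Q) =
    four_block_mat (adjoint P * P + adjoint Q * Q) (adjoint P * 0\<^sub>m m 0 + adjoint Q * 0\<^sub>m p 0)
      (0\<^sub>m 0 m * P + 0\<^sub>m 0 p * Q) (0\<^sub>m 0 m * 0\<^sub>m m 0 + 0\<^sub>m 0 p * 0\<^sub>m p 0)"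
    using assms unfolding append_rows_def
    by (simp add: adjoint_four_block[of _ m t _ 0 _ p] mult_four_block_mat[of _ t m _ p _ 0 _ _ t _ 0])
  also have "\<dots> = adjoint P * P + adjoint Q * Q"
    using assms by (intro eq_matI) auto
  finally show ?thesis .
qed

text \<open>\<open>X\<close> consists of the right singular vectors of the appreciable singular values, scaled by the inverses of
these values. Infinitesimal singular values are not invertible and are left out; this is why the number of
columns is the appreciable rank.\<close>
lemma orthonormal_reduction:
  assumes A: "A \<in> carrier_mat m n" and B: "B \<in> carrier_mat p n" and t: "Arank (A @\<^sub>r B) = t"
  obtains X where "t \<le> n" "X \<in> carrier_mat n t"
    "adjoint (A * X) * (A * X) + adjoint (B * X) * (B * X) = 1\<^sub>m t"
proof -
  have C: "A @\<^sub>r B \<in> carrier_mat (m + p) n" using A B by auto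
  obtain U V t' \<mu> where svd: "dq_svd (A @\<^sub>r B) U V t t' \<mu>"
    using Arank_dq_svd[OF C] t by metis
  note s = dq_svd_solve[OF C svd]
  note c = unitaryD(1,2)[OF s(1)] unitaryD(1,2)[OF s(2)]
  \<comment> \<open>the inverse of an appreciable dual number\<close>
  let ?inv = "\<lambda>x. Dual (1 / st_part x) (- in_part x / (st_part x)\<^sup>2)"
  let ?D = "rect_diag (m + p) n (\<lambda>i. if i < t' then dq_of_dual (\<mu> i) else 0)"
  let ?E = "rect_diag n t (\<lambda>i. dq_of_dual (?inv (\<mu> i)))"
  let ?J = "rect_diag (m + p) t (\<lambda>i. 1) :: quat dual mat"
  define X where "X = V * ?E"
  have X: "X \<in> carrier_mat n t" using c by (auto simp: X_def)
  have inv: "\<mu> i * ?inv (\<mu> i) = 1" if "i < t" for i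
    using s(7)[OF that] by (simp add: dual_eq_iff power2_eq_square)
  have DE: "?D * ?E = ?J"
    unfolding rect_diag_mult
  proof (rule eq_matI)
    fix i j assume "i < dim_row ?J" "j < dim_col ?J"
    then show "rect_diag (m + p) t (\<lambda>i. if i < n then (if i < t' then dq_of_dual (\<mu> i) else 0) *
        dq_of_dual (?inv (\<mu> i)) else 0) $$ (i,j) = ?J $$ (i,j)"
      using s(3,5) inv[of i] by (auto simp flip: dq_of_dual_simps(3))
  qed auto
  have CX: "(A @\<^sub>r B) * X = U * ?J"
  proof -
    have "(A @\<^sub>r B) * X = U * ?D * adjoint V * (V * ?E * 1\<^sub>m t)"
      using c X unfolding s(6) X_def by (simp add: right_mult_one_mat[of _ n t])
    also have "\<dots> = U * (?D * ?E) * 1\<^sub>m t"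
      by (rule mult_cancel_middle[OF s(2) c(1)]) auto
    also have "\<dots> = U * ?J"
      unfolding DE using c by (intro right_mult_one_mat mult_carrier_mat[of _ "m + p" "m + p"]) auto
    finally show ?thesis .
  qed
  have UJ: "U * ?J \<in> carrier_mat (m + p) t" using c by auto
  have "adjoint (U * ?J) * (U * ?J) = adjoint ?J * (adjoint U * (U * ?J))"
    unfolding adjoint_mult[OF c(1) rect_diag_carrier]
    by (rule assoc_mult_mat[OF adjoint_carrier[OF rect_diag_carrier] c(2) UJ])
  also have "\<dots> = adjoint ?J * ?J"
    by (simp only: unitary_cancel_left[OF s(1) rect_diag_carrier])
  also have "\<dots> = 1\<^sub>m t"
    using s(3,4) by (auto simp: adjoint_rect_diag rect_diag_mult intro!: eq_matI)
  finally have "adjoint (A * X) * (A * X) + adjoint (B * X) * (B * X) = 1\<^sub>m t"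
    using gram_append_rows[OF mult_carrier_mat[OF A X] mult_carrier_mat[OF B X]]
      append_rows_mult[OF A B X] CX by simp
  then show thesis using that[of X] X s(3,5) by simp
qed

section \<open>Permutations and completion to a unitary matrix\<close>

definition perm_mat :: "nat \<Rightarrow> (nat \<Rightarrow> nat) \<Rightarrow> 'a::star_ring mat" where
  "perm_mat n \<pi> = mat n n (\<lambda>(i,j). if i = \<pi> j then 1 else 0)"

lemma perm_mat_carrier [simp, intro]: "perm_mat n \<pi> \<in> carrier_mat n n"
  by (simp add: perm_mat_def)

lemma mult_perm_mat_entry:
  assumes "M \<in> carrier_mat m n" "bij_betw \<pi> {..<n} {..<n}" "i < m" "j < n"
  shows "(M * perm_mat n \<pi>) $$ (i,j) = M $$ (i, \<pi> j)"
proof -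
  have \<pi>: "\<pi> j < n" using assms(2,4) by (auto simp: bij_betw_def)
  have "(M * perm_mat n \<pi>) $$ (i,j) = (\<Sum>l<n. M $$ (i,l) * perm_mat n \<pi> $$ (l,j))"
    using assms by (intro mult_mat_entry) auto
  also have "\<dots> = (\<Sum>l<n. if l = \<pi> j then M $$ (i, \<pi> j) else 0)"
    using assms by (intro sum.cong) (auto simp: perm_mat_def)
  finally show ?thesis using \<pi> by simp
qed

lemma adjoint_perm_mat_mult_entry:
  assumes "M \<in> carrier_mat n m" "bij_betw \<pi> {..<n} {..<n}" "i < n" "j < m"
  shows "(adjoint (perm_mat n \<pi>) * M) $$ (i,j) = M $$ (\<pi> i, j)"
proof -
  have \<pi>: "\<pi> i < n" using assms(2,3) by (auto simp: bij_betw_def)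
  have "(adjoint (perm_mat n \<pi>) * M) $$ (i,j) = (\<Sum>l<n. adjoint (perm_mat n \<pi>) $$ (i,l) * M $$ (l,j))"
    using assms by (intro mult_mat_entry) auto
  also have "\<dots> = (\<Sum>l<n. if l = \<pi> i then M $$ (\<pi> i, j) else 0)"
    using assms by (intro sum.cong) (auto simp: perm_mat_def)
  finally show ?thesis using \<pi> by simp
qed

lemma unitary_perm_mat:
  assumes \<pi>: "bij_betw \<pi> {..<n} {..<n}"
  shows "unitary n (perm_mat n \<pi> :: 'a::star_ring mat)"
proof -
  let ?P = "perm_mat n \<pi> :: 'a mat"
  have "adjoint ?P * ?P = 1\<^sub>m n"
  proof (rule eq_matI)
    fix i j assume "i < dim_row (1\<^sub>m n :: 'a mat)" "j < dim_col (1\<^sub>m n :: 'a mat)"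
    then have ij: "i < n" "j < n" by auto
    moreover from ij have "\<pi> i < n" "\<pi> i = \<pi> j \<longleftrightarrow> i = j"
      using \<pi> by (auto simp: bij_betw_def inj_on_eq_iff)
    ultimately show "(adjoint ?P * ?P) $$ (i,j) = 1\<^sub>m n $$ (i,j)"
      by (subst adjoint_perm_mat_mult_entry[OF perm_mat_carrier \<pi>]) (auto simp: perm_mat_def)
  qed (auto simp: perm_mat_def)
  moreover have "?P * adjoint ?P = 1\<^sub>m n"
  proof (rule eq_matI)
    fix i j assume "i < dim_row (1\<^sub>m n :: 'a mat)" "j < dim_col (1\<^sub>m n :: 'a mat)"
    then have ij: "i < n" "j < n" by auto
    have "(?P * adjoint ?P) $$ (i,j) = (\<Sum>l<n. ?P $$ (i,l) * adjoint ?P $$ (l,j))"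
      using ij by (intro mult_mat_entry) auto
    also have "\<dots> = (\<Sum>l<n. if i = \<pi> l then if j = \<pi> l then 1 else 0 else 0)"
      using ij by (intro sum.cong) (auto simp: perm_mat_def)
    also have "\<dots> = (\<Sum>a<n. if i = a then if j = a then 1 else 0 else 0)"
      by (rule sum.reindex_bij_betw[OF \<pi>])
    also have "\<dots> = 1\<^sub>m n $$ (i,j)"
      using ij by (simp add: sum.delta')
    finally show "(?P * adjoint ?P) $$ (i,j) = 1\<^sub>m n $$ (i,j)" .
  qed (auto simp: perm_mat_def)
  ultimately show ?thesis by (simp add: unitary_def)
qed

lemma gram_entry:
  assumes "Q \<in> carrier_mat p t" "i < t" "j < t"
  shows "(adjoint Q * Q) $$ (i,j) = (\<Sum>l<p. star (Q $$ (l,i)) * Q $$ (l,j))"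
  using assms by (subst mult_mat_entry[of _ t p _ t]) auto

lemma gram_unitary_mult:
  assumes V: "unitary p V" and Q: "Q \<in> carrier_mat p t"
  shows "adjoint (adjoint V * Q) * (adjoint V * Q) = adjoint Q * Q"
    "adjoint (V * Q) * (V * Q) = adjoint Q * Q"
proof -
  have *: "adjoint (V * Q) * (V * Q) = adjoint Q * Q" if V: "unitary p V" for V
  proof -
    note c = unitaryD(1,2)[OF V]
    show ?thesis
      unfolding adjoint_mult[OF c(1) Q]
      using assoc_mult_mat[OF adjoint_carrier[OF Q] c(2) mult_carrier_mat[OF c(1) Q]]
        unitary_cancel_left(1)[OF V Q] by simp
  qed
  show "adjoint (adjoint V * Q) * (adjoint V * Q) = adjoint Q * Q"
    "adjoint (V * Q) * (V * Q) = adjoint Q * Q"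
    using *[OF V] *[OF unitary_adjoint[OF V]] by auto
qed

lemma gram_mult_unitary:
  assumes Y: "unitary t Y" and P: "P \<in> carrier_mat m t" and Q: "Q \<in> carrier_mat p t"
    and eq: "adjoint P * P + adjoint Q * Q = 1\<^sub>m t"
  shows "adjoint (P * Y) * (P * Y) + adjoint (Q * Y) * (Q * Y) = 1\<^sub>m t"
proof -
  note c = unitaryD(1,2)[OF Y]
  have *: "adjoint (P * Y) * (P * Y) = adjoint Y * (adjoint P * P) * Y" if P: "P \<in> carrier_mat m t" for P m
  proof -
    have "adjoint (P * Y) * (P * Y) = adjoint Y * adjoint P * (P * Y)"
      by (simp only: adjoint_mult[OF P c(1)])
    also have "\<dots> = adjoint Y * (adjoint P * (P * Y))"
      using c P by (intro assoc_mult_mat[of _ t t _ m _ t]) auto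
    also have "adjoint P * (P * Y) = adjoint P * P * Y"
      using c P by (intro assoc_mult_mat[of _ t m _ t _ t, symmetric]) auto
    also have "adjoint Y * (adjoint P * P * Y) = adjoint Y * (adjoint P * P) * Y"
      using c P by (intro assoc_mult_mat[of _ t t _ t _ t, symmetric]) auto
    finally show ?thesis .
  qed
  have PP: "adjoint P * P \<in> carrier_mat t t" and QQ: "adjoint Q * Q \<in> carrier_mat t t"
    using P Q by auto
  have "adjoint (P * Y) * (P * Y) + adjoint (Q * Y) * (Q * Y) =
      (adjoint Y * (adjoint P * P) + adjoint Y * (adjoint Q * Q)) * Y"
    unfolding *[OF P] *[OF Q]
    by (rule add_mult_distrib_mat[OF mult_carrier_mat[OF c(2) PP] mult_carrier_mat[OF c(2) QQ] c(1), symmetric])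
  also have "adjoint Y * (adjoint P * P) + adjoint Y * (adjoint Q * Q) =
      adjoint Y * (adjoint P * P + adjoint Q * Q)"
    by (rule mult_add_distrib_mat[OF c(2) PP QQ, symmetric])
  also have "\<dots> * Y = 1\<^sub>m t"
    unfolding eq using c unitaryD(3)[OF Y] by simp
  finally show ?thesis .
qed

lemma qre_star_mult_eq_0: "qre (star x * x) = 0 \<Longrightarrow> x = 0"
  by (simp add: quat_part_mult quat_eq_iff) (smt (verit) mult_eq_0_iff zero_le_square)

text \<open>The squared norm of a dual quaternion vector cannot be a nonzero infinitesimal: if its standard part
vanishes, all entries are infinitesimal and their products are zero.\<close>
lemma dual_norm_st_zero:
  fixes f :: "nat \<Rightarrow> quat dual"
  assumes "x = (\<Sum>l<p. star (f l) * f l)"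
  shows "0 \<le> qre (st_part x)"
    and "st_part x = 0 \<Longrightarrow> l < p \<Longrightarrow> st_part (f l) = 0"
    and "st_part x = 0 \<Longrightarrow> in_part x = 0"
proof -
  have st: "qre (st_part x) = (\<Sum>l<p. qre (star (st_part (f l)) * st_part (f l)))"
    by (simp add: assms)
  show "0 \<le> qre (st_part x)"
    unfolding st by (intro sum_nonneg qre_star_mult_nonneg)
  show *: "st_part (f l) = 0" if "st_part x = 0" "l < p" for l
  proof -
    have "(\<Sum>l<p. qre (star (st_part (f l)) * st_part (f l))) = 0"
      using st that(1) by simp
    then have "\<forall>l\<in>{..<p}. qre (star (st_part (f l)) * st_part (f l)) = 0"
      by (subst (asm) sum_nonneg_eq_0_iff) (simp_all only: qre_star_mult_nonneg finite_lessThan)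
    then show ?thesis using that(2) qre_star_mult_eq_0 by blast
  qed
  show "in_part x = 0" if "st_part x = 0"
    using *[OF that] by (simp add: assms)
qed

lemma dual_square_eq_one:
  fixes x :: "real dual"
  assumes "0 \<le> x" "x * x = 1"
  shows "x = 1"
proof -
  have "st_part x * st_part x = 1" "st_part x * in_part x = 0"
    using assms(2) by (auto simp: dual_eq_iff)
  moreover have "0 \<le> st_part x" using assms(1) by (auto simp: less_eq_dual_def)
  ultimately show ?thesis by (auto simp: dual_eq_iff square_eq_1_iff)
qed

text \<open>The singular values of a matrix with orthonormal columns are all \<open>1\<close>, so its singular value decomposition
reads \<open>Q = U J W\<^sup>*\<close> with \<open>J\<close> an identity block above a zero block. Since \<open>J W\<^sup>* = diag (W\<^sup>*, I) J\<close>, the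
unitary \<open>U diag (W\<^sup>*, I)\<close> has the columns of \<open>Q\<close> as its first columns; a cyclic permutation moves them
to the end, where the block form of \<open>\<Sigma>\<^sub>B\<close> wants them.\<close>
lemma unitary_completion:
  assumes Q: "Q \<in> carrier_mat p s" and orth: "adjoint Q * Q = 1\<^sub>m s"
  obtains V where "s \<le> p" "unitary p V"
    "adjoint V * Q = mat p s (\<lambda>(i,j). if i = j + (p - s) then 1 else 0 :: quat dual)"
proof -
  obtain U W \<mu> where U: "unitary p U" and W: "unitary s W"
    and \<mu>: "\<And>i. i < min p s \<Longrightarrow> 0 \<le> \<mu> i"
    and eq: "adjoint U * Q * W = rect_diag p s (\<lambda>i. dq_of_dual (\<mu> i))"
    using dual_quaternion_svd[OF Q] by metis
  let ?D = "rect_diag p s (\<lambda>i. dq_of_dual (\<mu> i))"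
  note u = unitaryD(1,2)[OF U] and w = unitaryD(1,2)[OF W]
  have UQ: "adjoint U * Q \<in> carrier_mat p s" using u Q by auto
  have z: "0\<^sub>m 0 s \<in> carrier_mat 0 s" by simp
  have "adjoint ?D * ?D = 1\<^sub>m s"
  proof -
    have "adjoint (adjoint U * Q) * (adjoint U * Q) + adjoint (0\<^sub>m 0 s) * 0\<^sub>m 0 s = 1\<^sub>m s"
      unfolding gram_unitary_mult(1)[OF U Q] orth by (rule eq_matI) auto
    from gram_mult_unitary[OF W UQ z this] have
      "adjoint ?D * ?D + adjoint (0\<^sub>m 0 s * W) * (0\<^sub>m 0 s * W) = 1\<^sub>m s" unfolding eq .
    moreover have "adjoint ?D * ?D + adjoint (0\<^sub>m 0 s * W) * (0\<^sub>m 0 s * W) = adjoint ?D * ?D"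
      using w by (intro eq_matI) (auto simp: scalar_prod_def)
    ultimately show ?thesis by simp
  qed
  then have DD: "rect_diag s s (\<lambda>i. if i < p then dq_of_dual (\<mu> i * \<mu> i) else 0) = 1\<^sub>m s"
    by (simp add: adjoint_rect_diag rect_diag_mult cong: if_cong)
  have one: "(if j < p then dq_of_dual (\<mu> j * \<mu> j) else 0) = 1" if "j < s" for j
    using that arg_cong[OF DD, of "\<lambda>M. M $$ (j,j)"] by (simp del: dq_of_dual_simps)
  have sp: "s \<le> p"
  proof (rule ccontr)
    assume "\<not> s \<le> p"
    then show False using one[of p] by simp
  qed
  have \<mu>1: "\<mu> j = 1" if "j < s" for j
  proof (rule dual_square_eq_one)
    show "0 \<le> \<mu> j" using that sp \<mu>[of j] by simp
    have "dq_of_dual (\<mu> j * \<mu> j) = dq_of_dual 1"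
      using one[OF that] that sp by (simp del: dq_of_dual_simps(3))
    then show "\<mu> j * \<mu> j = 1" by (simp only: dq_of_dual_inject)
  qed
  let ?J = "rect_diag p s (\<lambda>i. 1) :: quat dual mat"
  have D: "?D = ?J" using \<mu>1 by (intro eq_matI) auto
  define W' where "W' = four_block_mat (adjoint W) (0\<^sub>m s (p - s)) (0\<^sub>m (p - s) s) (1\<^sub>m (p - s))"
  have W': "unitary p W'"
    using unitary_four_block[OF unitary_adjoint[OF W] unitary_one[of "p - s"]] sp by (simp add: W'_def)
  have WJ: "W' * ?J = ?J * adjoint W"
  proof (rule eq_matI)
    fix i j assume "i < dim_row (?J * adjoint W)" "j < dim_col (?J * adjoint W)"
    then have ij: "i < p" "j < s" using w by auto
    have "(W' * ?J) $$ (i,j) = (if j < p then W' $$ (i,j) * 1 else 0)"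
      using ij by (intro mult_rect_diag_entry[OF unitaryD(1)[OF W']])
    moreover have "(?J * adjoint W) $$ (i,j) = (if i < s then 1 * adjoint W $$ (i,j) else 0)"
      using ij by (intro rect_diag_mult_entry[OF w(2)])
    ultimately show "(W' * ?J) $$ (i,j) = (?J * adjoint W) $$ (i,j)"
      using w(1) sp ij by (simp add: W'_def del: index_mult_mat(1))
  qed (use w unitaryD(1)[OF W'] in auto)
  define \<pi> where "\<pi> i = (if i < p - s then i + s else i - (p - s))" for i
  have \<pi>: "bij_betw \<pi> {..<p} {..<p}"
    by (rule bij_betw_byWitness[of _ "\<lambda>i. if i < s then i + (p - s) else i - s"])
      (use sp in \<open>auto simp: \<pi>_def\<close>)
  define V where "V = U * W' * perm_mat p \<pi>"
  have UW: "unitary p (U * W')" by (rule unitary_mult[OF U W'])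
  have V: "unitary p V" unfolding V_def by (rule unitary_mult[OF UW unitary_perm_mat[OF \<pi>]])
  have "Q = U * ?J * adjoint W"
    by (rule unitary_conjugate_solve[OF U W Q]) (simp add: eq D)
  also have "\<dots> = U * (?J * adjoint W)" by (rule assoc_mult_mat[OF u(1) rect_diag_carrier w(2)])
  also have "\<dots> = U * W' * ?J"
    unfolding WJ[symmetric] by (rule assoc_mult_mat[OF u(1) unitaryD(1)[OF W'] rect_diag_carrier, symmetric])
  finally have QJ: "adjoint (U * W') * Q = ?J"
    using unitary_cancel_left(1)[OF UW rect_diag_carrier] by simp
  have "adjoint V * Q = adjoint (perm_mat p \<pi>) * ?J"
    unfolding V_def adjoint_mult[OF unitaryD(1)[OF UW] perm_mat_carrier] QJ[symmetric]
    by (rule assoc_mult_mat[OF adjoint_carrier[OF perm_mat_carrier] unitaryD(2)[OF UW] Q])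
  also have "\<dots> = mat p s (\<lambda>(i,j). if i = j + (p - s) then 1 else 0)"
  proof (rule eq_matI)
    fix i j assume "i < dim_row (mat p s (\<lambda>(i,j). if i = j + (p - s) then 1 else 0 :: quat dual))"
      "j < dim_col (mat p s (\<lambda>(i,j). if i = j + (p - s) then 1 else 0 :: quat dual))"
    then have ij: "i < p" "j < s" by auto
    moreover have "\<pi> i < p" using ij sp by (auto simp: \<pi>_def)
    moreover have "\<pi> i = j \<longleftrightarrow> i = j + (p - s)" using ij sp by (auto simp: \<pi>_def)
    ultimately show "(adjoint (perm_mat p \<pi>) * ?J) $$ (i,j) =
        mat p s (\<lambda>(i,j). if i = j + (p - s) then 1 else 0) $$ (i,j)"
      by (simp add: adjoint_perm_mat_mult_entry[OF rect_diag_carrier \<pi>] del: index_mult_mat(1))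
  qed (auto simp: perm_mat_def)
  finally show thesis using that sp V by blast
qed

section \<open>The CS decomposition\<close>

text \<open>The square root of \<open>1 - x\<^sup>2\<close>: for \<open>x = a + b \<epsilon>\<close> with \<open>\<bar>a\<bar> < 1\<close> it is
\<open>sqrt (1 - a\<^sup>2) - (a b / sqrt (1 - a\<^sup>2)) \<epsilon>\<close>.\<close>
definition complementary_sine :: "real dual \<Rightarrow> real dual" where
  "complementary_sine x =
     Dual (sqrt (1 - (st_part x)\<^sup>2)) (- (st_part x * in_part x) / sqrt (1 - (st_part x)\<^sup>2))"

lemma complementary_sine:
  assumes "0 \<le> st_part x" "st_part x < 1"
  shows "0 < st_part (complementary_sine x)"
    "complementary_sine x * complementary_sine x = 1 - x * x"
proof -
  have "(st_part x)\<^sup>2 < 1" using assms by (simp add: abs_square_less_1)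
  then show "0 < st_part (complementary_sine x)"
    "complementary_sine x * complementary_sine x = 1 - x * x"
    by (auto simp: complementary_sine_def dual_eq_iff power2_eq_square)
qed

lemma complementary_sine_infinitesimal: "st_part x = 0 \<Longrightarrow> complementary_sine x = 1"
  by (simp add: complementary_sine_def one_dual_def)

lemma complementary_sine_less_1:
  assumes "0 < st_part x" "st_part x < 1"
  shows "complementary_sine x < 1"
  using assms by (simp add: complementary_sine_def less_dual_def)

lemma complementary_sine_antimono:
  assumes "x \<le> y" "0 \<le> st_part x" "0 \<le> st_part y" "st_part y < 1"
  shows "complementary_sine y \<le> complementary_sine x"
proof (cases "st_part x = st_part y")
  case True
  then have "in_part x \<le> in_part y" using assms(1) by (auto simp: less_eq_dual_def)
  then have "st_part y * in_part x \<le> st_part y * in_part y"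
    using assms(3) by (rule mult_left_mono)
  moreover have "0 < sqrt (1 - (st_part y)\<^sup>2)"
    using assms(3,4) by (simp add: abs_square_less_1)
  ultimately show ?thesis
    using True by (simp add: complementary_sine_def less_eq_dual_def divide_right_mono)
next
  case False
  then have "st_part x < st_part y" using assms(1) by (auto simp: less_eq_dual_def)
  then have "(st_part x)\<^sup>2 < (st_part y)\<^sup>2"
    using assms(2) by (intro power_strict_mono) auto
  then show ?thesis by (simp add: complementary_sine_def less_eq_dual_def)
qed

lemma gram_complement_entry:
  fixes \<nu> :: "nat \<Rightarrow> real dual"
  assumes R: "R \<in> carrier_mat p t" and ij: "i < t" "j < t"
    and gram: "adjoint (rect_diag m t (\<lambda>i. dq_of_dual (\<nu> i))) * rect_diag m t (\<lambda>i. dq_of_dual (\<nu> i))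
      + adjoint R * R = 1\<^sub>m t"
  shows "(adjoint R * R) $$ (i,j) =
    (if i = j then 1 - (if j < m then dq_of_dual (\<nu> j * \<nu> j) else 0) else 0)"
proof -
  have "rect_diag t t (\<lambda>i. if i < m then dq_of_dual (\<nu> i * \<nu> i) else 0) + adjoint R * R = 1\<^sub>m t"
    using gram by (simp add: adjoint_rect_diag rect_diag_mult cong: if_cong)
  from arg_cong[OF this, of "\<lambda>M. M $$ (i,j)"]
  have "(if i = j then (if i < m then dq_of_dual (\<nu> i * \<nu> i) else 0) else 0) + (adjoint R * R) $$ (i,j)
      = (if i = j then 1 else 0)"
    using R ij by (simp del: index_mult_mat(1) dq_of_dual_simps)
  then show ?thesis by (auto simp: algebra_simps split: if_splits)
qed

text \<open>\<open>1 - \<nu>\<^sub>j\<^sup>2\<close> is the squared norm of a column of \<open>R\<close>: its standard part is nonnegative, and if that part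
vanishes then so does the infinitesimal part \<open>-2 a b\<close> of \<open>1 - (a + b \<epsilon>)\<^sup>2\<close>.\<close>
lemma cosine_bound:
  fixes \<nu> :: "nat \<Rightarrow> real dual"
  assumes R: "R \<in> carrier_mat p t" and j: "j < m" "j < t" and pos: "0 \<le> \<nu> j"
    and gram: "adjoint (rect_diag m t (\<lambda>i. dq_of_dual (\<nu> i))) * rect_diag m t (\<lambda>i. dq_of_dual (\<nu> i))
      + adjoint R * R = 1\<^sub>m t"
  shows "st_part (\<nu> j) \<le> 1" "st_part (\<nu> j) = 1 \<Longrightarrow> \<nu> j = 1"
proof -
  let ?x = "1 - dq_of_dual (\<nu> j * \<nu> j)"
  have x: "?x = (\<Sum>l<p. star (R $$ (l,j)) * R $$ (l,j))"
    using gram_complement_entry[OF R j(2) j(2) gram] gram_entry[OF R j(2) j(2)] j by simp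
  note norm = dual_norm_st_zero[OF x]
  have st0: "0 \<le> st_part (\<nu> j)" using pos by (auto simp: less_eq_dual_def)
  have "(st_part (\<nu> j))\<^sup>2 \<le> 1"
    using norm(1) by (simp add: quat_part_mult of_real_def power2_eq_square)
  then show "st_part (\<nu> j) \<le> 1" using st0 by (simp add: abs_square_le_1)
  assume one: "st_part (\<nu> j) = 1"
  then have "in_part ?x = 0" by (intro norm(3)) simp
  then have "of_real (2 * in_part (\<nu> j)) = (0 :: quat)" using one by simp
  then have "in_part (\<nu> j) = 0" by (simp only: of_real_eq_0_iff)
  then show "\<nu> j = 1" using one by (simp add: dual_eq_iff)
qed

text \<open>The diagonal of \<open>\<Sigma>\<^sub>A\<close>.\<close>
definition cosines :: "nat \<Rightarrow> nat \<Rightarrow> nat \<Rightarrow> (nat \<Rightarrow> real dual) \<Rightarrow> (nat \<Rightarrow> real) \<Rightarrow> nat \<Rightarrow> real dual" where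
  "cosines r q l c \<xi> i = (if i < r then 1 else if i < r + q then c (i - r)
     else if i < r + q + l then Dual 0 (\<xi> (i - (r + q))) else 0)"

text \<open>The singular values of \<open>P\<close> come in decreasing order, so they already consist of the value \<open>1\<close>, the other
appreciable values, the infinitesimal ones and zeros, in this order. Only the second group has to be
reversed, because the cosines are required to increase.\<close>
lemma cosine_decomposition:
  assumes P: "P \<in> carrier_mat m t" and Q: "Q \<in> carrier_mat p t"
    and gram: "adjoint P * P + adjoint Q * Q = 1\<^sub>m t"
  obtains U Y r q l \<xi> c where "unitary m U" "unitary t Y" "r + q + l \<le> m" "r + q + l \<le> t"
    "\<And>i. i < l \<Longrightarrow> 0 < \<xi> i" "\<And>i j. i \<le> j \<Longrightarrow> j < l \<Longrightarrow> \<xi> j \<le> \<xi> i"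
    "\<And>i. i < q \<Longrightarrow> 0 < st_part (c i) \<and> st_part (c i) < 1"
    "\<And>i j. i \<le> j \<Longrightarrow> j < q \<Longrightarrow> c i \<le> c j"
    "adjoint U * P * Y = rect_diag m t (\<lambda>i. dq_of_dual (cosines r q l c \<xi> i))"
proof -
  let ?k = "min m t"
  obtain U Y \<mu> where U: "unitary m U" and Y: "unitary t Y" and pos: "\<And>i. i < ?k \<Longrightarrow> 0 \<le> \<mu> i"
    and mono: "\<And>i j. i \<le> j \<Longrightarrow> j < ?k \<Longrightarrow> \<mu> j \<le> \<mu> i"
    and eq: "adjoint U * P * Y = rect_diag m t (\<lambda>i. dq_of_dual (\<mu> i))"
    using dual_quaternion_svd[OF P] by metis
  let ?D = "rect_diag m t (\<lambda>i. dq_of_dual (\<mu> i))"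
  note u = unitaryD(1,2)[OF U] and y = unitaryD(1,2)[OF Y]
  have UP: "adjoint U * P \<in> carrier_mat m t" and QY: "Q * Y \<in> carrier_mat p t"
    using u y P Q by auto
  have gramD: "adjoint ?D * ?D + adjoint (Q * Y) * (Q * Y) = 1\<^sub>m t"
    using gram_mult_unitary[OF Y UP Q] gram unfolding gram_unitary_mult(1)[OF U P] eq by simp
  have le1: "st_part (\<mu> i) \<le> 1" and eq1: "st_part (\<mu> i) = 1 \<Longrightarrow> \<mu> i = 1" if "i < ?k" for i
    using cosine_bound[OF QY _ _ pos[OF that] gramD] that by auto
  have st_mono: "st_part (\<mu> j) \<le> st_part (\<mu> i)" if "i \<le> j" "j < ?k" for i j
    using mono[OF that] by (auto simp: less_eq_dual_def)
  obtain r where r: "r \<le> ?k" "\<And>i. i < ?k \<Longrightarrow> 1 \<le> st_part (\<mu> i) \<longleftrightarrow> i < r"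
    using initial_segment[of ?k "\<lambda>i. 1 \<le> st_part (\<mu> i)"] st_mono by (metis order_trans)
  obtain b where b: "b \<le> ?k" "\<And>i. i < ?k \<Longrightarrow> 0 < st_part (\<mu> i) \<longleftrightarrow> i < b"
    using initial_segment[of ?k "\<lambda>i. 0 < st_part (\<mu> i)"] st_mono by (metis order_less_le_trans)
  obtain e where e: "e \<le> ?k" "\<And>i. i < ?k \<Longrightarrow> 0 < \<mu> i \<longleftrightarrow> i < e"
    using initial_segment[of ?k "\<lambda>i. 0 < \<mu> i"] mono by (metis order_less_le_trans)
  have rb: "r \<le> b"
  proof (rule ccontr)
    assume "\<not> r \<le> b"
    then have "b < ?k" "b < r" using r(1) by auto
    then show False using r(2)[of b] b(2)[of b] by simp
  qed
  have be: "b \<le> e"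
  proof (rule ccontr)
    assume "\<not> b \<le> e"
    then have "e < ?k" "e < b" using b(1) by auto
    then show False using b(2)[of e] e(2)[of e] by (simp add: less_dual_def)
  qed
  \<comment> \<open>reversal of the indices \<open>r, \<dots>, b - 1\<close>\<close>
  define \<pi> where "\<pi> i = (if r \<le> i \<and> i < b then r + b - 1 - i else i)" for i
  have \<pi>: "bij_betw \<pi> {..<n} {..<n}" if "b \<le> n" for n
    by (rule bij_betw_byWitness[of _ \<pi>]) (use rb that in \<open>auto simp: \<pi>_def\<close>)
  have \<pi>m: "bij_betw \<pi> {..<m} {..<m}" and \<pi>t: "bij_betw \<pi> {..<t} {..<t}"
    using \<pi> b(1) by auto
  define q l where "q = b - r" and "l = e - b"
  define c where "c i = \<mu> (b - 1 - i)" for i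
  define \<xi> where "\<xi> i = in_part (\<mu> (b + i))" for i
  have sums: "r + q = b" "r + q + l = e" using rb be by (auto simp: q_def l_def)
  have \<mu>\<pi>: "\<mu> (\<pi> i) = cosines r q l c \<xi> i" if "i < ?k" for i
  proof -
    consider "i < r" | "r \<le> i" "i < b" | "b \<le> i" "i < e" | "e \<le> i" by linarith
    then show ?thesis
    proof cases
      case 1
      then have "\<mu> i = 1" using le1[OF that] eq1[OF that] r(2)[OF that] by auto
      then show ?thesis using 1 by (simp add: cosines_def \<pi>_def)
    next
      case 2
      then have "r + b - 1 - i = b - 1 - (i - r)" by simp
      then show ?thesis using 2 sums by (simp add: cosines_def \<pi>_def c_def)
    next
      case 3
      then have "st_part (\<mu> i) = 0"
        using b(2)[OF that] pos[OF that] by (auto simp: less_eq_dual_def)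
      then show ?thesis using 3 sums rb by (simp add: cosines_def \<pi>_def \<xi>_def dual_eq_iff)
    next
      case 4
      then have "\<mu> i = 0" using e(2)[OF that] pos[OF that] by auto
      then show ?thesis using 4 sums rb be by (simp add: cosines_def \<pi>_def)
    qed
  qed
  let ?U = "U * perm_mat m \<pi>" and ?Y = "Y * perm_mat t \<pi>"
  have DY: "?D * perm_mat t \<pi> \<in> carrier_mat m t"
    by (rule mult_carrier_mat[OF rect_diag_carrier perm_mat_carrier])
  have "adjoint ?U * P * ?Y = adjoint (perm_mat m \<pi>) * ?D * perm_mat t \<pi>"
    using conjugate_mult[OF u(1) perm_mat_carrier y(1) perm_mat_carrier P] eq by simp
  also have "\<dots> = adjoint (perm_mat m \<pi>) * (?D * perm_mat t \<pi>)"
    by (rule assoc_mult_mat[OF adjoint_carrier[OF perm_mat_carrier] rect_diag_carrier perm_mat_carrier])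
  also have "\<dots> = rect_diag m t (\<lambda>i. dq_of_dual (cosines r q l c \<xi> i))"
  proof (rule eq_matI)
    fix i j assume "i < dim_row (rect_diag m t (\<lambda>i. dq_of_dual (cosines r q l c \<xi> i)))"
      "j < dim_col (rect_diag m t (\<lambda>i. dq_of_dual (cosines r q l c \<xi> i)))"
    then have ij: "i < m" "j < t" by auto
    then have \<pi>b: "\<pi> i < m" "\<pi> j < t" using \<pi>m \<pi>t by (auto simp: bij_betw_def)
    have "inj_on \<pi> {..<max m t}"
      using \<pi>[of "max m t"] b(1) by (auto simp: bij_betw_def)
    then have "\<pi> i = \<pi> j \<longleftrightarrow> i = j"
      using ij by (intro inj_on_eq_iff) auto
    then show "(adjoint (perm_mat m \<pi>) * (?D * perm_mat t \<pi>)) $$ (i,j) =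
        rect_diag m t (\<lambda>i. dq_of_dual (cosines r q l c \<xi> i)) $$ (i,j)"
      using ij \<pi>b \<mu>\<pi>[of i]
      by (cases "i = j") (simp_all add: adjoint_perm_mat_mult_entry[OF DY \<pi>m] mult_perm_mat_entry[OF rect_diag_carrier \<pi>t]
        del: index_mult_mat(1))
  qed (auto simp: perm_mat_def)
  finally have final: "adjoint ?U * P * ?Y = rect_diag m t (\<lambda>i. dq_of_dual (cosines r q l c \<xi> i))" .
  show thesis
  proof (rule that[OF _ _ _ _ _ _ _ _ final])
    show "unitary m ?U" "unitary t ?Y"
      using unitary_mult[OF U unitary_perm_mat[OF \<pi>m]] unitary_mult[OF Y unitary_perm_mat[OF \<pi>t]] by auto
    show "r + q + l \<le> m" "r + q + l \<le> t" using sums e(1) by auto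
    show "0 < \<xi> i" if "i < l" for i
    proof -
      have "b + i < e" "b + i < ?k" using that e(1) by (auto simp: l_def)
      then show ?thesis using e(2)[of "b + i"] b(2)[of "b + i"] by (auto simp: \<xi>_def less_dual_def)
    qed
    show "\<xi> j \<le> \<xi> i" if "i \<le> j" "j < l" for i j
    proof -
      have *: "b + j < e" "b + j < ?k" "b + i < ?k" using that e(1) by (auto simp: l_def)
      have "st_part (\<mu> (b + n)) = 0" if "b + n < ?k" for n
        using b(2)[OF that] pos[OF that] by (auto simp: less_eq_dual_def)
      then show ?thesis using mono[of "b + i" "b + j"] * that(1) by (auto simp: \<xi>_def less_eq_dual_def)
    qed
    show "0 < st_part (c i) \<and> st_part (c i) < 1" if "i < q" for i
    proof -
      have *: "b - 1 - i < ?k" "b - 1 - i < b" "r \<le> b - 1 - i" using that b(1) by (auto simp: q_def)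
      then show ?thesis using b(2)[OF *(1)] r(2)[OF *(1)] by (auto simp: c_def)
    qed
    show "c i \<le> c j" if "i \<le> j" "j < q" for i j
      unfolding c_def using that b(1) rb by (intro mono) (auto simp: q_def)
  qed
qed

text \<open>With \<open>P\<close> diagonal, the columns of \<open>R = Q Y\<close> are orthogonal. The last \<open>t - r\<close> of them have invertible norm;
normalised, they become the last \<open>t - r\<close> columns of a unitary \<open>V\<close>, so \<open>V\<^sup>* R\<close> is block diagonal with a
diagonal lower right block. The first \<open>r\<close> columns have norm zero, so the upper left block \<open>E\<close> is
infinitesimal and its singular values are the \<open>\<sigma>\<^sub>i \<epsilon>\<close>. Rotating the first \<open>r\<close> coordinates by the right
singular vectors of \<open>E\<close> does not disturb the cosines, because \<open>P\<close> is the identity there and the same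
rotation is applied on the left.\<close>
lemma cs_decomposition:
  assumes P: "P \<in> carrier_mat m t" and Q: "Q \<in> carrier_mat p t"
    and gram: "adjoint P * P + adjoint Q * Q = 1\<^sub>m t"
  obtains U V Y r r1 q l \<sigma> \<xi> c where "unitary m U" "unitary p V" "unitary t Y"
    "r1 \<le> r" "r + q + l \<le> m" "r + q + l \<le> t" "t + r1 \<le> p + r"
    "\<And>i. i < r1 \<Longrightarrow> 0 < \<sigma> i" "\<And>i j. i \<le> j \<Longrightarrow> j < r1 \<Longrightarrow> \<sigma> j \<le> \<sigma> i"
    "\<And>i. i < l \<Longrightarrow> 0 < \<xi> i" "\<And>i j. i \<le> j \<Longrightarrow> j < l \<Longrightarrow> \<xi> j \<le> \<xi> i"
    "\<And>i. i < q \<Longrightarrow> 0 < st_part (c i) \<and> st_part (c i) < 1"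
    "\<And>i j. i \<le> j \<Longrightarrow> j < q \<Longrightarrow> c i \<le> c j"
    "adjoint U * P * Y = rect_diag m t (\<lambda>i. dq_of_dual (cosines r q l c \<xi> i))"
    "adjoint V * Q * Y = four_block_mat
       (rect_diag (p + r - t) r (\<lambda>i. if i < r1 then dq_of_dual (Dual 0 (\<sigma> i)) else 0))
       (0\<^sub>m (p + r - t) (t - r)) (0\<^sub>m (t - r) r)
       (rect_diag (t - r) (t - r) (\<lambda>i. if i < q then dq_of_dual (complementary_sine (c i)) else 1))"
proof -
  obtain U Y r q l c \<xi> where U: "unitary m U" and Y: "unitary t Y"
    and dims: "r + q + l \<le> m" "r + q + l \<le> t"
    and \<xi>: "\<And>i. i < l \<Longrightarrow> 0 < \<xi> i" "\<And>i j. i \<le> j \<Longrightarrow> j < l \<Longrightarrow> \<xi> j \<le> \<xi> i"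
    and c: "\<And>i. i < q \<Longrightarrow> 0 < st_part (c i) \<and> st_part (c i) < 1"
      "\<And>i j. i \<le> j \<Longrightarrow> j < q \<Longrightarrow> c i \<le> c j"
    and eq: "adjoint U * P * Y = rect_diag m t (\<lambda>i. dq_of_dual (cosines r q l c \<xi> i))"
    by (rule cosine_decomposition[OF P Q gram]) ((rule that); blast)
  define \<nu> where "\<nu> = cosines r q l c \<xi>"
  define sn where "sn i = complementary_sine (\<nu> i)" for i
  let ?D = "rect_diag m t (\<lambda>i. dq_of_dual (\<nu> i))"
  let ?inv = "\<lambda>x. Dual (1 / st_part x) (- in_part x / (st_part x)\<^sup>2)"
  note u = unitaryD(1,2)[OF U] and y = unitaryD(1,2)[OF Y]
  define R where "R = Q * Y"
  have R: "R \<in> carrier_mat p t" using Q y by (auto simp: R_def)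
  have UP: "adjoint U * P \<in> carrier_mat m t" using u P by auto
  have gramD: "adjoint ?D * ?D + adjoint R * R = 1\<^sub>m t"
    using gram_mult_unitary[OF Y UP Q] gram
    unfolding gram_unitary_mult(1)[OF U P] eq R_def \<nu>_def by simp
  have \<nu>_low: "\<nu> i = 1" if "i < r" for i using that by (simp add: \<nu>_def cosines_def)
  have \<nu>_high: "0 \<le> st_part (\<nu> i) \<and> st_part (\<nu> i) < 1" if "r \<le> i" for i
  proof (cases "i < r + q")
    case True
    then have "i - r < q" using that by simp
    from c(1)[OF this] show ?thesis using True that by (simp add: \<nu>_def cosines_def)
  qed (use that in \<open>simp add: \<nu>_def cosines_def\<close>)
  have \<nu>_m: "\<nu> i = 0" if "m \<le> i" for i using that dims by (auto simp: \<nu>_def cosines_def)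
  have gramR: "(adjoint R * R) $$ (i,j) = (if i = j then 1 - dq_of_dual (\<nu> j * \<nu> j) else 0)"
    if "i < t" "j < t" for i j
    using gram_complement_entry[OF R that gramD] \<nu>_m[of j] by auto
  have sn: "0 < st_part (sn i)" "sn i * sn i = 1 - \<nu> i * \<nu> i" if "r \<le> i" for i
    using complementary_sine[of "\<nu> i"] \<nu>_high[OF that] by (auto simp: sn_def)
  have inv: "sn i * ?inv (sn i) = 1" "?inv (sn i) * sn i = 1" if "r \<le> i" for i
    using sn(1)[OF that] by (simp_all add: dual_eq_iff power2_eq_square)
  have rt: "r \<le> t" using dims by simp

  \<comment> \<open>the normalised columns of \<open>R\<close> with index at least \<open>r\<close>\<close>
  define N where "N = mat p (t - r) (\<lambda>(i,j). R $$ (i, j + r) * dq_of_dual (?inv (sn (j + r))))"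
  have N: "N \<in> carrier_mat p (t - r)" by (simp add: N_def)
  have "adjoint N * N = 1\<^sub>m (t - r)"
  proof (rule eq_matI)
    fix i j assume "i < dim_row (1\<^sub>m (t - r) :: quat dual mat)" "j < dim_col (1\<^sub>m (t - r) :: quat dual mat)"
    then have ij: "i < t - r" "j < t - r" by auto
    then have ij': "i + r < t" "j + r < t" by auto
    have "(adjoint N * N) $$ (i,j) = (\<Sum>l<p. dq_of_dual (?inv (sn (i + r))) *
        (star (R $$ (l, i + r)) * R $$ (l, j + r)) * dq_of_dual (?inv (sn (j + r))))"
      using ij by (subst gram_entry[OF N ij]) (auto intro!: sum.cong simp: N_def star_mult mult.assoc)
    also have "\<dots> = dq_of_dual (?inv (sn (i + r))) * (adjoint R * R) $$ (i + r, j + r) *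
        dq_of_dual (?inv (sn (j + r)))"
      by (simp add: gram_entry[OF R ij'] sum_distrib_left sum_distrib_right)
    also have "\<dots> = 1\<^sub>m (t - r) $$ (i,j)"
    proof (cases "i = j")
      case True
      have "(adjoint R * R) $$ (i + r, j + r) = dq_of_dual (sn (j + r) * sn (j + r))"
        using gramR[OF ij'] True sn(2)[of "j + r"] by (simp del: index_mult_mat(1))
      moreover have "?inv (sn (j + r)) * (sn (j + r) * sn (j + r)) * ?inv (sn (j + r)) = 1"
        using inv[of "j + r"] by (metis le_add2 mult.assoc mult_1)
      ultimately show ?thesis
        using True ij by (metis dq_of_dual_simps(2,3) index_one_mat(1))
    next
      case False
      then show ?thesis using gramR[OF ij'] ij by (simp del: index_mult_mat(1))
    qed
    finally show "(adjoint N * N) $$ (i,j) = 1\<^sub>m (t - r) $$ (i,j)" .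
  qed (auto simp: N_def)
  from unitary_completion[OF N this] obtain V where tp: "t - r \<le> p" and V: "unitary p V"
    and VN: "adjoint V * N = mat p (t - r) (\<lambda>(i,j). if i = j + (p - (t - r)) then 1 else 0)"
    by blast
  define h where "h = p - (t - r)"
  have h: "h + (t - r) = p" "p + r - t = h" using tp rt by (auto simp: h_def)
  note v = unitaryD(1,2)[OF V]
  define F where "F = adjoint V * R"
  have F: "F \<in> carrier_mat p t" using v R by (auto simp: F_def)
  have gramF: "adjoint F * F = adjoint R * R"
    unfolding F_def by (rule gram_unitary_mult(1)[OF V R])
  have F_right: "F $$ (i,j) = (if i = j - r + h then dq_of_dual (sn j) else 0)"
    if "i < p" "r \<le> j" "j < t" for i j
  proof -
    have "F $$ (i,j) = (\<Sum>l<p. adjoint V $$ (i,l) * (N $$ (l, j - r) * dq_of_dual (sn j)))"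
    proof -
      have "R $$ (l,j) = N $$ (l, j - r) * dq_of_dual (sn j)" if "l < p" for l
        using that \<open>r \<le> j\<close> \<open>j < t\<close> inv(2)[OF \<open>r \<le> j\<close>]
        by (simp add: N_def mult.assoc flip: dq_of_dual_simps(3))
      then show ?thesis
        unfolding F_def using that v R by (subst mult_mat_entry[of _ p p _ t]) auto
    qed
    also have "\<dots> = (adjoint V * N) $$ (i, j - r) * dq_of_dual (sn j)"
      using that v by (subst mult_mat_entry[OF v(2) N]) (auto simp: sum_distrib_right mult.assoc)
    finally show ?thesis
      unfolding VN using that by (simp add: h_def)
  qed
  \<comment> \<open>Row \<open>i\<close> meets the column \<open>a\<close> in its only nonzero entry, so orthogonality of columns kills the entry.\<close>
  have F_left: "F $$ (i,j) = 0" if "h \<le> i" "i < p" "j < r" for i j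
  proof -
    define a where "a = i - h + r"
    have a: "a < t" "r \<le> a" "i = a - r + h" using that h by (auto simp: a_def)
    have jt: "j < t" using that(3) rt by simp
    have "(\<Sum>l<p. star (F $$ (l,a)) * F $$ (l,j)) = 0"
      using gramR[OF a(1) jt] a(2) that(3) by (simp add: gramF flip: gram_entry[OF F a(1) jt] del: index_mult_mat(1))
    also have "(\<Sum>l<p. star (F $$ (l,a)) * F $$ (l,j)) =
        (\<Sum>l<p. if l = i then dq_of_dual (sn a) * F $$ (i,j) else 0)"
      using F_right[OF _ a(2,1)] a(3) by (intro sum.cong) auto
    finally have "dq_of_dual (sn a) * F $$ (i,j) = 0" using that(2) by simp
    then have "dq_of_dual (?inv (sn a)) * dq_of_dual (sn a) * F $$ (i,j) = 0"
      by (simp only: mult.assoc mult_zero_right)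
    then show ?thesis
      using inv(2)[OF a(2)] by (simp only: dq_of_dual_simps(2) mult_1 flip: dq_of_dual_simps(3))
  qed
  define E where "E = mat h r (\<lambda>(i,j). F $$ (i,j))"
  define G where "G = rect_diag (t - r) (t - r) (\<lambda>i. dq_of_dual (sn (i + r)))"
  have E: "E \<in> carrier_mat h r" and G: "G \<in> carrier_mat (t - r) (t - r)" by (auto simp: E_def G_def)
  have F_block: "F = four_block_mat E (0\<^sub>m h (t - r)) (0\<^sub>m (t - r) r) G"
  proof (rule eq_matI)
    fix i j assume "i < dim_row (four_block_mat E (0\<^sub>m h (t - r)) (0\<^sub>m (t - r) r) G)"
      "j < dim_col (four_block_mat E (0\<^sub>m h (t - r)) (0\<^sub>m (t - r) r) G)"
    then have "i < p" "j < t" using E G h rt by auto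
    then show "F $$ (i,j) = four_block_mat E (0\<^sub>m h (t - r)) (0\<^sub>m (t - r) r) G $$ (i,j)"
      using F_right[of i j] F_left[of i j] h rt by (auto simp: E_def G_def)
  qed (use F E G h rt in auto)
  have stE: "st_mat E = 0\<^sub>m h r"
  proof (rule eq_matI)
    fix i j assume "i < dim_row (0\<^sub>m h r :: quat mat)" "j < dim_col (0\<^sub>m h r :: quat mat)"
    then have ij: "i < h" "j < r" by auto
    then have jt: "j < t" using rt by simp
    have "(0 :: quat dual) = (\<Sum>l<p. star (F $$ (l,j)) * F $$ (l,j))"
      using gramR[OF jt jt] \<nu>_low[OF ij(2)] by (simp add: gramF flip: gram_entry[OF F jt jt] del: index_mult_mat(1))
    from dual_norm_st_zero(2)[OF this, of i] show "st_mat E $$ (i,j) = 0\<^sub>m h r $$ (i,j)"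
      using ij h by (simp add: E_def)
  qed (auto simp: E_def)
  obtain V3 Y3 \<mu> where V3: "unitary h V3" and Y3: "unitary r Y3"
    and pos: "\<And>i. i < min h r \<Longrightarrow> 0 \<le> \<mu> i"
    and mono: "\<And>i j. i \<le> j \<Longrightarrow> j < min h r \<Longrightarrow> \<mu> j \<le> \<mu> i"
    and svdE: "adjoint V3 * E * Y3 = rect_diag h r (\<lambda>i. dq_of_dual (\<mu> i))"
    using dual_quaternion_svd[OF E] by metis
  note v3 = unitaryD(1,2)[OF V3] and y3 = unitaryD(1,2)[OF Y3]
  have st\<mu>: "st_part (\<mu> i) = 0" if "i < min h r" for i
  proof -
    have "st_mat (adjoint V3 * E * Y3) = 0\<^sub>m h r"
      unfolding st_mat_mult[OF mult_carrier_mat[OF v3(2) E] y3(1)] st_mat_mult[OF v3(2) E] stE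
      using v3 y3 by simp
    from arg_cong[OF this, of "\<lambda>M. M $$ (i,i)"] have "of_real (st_part (\<mu> i)) = (0 :: quat)"
      using that unfolding svdE by simp
    then show ?thesis by (simp only: of_real_eq_0_iff)
  qed
  obtain r1 where r1: "r1 \<le> min h r" "\<And>i. i < min h r \<Longrightarrow> 0 < \<mu> i \<longleftrightarrow> i < r1"
    using initial_segment[of "min h r" "\<lambda>i. 0 < \<mu> i"] mono by (metis order_less_le_trans)
  define \<sigma> where "\<sigma> i = in_part (\<mu> i)" for i
  have svdE': "adjoint V3 * E * Y3 =
    rect_diag (p + r - t) r (\<lambda>i. if i < r1 then dq_of_dual (Dual 0 (\<sigma> i)) else 0)"
    unfolding svdE h(2)
  proof (rule eq_matI)
    fix i j assume "i < dim_row (rect_diag h r (\<lambda>i. if i < r1 then dq_of_dual (Dual 0 (\<sigma> i)) else 0))"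
      "j < dim_col (rect_diag h r (\<lambda>i. if i < r1 then dq_of_dual (Dual 0 (\<sigma> i)) else 0))"
    then have ij: "i < h" "j < r" by auto
    have "\<mu> i = (if i < r1 then Dual 0 (\<sigma> i) else 0)" if "i < min h r"
      using pos[OF that] r1(2)[OF that] st\<mu>[OF that] by (auto simp: \<sigma>_def dual_eq_iff)
    then show "rect_diag h r (\<lambda>i. dq_of_dual (\<mu> i)) $$ (i,j) =
        rect_diag h r (\<lambda>i. if i < r1 then dq_of_dual (Dual 0 (\<sigma> i)) else 0) $$ (i,j)"
      using ij by auto
  qed auto

  define Yr where "Yr b = four_block_mat Y3 (0\<^sub>m r (b - r)) (0\<^sub>m (b - r) r) (1\<^sub>m (b - r))" for b
  define W where "W = four_block_mat V3 (0\<^sub>m h (t - r)) (0\<^sub>m (t - r) h) (1\<^sub>m (t - r))"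
  have Yr: "unitary b (Yr b)" if "r \<le> b" for b
    using unitary_four_block[OF Y3 unitary_one[of "b - r"]] that by (simp add: Yr_def)
  have W: "unitary p W"
    using unitary_four_block[OF V3 unitary_one[of "t - r"]] h by (simp add: W_def)
  have rm: "r \<le> m" using dims by simp
  define D' where "D' = rect_diag (m - r) (t - r) (\<lambda>i. dq_of_dual (\<nu> (i + r)))"
  have D': "D' \<in> carrier_mat (m - r) (t - r)" by (simp add: D'_def)
  have D_block: "?D = four_block_mat (1\<^sub>m r) (0\<^sub>m r (t - r)) (0\<^sub>m (m - r) r) D'"
    using \<nu>_low rm rt by (intro eq_matI) (auto simp: D'_def)
  have fixD: "adjoint (Yr m) * ?D * Yr t = ?D"
    unfolding D_block Yr_def adjoint_four_block[OF y3(1) zero_carrier_mat zero_carrier_mat one_carrier_mat]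
    using y3 D' unitaryD(3)[OF Y3]
    by (simp add: mult_four_block_mat[of _ r r _ "m - r" _ "m - r" _ _ r _ "t - r"]
      mult_four_block_mat[of _ r r _ "t - r" _ "m - r" _ _ r _ "t - r"])
  have EY: "adjoint V3 * E \<in> carrier_mat h r" using v3 E by auto
  have fixF: "adjoint W * F * Yr t = four_block_mat (adjoint V3 * E * Y3)
     (0\<^sub>m h (t - r)) (0\<^sub>m (t - r) r) G"
    unfolding F_block W_def Yr_def
      adjoint_four_block[OF v3(1) zero_carrier_mat zero_carrier_mat one_carrier_mat]
    using v3 y3 E G EY mult_carrier_mat[OF EY y3(1)]
    by (simp add: mult_four_block_mat[of _ h h _ "t - r" _ "t - r" _ _ r _ "t - r"]
      mult_four_block_mat[of _ h r _ "t - r" _ "t - r" _ _ r _ "t - r"])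
  have G_eq: "G = rect_diag (t - r) (t - r) (\<lambda>i. if i < q then dq_of_dual (complementary_sine (c i)) else 1)"
  proof -
    have "sn (i + r) = (if i < q then complementary_sine (c i) else 1)" for i
      by (auto simp: sn_def \<nu>_def cosines_def complementary_sine_infinitesimal)
    then show ?thesis unfolding G_def by (auto intro!: eq_matI)
  qed
  have VQY: "adjoint V * Q * Y = F"
    unfolding F_def R_def by (rule assoc_mult_mat[OF v(2) Q y(1)])
  show thesis
  proof (rule that[of "U * Yr m" "V * W" "Y * Yr t" r1 r q l \<sigma> \<xi> c])
    show "unitary m (U * Yr m)" "unitary p (V * W)" "unitary t (Y * Yr t)"
      using unitary_mult[OF U Yr[OF rm]] unitary_mult[OF V W] unitary_mult[OF Y Yr[OF rt]] by auto
    show "r1 \<le> r" "t + r1 \<le> p + r" using r1(1) h rt by auto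
    show "0 < \<sigma> i" if "i < r1" for i
      using that r1(1) r1(2)[of i] st\<mu>[of i] by (auto simp: \<sigma>_def less_dual_def)
    show "\<sigma> j \<le> \<sigma> i" if "i \<le> j" "j < r1" for i j
      using mono[of i j] st\<mu>[of i] st\<mu>[of j] that r1(1) by (auto simp: \<sigma>_def less_eq_dual_def)
    show "adjoint (U * Yr m) * P * (Y * Yr t) = rect_diag m t (\<lambda>i. dq_of_dual (cosines r q l c \<xi> i))"
      using conjugate_mult[OF u(1) unitaryD(1)[OF Yr[OF rm]] y(1) unitaryD(1)[OF Yr[OF rt]] P]
        fixD unfolding eq \<nu>_def by simp
    show "adjoint (V * W) * Q * (Y * Yr t) = four_block_mat
       (rect_diag (p + r - t) r (\<lambda>i. if i < r1 then dq_of_dual (Dual 0 (\<sigma> i)) else 0))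
       (0\<^sub>m (p + r - t) (t - r)) (0\<^sub>m (t - r) r)
       (rect_diag (t - r) (t - r) (\<lambda>i. if i < q then dq_of_dual (complementary_sine (c i)) else 1))"
      using conjugate_mult[OF v(1) unitaryD(1)[OF W] y(1) unitaryD(1)[OF Yr[OF rt]] Q]
        fixF svdE' G_eq h(2) unfolding VQY by simp
  qed (use dims \<xi> c in auto)
qed

section \<open>The decomposition of a pair of matrices\<close>
lemma append_cols_carrier:
  "A \<in> carrier_mat m k \<Longrightarrow> B \<in> carrier_mat m l \<Longrightarrow> append_cols A B \<in> carrier_mat m (k + l)"
  by (auto simp: append_cols_def)

lemma mult_append_cols_zero:
  fixes M :: "'a::semiring_0 mat"
  assumes M: "M \<in> carrier_mat m n" and Z: "Z \<in> carrier_mat n t"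
  shows "M * append_cols Z (0\<^sub>m n d) = append_cols (M * Z) (0\<^sub>m m d)"
proof (rule eq_matI)
  fix i j assume "i < dim_row (append_cols (M * Z) (0\<^sub>m m d))" "j < dim_col (append_cols (M * Z) (0\<^sub>m m d))"
  then have ij: "i < m" "j < t + d" using assms by (auto simp: append_cols_def)
  have "(M * append_cols Z (0\<^sub>m n d)) $$ (i,j) =
      (\<Sum>l<n. M $$ (i,l) * append_cols Z (0\<^sub>m n d) $$ (l,j))"
    using ij by (intro mult_mat_entry[OF M append_cols_carrier[OF Z]]) auto
  also have "\<dots> = append_cols (M * Z) (0\<^sub>m m d) $$ (i,j)"
    using assms ij by (auto simp: append_cols_def mult_mat_entry[OF M Z] simp del: index_mult_mat(1))
  finally show "(M * append_cols Z (0\<^sub>m n d)) $$ (i,j) = append_cols (M * Z) (0\<^sub>m m d) $$ (i,j)" .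
qed (use assms in \<open>auto simp: append_cols_def\<close>)

lemma rect_diag_cong:
  "(\<And>i. i < m \<Longrightarrow> i < n \<Longrightarrow> f i = g i) \<Longrightarrow> rect_diag m n f = rect_diag m n g"
  by (rule eq_matI) auto

lemma dual_diag_eq_rect_diag: "dual_diag q f = rect_diag q q (\<lambda>i. dq_of_dual (f i))"
  by (auto simp: dual_diag_def mat_diag_def rect_diag_def)

lemma one_mat_eq_rect_diag: "1\<^sub>m n = rect_diag n n (\<lambda>i. 1)"
  by (rule eq_matI) auto

lemma zero_mat_eq_rect_diag: "0\<^sub>m m n = rect_diag m n (\<lambda>i. 0)"
  by (rule eq_matI) auto

lemma diag_block_mat_rect_diag:
  assumes "diag_block_mat Bs = rect_diag m n g"
  shows "diag_block_mat (rect_diag a a f # Bs) =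
    rect_diag (a + m) (a + n) (\<lambda>i. if i < a then f i else g (i - a))"
  by (rule eq_matI) (auto simp: assms Let_def)

lemma cosine_blocks:
  assumes "r + q + l \<le> m" "r + q + l \<le> t"
  shows "diag_block_mat [1\<^sub>m r, dual_diag q c, dual_diag l (\<lambda>i. Dual 0 (\<xi> i)),
      0\<^sub>m (m - (r + q + l)) (t - (r + q + l))] =
    rect_diag m t (\<lambda>i. dq_of_dual (cosines r q l c \<xi> i))"
proof -
  have "r + (q + (l + (m - (r + q + l)))) = m" "r + (q + (l + (t - (r + q + l)))) = t"
    using assms by auto
  then show ?thesis
    unfolding one_mat_eq_rect_diag dual_diag_eq_rect_diag zero_mat_eq_rect_diag
      diag_block_mat_rect_diag[OF diag_block_mat_rect_diag[OF diag_block_mat_rect_diag[OF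
        diag_block_mat_singleton]]]
    by (auto simp: cosines_def diff_diff_left intro!: rect_diag_cong)
qed

text \<open>The second block of \<open>\<Sigma>\<^sub>B\<close> is rectangular, so the diagonal of the whole matrix is broken there; it is
grouped with the first block, and the last two blocks form a diagonal square.\<close>
lemma sine_blocks:
  assumes "r1 \<le> r" "r + q \<le> t" "t + r1 \<le> p + r"
  shows "diag_block_mat [dual_diag r1 (\<lambda>i. Dual 0 (\<sigma> i)), 0\<^sub>m (p + r - (t + r1)) (r - r1),
      dual_diag q s, 1\<^sub>m (t - (r + q))] =
    four_block_mat
      (rect_diag (p + r - t) r (\<lambda>i. if i < r1 then dq_of_dual (Dual 0 (\<sigma> i)) else 0))
      (0\<^sub>m (p + r - t) (t - r)) (0\<^sub>m (t - r) r)
      (rect_diag (t - r) (t - r) (\<lambda>i. if i < q then dq_of_dual (s i) else 1))"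
proof -
  have dims: "r1 + (p + r - (t + r1)) = p + r - t" "r1 + (r - r1) = r" "q + (t - (r + q)) = t - r"
    using assms by auto
  have top: "diag_block_mat [dual_diag r1 (\<lambda>i. Dual 0 (\<sigma> i)), 0\<^sub>m (p + r - (t + r1)) (r - r1)] =
      rect_diag (p + r - t) r (\<lambda>i. if i < r1 then dq_of_dual (Dual 0 (\<sigma> i)) else 0)"
    unfolding dual_diag_eq_rect_diag zero_mat_eq_rect_diag
      diag_block_mat_rect_diag[OF diag_block_mat_singleton] dims ..
  have bottom: "diag_block_mat [dual_diag q s, 1\<^sub>m (t - (r + q))] =
      rect_diag (t - r) (t - r) (\<lambda>i. if i < q then dq_of_dual (s i) else 1)"
    unfolding dual_diag_eq_rect_diag one_mat_eq_rect_diag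
      diag_block_mat_rect_diag[OF diag_block_mat_singleton] dims ..
  show ?thesis
    using diag_block_mat_append[of "[dual_diag r1 (\<lambda>i. Dual 0 (\<sigma> i)), 0\<^sub>m (p + r - (t + r1)) (r - r1)]"
      "[dual_diag q s, 1\<^sub>m (t - (r + q))]"]
    unfolding top bottom Let_def append.simps by simp
qed

theorem theorem4p2:
  fixes A B :: "quat dual mat" and m n p t :: nat
  assumes "A \<in> carrier_mat m n" and "B \<in> carrier_mat p n"
    and "Arank (A @\<^sub>r B) = t"
  shows "\<exists>U V X. dq_unitary m U \<and> dq_unitary p V \<and> X \<in> carrier_mat n n \<and>
    (\<exists>(r::nat) (r1::nat) (q::nat) (l::nat)
        (\<sigma> :: nat \<Rightarrow> real) (\<xi> :: nat \<Rightarrow> real) (c :: nat \<Rightarrow> real dual) (s :: nat \<Rightarrow> real dual).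
      r1 \<le> r \<and> r + q + l \<le> m \<and> r + q + l \<le> t \<and> t + r1 \<le> p + r \<and> t \<le> n \<and>
      (\<forall>i<r1. 0 < \<sigma> i) \<and> monotone_on {..<r1} (\<le>) (\<ge>) \<sigma> \<and>
      (\<forall>i<l. 0 < \<xi> i) \<and> monotone_on {..<l} (\<le>) (\<ge>) \<xi> \<and>
      (\<forall>i<q. appreciable (c i) \<and> 0 < c i \<and> c i < 1) \<and> monotone_on {..<q} (\<le>) (\<le>) c \<and>
      (\<forall>i<q. appreciable (s i) \<and> 0 < s i \<and> s i < 1) \<and> monotone_on {..<q} (\<le>) (\<ge>) s \<and>
      (\<forall>i<q. (c i)^2 + (s i)^2 = 1) \<and>
      dq_adjoint U * A * X =
        append_cols
          (diag_block_mat
            [1\<^sub>m r,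
             dual_diag q c,
             dual_diag l (\<lambda>i. Dual 0 (\<xi> i)),
             0\<^sub>m (m - (r + q + l)) (t - (r + q + l))])
          (0\<^sub>m m (n - t)) \<and>
      dq_adjoint V * B * X =
        append_cols
          (diag_block_mat
            [dual_diag r1 (\<lambda>i. Dual 0 (\<sigma> i)),
             0\<^sub>m (p + r - (t + r1)) (r - r1),
             dual_diag q s,
             1\<^sub>m (t - (r + q))])
          (0\<^sub>m p (n - t)))"
proof -
  note A = assms(1) and B = assms(2)
  obtain Z where tn: "t \<le> n" and Z: "Z \<in> carrier_mat n t"
    and gram: "adjoint (A * Z) * (A * Z) + adjoint (B * Z) * (B * Z) = 1\<^sub>m t"
    using orthonormal_reduction[OF assms] by metis
  have AZ: "A * Z \<in> carrier_mat m t" and BZ: "B * Z \<in> carrier_mat p t" using A B Z by auto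
  show ?thesis
  proof (rule cs_decomposition[OF AZ BZ gram])
  fix U V Y r r1 q l \<sigma> \<xi> c
  assume U: "unitary m U" and V: "unitary p V" and Y: "unitary t Y"
    and dims: "r1 \<le> r" "r + q + l \<le> m" "r + q + l \<le> t" "t + r1 \<le> p + r"
    and \<sigma>: "\<And>i. i < r1 \<Longrightarrow> 0 < \<sigma> i" "\<And>i j. i \<le> j \<Longrightarrow> j < r1 \<Longrightarrow> \<sigma> j \<le> \<sigma> i"
    and \<xi>: "\<And>i. i < l \<Longrightarrow> 0 < \<xi> i" "\<And>i j. i \<le> j \<Longrightarrow> j < l \<Longrightarrow> \<xi> j \<le> \<xi> i"
    and c: "\<And>i. i < q \<Longrightarrow> 0 < st_part (c i) \<and> st_part (c i) < 1"
      "\<And>i j. i \<le> j \<Longrightarrow> j < q \<Longrightarrow> c i \<le> c j"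
    and UAY: "adjoint U * (A * Z) * Y = rect_diag m t (\<lambda>i. dq_of_dual (cosines r q l c \<xi> i))"
    and VBY: "adjoint V * (B * Z) * Y = four_block_mat
       (rect_diag (p + r - t) r (\<lambda>i. if i < r1 then dq_of_dual (Dual 0 (\<sigma> i)) else 0))
       (0\<^sub>m (p + r - t) (t - r)) (0\<^sub>m (t - r) r)
       (rect_diag (t - r) (t - r) (\<lambda>i. if i < q then dq_of_dual (complementary_sine (c i)) else 1))"
  define s where "s i = complementary_sine (c i)" for i
  define X where "X = append_cols (Z * Y) (0\<^sub>m n (n - t))"
  have ZY: "Z * Y \<in> carrier_mat n t" using Z unitaryD(1)[OF Y] by auto
  have X: "X \<in> carrier_mat n n"
    using append_cols_carrier[OF ZY zero_carrier_mat[of n "n - t"]] tn by (simp add: X_def)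
  have times_X: "adjoint T * M * X = append_cols (adjoint T * (M * Z) * Y) (0\<^sub>m k (n - t))"
    if T: "unitary k T" and M: "M \<in> carrier_mat k n" for k T M
  proof -
    note cT = unitaryD(2)[OF T] and cY = unitaryD(1)[OF Y]
    have TM: "adjoint T * M \<in> carrier_mat k n" using cT M by auto
    have "adjoint T * M * (Z * Y) = adjoint T * M * Z * Y"
      by (rule assoc_mult_mat[OF TM Z cY, symmetric])
    also have "adjoint T * M * Z = adjoint T * (M * Z)"
      by (rule assoc_mult_mat[OF cT M Z])
    finally show ?thesis
      unfolding X_def mult_append_cols_zero[OF TM ZY] by simp
  qed
  have c_bounds: "appreciable (c i) \<and> 0 < c i \<and> c i < 1" if "i < q" for i
    using c(1)[OF that] by (auto simp: appreciable_def less_dual_def)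
  have s_bounds: "appreciable (s i) \<and> 0 < s i \<and> s i < 1" if "i < q" for i
    using c(1)[OF that] complementary_sine(1)[of "c i"] complementary_sine_less_1[of "c i"]
    by (auto simp: s_def appreciable_def less_dual_def)
  have pythagoras: "(c i)\<^sup>2 + (s i)\<^sup>2 = 1" if "i < q" for i
    using c(1)[OF that] complementary_sine(2)[of "c i"] by (simp add: s_def power2_eq_square)
  have s_mono: "s j \<le> s i" if "i \<le> j" "j < q" for i j
    using c(1)[of i] c(1)[of j] c(2)[OF that] that
    by (auto simp: s_def intro!: complementary_sine_antimono)
  have UAX: "adjoint U * A * X = append_cols (diag_block_mat [1\<^sub>m r, dual_diag q c,
      dual_diag l (\<lambda>i. Dual 0 (\<xi> i)), 0\<^sub>m (m - (r + q + l)) (t - (r + q + l))]) (0\<^sub>m m (n - t))"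
    unfolding times_X[OF U A] UAY cosine_blocks[OF dims(2,3)] ..
  have VBX: "adjoint V * B * X = append_cols (diag_block_mat [dual_diag r1 (\<lambda>i. Dual 0 (\<sigma> i)),
      0\<^sub>m (p + r - (t + r1)) (r - r1), dual_diag q s, 1\<^sub>m (t - (r + q))]) (0\<^sub>m p (n - t))"
  proof -
    have "r + q \<le> t" using dims by simp
    from sine_blocks[OF dims(1) this dims(4)] show ?thesis
      unfolding times_X[OF V B] VBY s_def by simp
  qed
  have props: "\<forall>i<r1. 0 < \<sigma> i" "monotone_on {..<r1} (\<le>) (\<ge>) \<sigma>"
    "\<forall>i<l. 0 < \<xi> i" "monotone_on {..<l} (\<le>) (\<ge>) \<xi>"
    "\<forall>i<q. appreciable (c i) \<and> 0 < c i \<and> c i < 1" "monotone_on {..<q} (\<le>) (\<le>) c"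
    "\<forall>i<q. appreciable (s i) \<and> 0 < s i \<and> s i < 1" "monotone_on {..<q} (\<le>) (\<ge>) s"
    "\<forall>i<q. (c i)^2 + (s i)^2 = 1"
    using \<sigma> \<xi> c(2) c_bounds s_bounds pythagoras s_mono by (simp_all add: monotone_on_def)
  show ?thesis
    unfolding dq_unitary_eq_unitary dq_adjoint_eq_adjoint
  proof (rule exI[of _ U], rule exI[of _ V], rule exI[of _ X], intro conjI, goal_cases)
    case 4
    show ?case
      by (rule exI[of _ r], rule exI[of _ r1], rule exI[of _ q], rule exI[of _ l], rule exI[of _ \<sigma>],
        rule exI[of _ \<xi>], rule exI[of _ c], rule exI[of _ s], intro conjI)
        (rule dims tn props UAX VBX)+
  qed (rule U V X)+
  qed
qed

end
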